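(* Let triangle $ABC$ have angles $(2\alpha,\alpha,2\beta)$ at $(A,B,C)$ respectively, and suppose $ABC$ is $N$-tiled by a tile with angles $(\alpha,\beta,\gamma)$ and sides $(a,b,c)$. Let the tiles be colored alternately black and white with a black tile at $B$, and let $M$ be the number of black tiles minus the number of white tiles. Let $s=a/c$. Then $s$ is rational and the following equation is satisfied: $$\frac{N}{M^2}=\frac{(2-s^2)(3-s^2)}{(1-s)^2(2+s)^2}.$$
   Context: An $N$-tiling of a triangle $ABC$ by a triangle $T$ (the tile) is a way of writing $ABC$ as a union of $N$ triangles congruent to $T$ (also called tiles; reflections allowed) overlapping only at their boundaries; tiles need not meet edge-to-edge. The sides $a,b,c$ of the tile are opposite its angles $\alpha,\beta,\gamma$ respectively. "Colored alternately" means that any two tiles whose boundaries share a line segment of positive length have opposite colors. Since the angles of $ABC$ add up to $\pi$, one has $3\alpha+2\beta=\pi$.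
   Formalization: Added hypothesis: triangle ABC is not similar to the tile. This excludes only α=π/7, β=2π/7, γ=4π/7, where the claim fails (ABC equal to the tile, N=M=1, and s=sin(π/7)/sin(4π/7) is irrational). *)

theory Defs
  imports "HOL-Analysis.Analysis"
begin

type_synonym point = "real^2"

text \<open>Triangles are the closed solid triangles. Non-degeneracy is not built in; it is
  the separate condition \<open>\<not> collinear {A, B, C}\<close>.\<close>

definition tri :: "point \<Rightarrow> point \<Rightarrow> point \<Rightarrow> point set" where
  "tri A B C = convex hull {A, B, C}"

text \<open>\<open>angle X Y Z\<close> is the unoriented angle with apex \<open>Y\<close>, with values in \<open>[0, pi]\<close>.\<close>

definition angle :: "point \<Rightarrow> point \<Rightarrow> point \<Rightarrow> real" where
  "angle X Y Z = arccos (inner (X - Y) (Z - Y) / (norm (X - Y) * norm (Z - Y)))"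

definition triangle_with_angles ::
    "point \<Rightarrow> point \<Rightarrow> point \<Rightarrow> real \<Rightarrow> real \<Rightarrow> real \<Rightarrow> bool" where
  "triangle_with_angles A B C x y z \<longleftrightarrow>
     \<not> collinear {A, B, C} \<and> angle B A C = x \<and> angle C B A = y \<and> angle A C B = z"

text \<open>Arbitrary isometries and similitudes are allowed, in particular reflections.\<close>

definition congruent_sets :: "point set \<Rightarrow> point set \<Rightarrow> bool" where
  "congruent_sets S T \<longleftrightarrow>
     (\<exists>f :: point \<Rightarrow> point. (\<forall>x y. dist (f x) (f y) = dist x y) \<and> S = f ` T)"

definition similar_sets :: "point set \<Rightarrow> point set \<Rightarrow> bool" where
  "similar_sets S T \<longleftrightarrow>
     (\<exists>(f :: point \<Rightarrow> point) k. k > 0 \<and> (\<forall>x y. dist (f x) (f y) = k * dist x y) \<and> S = f ` T)"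

definition tiling :: "nat \<Rightarrow> point set set \<Rightarrow> point set \<Rightarrow> point set \<Rightarrow> bool" where
  "tiling N \<T> S T \<longleftrightarrow>
     finite \<T> \<and> card \<T> = N \<and> \<Union>\<T> = S \<and>
     (\<forall>t\<in>\<T>. congruent_sets t T) \<and>
     (\<forall>t\<in>\<T>. \<forall>u\<in>\<T>. t \<noteq> u \<longrightarrow> t \<inter> u \<subseteq> frontier t \<inter> frontier u)"

text \<open>A colouring is given by the set \<open>Black\<close> of black tiles; all other tiles are white.\<close>

definition colored_alternately :: "point set set \<Rightarrow> point set set \<Rightarrow> bool" where
  "colored_alternately \<T> Black \<longleftrightarrow>
     Black \<subseteq> \<T> \<and>
     (\<forall>t\<in>\<T>. \<forall>u\<in>\<T>. t \<noteq> u \<and>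
        (\<exists>x y. x \<noteq> y \<and> closed_segment x y \<subseteq> frontier t \<inter> frontier u) \<longrightarrow>
        (t \<in> Black \<longleftrightarrow> u \<notin> Black))"

end

theory Submission
  imports Defs "HOL-Number_Theory.Cong"
begin

text \<open>
  Scale the tile so that \<open>c = 1\<close>. Then \<open>s = - 2 cos \<gamma>\<close> and \<open>b = 1 - s^2\<close>; if \<open>y\<close> is the length
  of \<open>AC\<close>, then \<open>BC = (2 - s^2) y\<close> and \<open>AB = (1 - s^2) (3 - s^2) y\<close>, and comparing areas gives
  \<open>N = y^2 (2 - s^2) (3 - s^2)\<close>. On every line, the tile edges, signed by the side on which the
  tile lies, have the same total length as the edges of \<open>ABC\<close>.

  If \<open>\<gamma>\<close> is not a rational multiple of \<open>pi\<close>, the directions \<open>\<plusminus> e^(i k \<gamma>)\<close> can be weighted by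
  \<open>\<plusminus> \<eta>^k\<close> for \<open>\<eta> = 1\<close> and for \<open>\<eta> = - 1\<close>. Summing the weighted edge lengths over all tiles yields
  \<open>AB + BC - AC = M' (b + c - a)\<close> for \<open>\<eta> = 1\<close>. For \<open>\<eta> = - 1\<close> the weight is, up to a global sign,
  the colour of the tile, and the result is \<open>AB + BC - AC = \<plusminus> M (a + b + c)\<close>. The quotient of the two
  equations shows that \<open>(2 - s^2) / s\<close> is rational, and then the area equation is linear in \<open>s\<close>.

  If \<open>\<gamma> = 2 pi k / n\<close>, every integer polynomial equation for \<open>s\<close> is inherited by its conjugates
  \<open>- 2 cos (2 pi j / n)\<close>. The lengths \<open>AC\<close> and \<open>BC\<close> are combinations of \<open>a\<close>, \<open>b\<close>, \<open>c\<close> with natural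
  coefficients, so \<open>s\<close> is a root of an integer polynomial of degree at most four and has at most four
  conjugates. Positivity of \<open>N\<close> at the conjugates leaves four values of \<open>n\<close>, of which only
  \<open>n = 7\<close> is consistent, and then \<open>ABC\<close> is similar to the tile.
\<close>

section \<open>Conjugates of cosines of rational angles\<close>

text \<open>Tiles need not meet edge-to-edge, so edges cannot be paired off; what survives is a
  balance of signed lengths on each line. A weight on directions that is odd turns this balance into
  an identity between a sum over all tiles and a sum over \<open>ABC\<close>. Since
  \<open>\<alpha> = 2 * \<gamma> - pi\<close> and \<open>\<beta> = 2 * pi - 3 * \<gamma>\<close>,
  the edge directions of one tile differ only by signs and powers of \<open>cis \<gamma>\<close>.
  The weights are unambiguous because no nonzero power of \<open>cis \<gamma>\<close> is real, and
  this is where irrationality of \<open>\<gamma> / pi\<close> enters. The equation for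
  \<open>\<eta> = - 1\<close> together with the area already gives the formula for
  \<open>N / M\<^sup>2\<close>; the weight with \<open>\<eta> = 1\<close>, which ignores the
  colours, is there for the rationality of \<open>s\<close>. At \<open>\<gamma> = 4 * pi / 7\<close>
  the tile itself has the angles required of \<open>ABC\<close> while \<open>s\<close> is
  irrational, so the tiling by a single tile shows why similarity of \<open>ABC\<close> to the tile
  must be excluded.\<close>

lemma rational_functional_exists:
  fixes \<theta> :: complex
  assumes "\<theta> \<noteq> 0"
  shows "\<exists>l :: complex \<Rightarrow> rat. (\<forall>x y. l (x + y) = l x + l y) \<and> (\<forall>q x. l (of_rat q * x) = q * l x) \<and> l \<theta> = 1"
proof -
  interpret V: vector_space "\<lambda>(q::rat) (z::complex). of_rat q * z"
    by unfold_locales (auto simp: algebra_simps of_rat_add of_rat_mult)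
  have ind: "V.independent {\<theta>}" using assms by (simp add: V.dependent_single)
  define B where "B = V.extend_basis {\<theta>}"
  have B: "V.independent B" "V.span B = UNIV" "\<theta> \<in> B"
    using V.independent_extend_basis[OF ind] V.span_extend_basis[OF ind] V.extend_basis_superset[OF ind]
    by (auto simp: B_def)
  let ?l = "\<lambda>v. V.representation B v \<theta>"
  have "?l (x + y) = ?l x + ?l y" for x y
    using V.representation_add[OF B(1)] B(2) by simp
  moreover have "?l (of_rat q * x) = q * ?l x" for q x
    using V.representation_scale[OF B(1)] B(2) by simp
  moreover have "?l \<theta> = 1" by (simp add: V.representation_basis[OF B(1) B(3)])
  ultimately show ?thesis by (intro exI[of _ ?l]) simp
qed

lemma root_of_unity_power_mod:
  fixes w :: "'a::monoid_mult"
  assumes "w ^ n = 1"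
  shows "w ^ (i mod n) = w ^ i"
proof -
  have "w ^ i = w ^ (n * (i div n) + i mod n)" by simp
  also have "\<dots> = w ^ (i mod n)" by (simp only: power_add power_mult assms) simp
  finally show ?thesis by simp
qed

text \<open>\<open>D\<close> is a common denominator of the values \<open>l (w ^ i)\<close> of a \<open>\<rat>\<close>-linear functional with
  \<open>l \<theta> = 1\<close>; this replaces norms and minimal polynomials.\<close>

lemma divisor_of_nonzero_bounded:
  fixes w \<theta> :: complex
  assumes w: "w ^ n = 1" "n > 0" and \<theta>: "\<theta> \<noteq> 0"
  shows "\<exists>D::nat. D > 0 \<and> (\<forall>p h. \<theta> = of_nat p * poly (map_poly of_int h) w \<longrightarrow> p dvd D)"
proof -
  obtain l :: "complex \<Rightarrow> rat" where add: "\<And>x y. l (x + y) = l x + l y"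
    and scale: "\<And>q x. l (of_rat q * x) = q * l x" and l1: "l \<theta> = 1"
    using rational_functional_exists[OF \<theta>] by blast
  have "\<exists>d::nat. d > 0 \<and> of_nat d * l (w ^ k) \<in> \<int>" for k
  proof -
    obtain a b where ab: "quotient_of (l (w ^ k)) = (a, b)" by fastforce
    have b: "b > 0" using quotient_of_denom_pos[OF ab] .
    have "l (w ^ k) = of_int a / of_int b" using quotient_of_div[OF ab] .
    hence "of_nat (nat b) * l (w ^ k) = of_int a" using b by (simp add: of_nat_nat)
    thus ?thesis using b by (intro exI[of _ "nat b"]) auto
  qed
  then obtain d :: "nat \<Rightarrow> nat" where d: "\<And>k. d k > 0" "\<And>k. of_nat (d k) * l (w ^ k) \<in> \<int>" by metis
  \<comment> \<open>There are at most \<open>n\<close> different powers of \<open>w\<close>, so this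
    finite product clears the denominators of all of them.\<close>
  define D where "D = (\<Prod>k<n. d k)"
  have Dpos: "D > 0" using d(1) by (simp add: D_def prod_pos)
  have D: "of_nat D * l (w ^ i) \<in> \<int>" for i
  proof -
    have "w ^ i = w ^ (i mod n)"
      using root_of_unity_power_mod[OF w(1)] by simp
    moreover obtain c where "D = d (i mod n) * c"
      using w(2) by (metis D_def dvd_def dvd_prodI finite_lessThan lessThan_iff mod_less_divisor)
    ultimately have "of_nat D * l (w ^ i) = of_nat c * (of_nat (d (i mod n)) * l (w ^ (i mod n)))" by simp
    thus ?thesis using d(2) by (simp add: Ints_mult)
  qed
  have l0: "l 0 = 0" using add[of 0 0] by simp
  have lsum: "l (sum f A) = (\<Sum>i\<in>A. l (f i))" if "finite A" for f and A :: "nat set"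
    using that by (induction A) (auto simp: l0 add)
  have lint: "l (of_int m * x) = of_int m * l x" for m x
    using scale[of "of_int m" x] by simp
  have "p dvd D" if "\<theta> = of_nat p * poly (map_poly of_int h) w" for p h
  proof -
    let ?h = "poly (map_poly of_int h) w"
    have "of_nat D * l ?h = (\<Sum>i\<le>degree (map_poly of_int h :: complex poly). of_int (coeff h i) * (of_nat D * l (w ^ i)))"
      by (simp add: poly_altdef coeff_map_poly lsum lint sum_distrib_left mult.left_commute)
    also have "\<dots> \<in> \<int>" by (intro Ints_sum Ints_mult[of "of_int _"] D) auto
    finally have "of_nat D * l ?h \<in> \<int>" .
    then obtain z where z: "of_nat D * l ?h = of_int z" by (auto elim: Ints_cases)
    have "1 = of_nat p * l ?h" using l1 that lint[of "int p" ?h] by simp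
    hence "of_nat D = of_nat p * (of_nat D * l ?h)" by (simp add: mult_ac)
    hence "(of_int (int D) :: rat) = of_int (int p * z)" using z by simp
    hence "int D = int p * z" by (simp only: of_int_eq_iff)
    thus "p dvd D" by (metis dvd_triv_left int_dvd_int_iff)
  qed
  thus ?thesis using Dpos by blast
qed

section \<open>The Frobenius congruence for integer polynomials\<close>

lemma prime_power_add_cong:
  fixes x y :: "'a::comm_ring_1"
  assumes "prime p"
  shows "\<exists>h. (x + y) ^ p = x ^ p + y ^ p + of_nat p * h"
proof -
  have p: "p > 0" using assms prime_gt_0_nat by blast
  have "\<exists>q. of_nat (p choose k) * x ^ k * y ^ (p - k) = of_nat p * q" if "k \<in> {1..<p}" for k
  proof -
    have "p dvd (p choose k)" using that assms by (intro dvd_choose_prime) auto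
    then obtain c where "p choose k = p * c" by (elim dvdE)
    thus ?thesis by (intro exI[of _ "of_nat c * x ^ k * y ^ (p - k)"]) (simp add: mult_ac)
  qed
  then obtain q where q: "\<And>k. k \<in> {1..<p} \<Longrightarrow> of_nat (p choose k) * x ^ k * y ^ (p - k) = of_nat p * q k" by metis
  have "{..p} = insert 0 (insert p {1..<p})" using p by auto
  hence "(x + y) ^ p = y ^ p + (x ^ p + (\<Sum>k\<in>{1..<p}. of_nat (p choose k) * x ^ k * y ^ (p - k)))"
    using p by (simp add: binomial_ring)
  also have "(\<Sum>k\<in>{1..<p}. of_nat (p choose k) * x ^ k * y ^ (p - k)) = of_nat p * (\<Sum>k\<in>{1..<p}. q k)"
    by (simp add: q sum_distrib_left)
  finally show ?thesis by (intro exI[of _ "\<Sum>k\<in>{1..<p}. q k"]) simp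
qed

lemma int_fermat_little:
  fixes a :: int
  assumes "prime p"
  shows "int p dvd a ^ p - a"
proof -
  have p: "p > 0" using assms prime_gt_0_nat by blast
  have nat: "int p dvd int b ^ p - int b" for b
  proof (induction b)
    case 0
    show ?case using p by (simp add: power_0_left)
  next
    case (Suc b)
    obtain h where "(int b + 1) ^ p = int b ^ p + 1 ^ p + of_nat p * h"
      using prime_power_add_cong[OF assms] by blast
    hence "int (Suc b) ^ p - int (Suc b) = (int b ^ p - int b) + int p * h" by (simp add: algebra_simps)
    thus ?case using Suc by (metis dvd_add dvd_triv_left)
  qed
  have "int p dvd (a mod int p) ^ p - a mod int p"
    using nat[of "nat (a mod int p)"] p by (metis int_nat_eq of_nat_0_less_iff pos_mod_sign)
  moreover have "[(a mod int p) ^ p - a mod int p = a ^ p - a] (mod int p)"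
    by (intro cong_diff cong_pow cong_mod_leftI cong_refl)
  ultimately show ?thesis using cong_dvd_iff by blast
qed

text \<open>Modulo \<open>p\<close>, taking \<open>p\<close>-th powers is additive and, by Fermat,
  fixes the coefficients; the induction adds one coefficient at a time.\<close>

lemma int_poly_frobenius:
  fixes F :: "int poly"
  assumes "prime p"
  shows "\<exists>h. F ^ p = pcompose F (monom 1 p) + of_nat p * h"
proof (induction F)
  case 0
  have "p > 0" using assms prime_gt_0_nat by blast
  thus ?case by (intro exI[of _ 0]) (simp add: power_0_left)
next
  case (pCons a F)
  obtain h where h: "F ^ p = pcompose F (monom 1 p) + of_nat p * h" using pCons by blast
  obtain c where c: "a ^ p = a + int p * c" using int_fermat_little[OF assms, of a] by (metis dvdE add_diff_cancel_left' diff_add_cancel add.commute)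
  obtain g where g: "([:a:] + [:0, 1:] * F) ^ p = [:a:] ^ p + ([:0, 1:] * F) ^ p + of_nat p * g"
    using prime_power_add_cong[OF assms] by blast
  have X: "([:0, 1:] :: int poly) ^ p = monom 1 p" by (simp add: monom_altdef)
  have A: "[:a:] ^ p = [:a:] + of_nat p * [:c:]" 
    using c by (simp add: poly_const_pow of_nat_poly)
  have "pCons a F = [:a:] + [:0, 1:] * F" by simp
  hence "pCons a F ^ p = ([:a:] + of_nat p * [:c:]) + monom 1 p * (pcompose F (monom 1 p) + of_nat p * h) + of_nat p * g"
    using g by (simp only: power_mult_distrib X A h)
  also have "\<dots> = pcompose (pCons a F) (monom 1 p) + of_nat p * ([:c:] + monom 1 p * h + g)"
    by (simp add: pcompose_pCons algebra_simps)
  finally show ?case by blast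
qed

lemma map_poly_of_int_hom:
  fixes f g :: "int poly"
  shows "map_poly (of_int :: int \<Rightarrow> 'a::{comm_ring_1,ring_char_0}) (f + g) = map_poly of_int f + map_poly of_int g"
    and "map_poly (of_int :: int \<Rightarrow> 'a) (f * g) = map_poly of_int f * map_poly of_int g"
  by (auto intro!: poly_eqI simp: coeff_map_poly coeff_mult)

lemma ipoly_hom [simp]:
  fixes x :: "'a::{comm_ring_1,ring_char_0}"
  shows "poly (map_poly of_int (f + g)) x = poly (map_poly of_int f) x + poly (map_poly of_int g) x"
    and "poly (map_poly of_int (f * g)) x = poly (map_poly of_int f) x * poly (map_poly of_int g) x"
    and "poly (map_poly of_int (f ^ m)) x = poly (map_poly of_int f) x ^ m"
proof -
  show *: "poly (map_poly of_int (f * g)) x = poly (map_poly of_int f) x * poly (map_poly of_int g) x" for f g :: "int poly"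
    by (simp add: map_poly_of_int_hom)
  show "poly (map_poly of_int (f ^ m)) x = poly (map_poly of_int f) x ^ m"
    by (induction m) (simp_all add: * map_poly_1')
qed (simp add: map_poly_of_int_hom)

lemma ipoly_pcompose_monom:
  fixes x :: "'a::{comm_ring_1,ring_char_0}"
  shows "poly (map_poly of_int (pcompose f (monom 1 p))) x = poly (map_poly of_int f) (x ^ p)"
proof (induction f)
  case (pCons a f)
  have "poly (map_poly of_int (monom 1 p)) x = x ^ p" by (simp add: map_poly_monom poly_monom)
  thus ?case using pCons by (simp add: pcompose_pCons map_poly_pCons)
qed simp

text \<open>Since \<open>F ^ p\<close> and \<open>F (X ^ p)\<close> agree modulo \<open>p\<close>, the value \<open>F (w ^ (k * p))\<close> is \<open>p\<close> times an
  element of \<open>\<int>[w]\<close>, which is impossible for large \<open>p\<close> unless it vanishes.\<close>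

lemma ipoly_root_of_unity_large_prime:
  fixes w :: complex and F :: "int poly"
  assumes w: "w ^ n = 1" "n > 0"
  shows "\<exists>B. \<forall>p k. prime p \<longrightarrow> p > B \<longrightarrow> poly (map_poly of_int F) (w ^ k) = 0 \<longrightarrow>
    poly (map_poly of_int F) (w ^ (k * p)) = 0"
proof -
  have wmod: "w ^ i = w ^ (i mod n)" for i
    using root_of_unity_power_mod[OF w(1)] by simp
  let ?v = "\<lambda>k. poly (map_poly of_int F) (w ^ k)"
  have "\<forall>k. \<exists>D::nat. D > 0 \<and> (?v k \<noteq> 0 \<longrightarrow> (\<forall>p h. ?v k = of_nat p * poly (map_poly of_int h) w \<longrightarrow> p dvd D))"
    (is "\<forall>k. \<exists>D. ?P k D")
  proof
    fix k
    show "\<exists>D. ?P k D" using divisor_of_nonzero_bounded[OF w, of "?v k"] by (cases "?v k = 0") auto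
  qed
  from choice[OF this] obtain D where D: "\<And>k. ?P k (D k)" by blast
  have "?v (k * p) = 0" if p: "prime p" "p > (\<Sum>i<n. D i)" "?v k = 0" for p k
  proof (rule ccontr)
    assume nz: "?v (k * p) \<noteq> 0"
    define i where "i = k * p mod n"
    have i: "?v i = ?v (k * p)" "i < n" using wmod[of "k * p"] w(2) by (auto simp: i_def)
    obtain h where h: "F ^ p = pcompose F (monom 1 p) + of_nat p * h" using int_poly_frobenius[OF p(1)] by blast
    have op: "poly (map_poly of_int (of_nat p * h)) x = of_nat p * poly (map_poly of_int h) x" for x :: complex
      by (simp add: of_nat_poly map_poly_pCons ipoly_hom(2) del: mult_pCons_left)
    have "poly (map_poly of_int (F ^ p)) (w ^ k) = 0" using p prime_gt_0_nat by auto
    hence "0 = ?v (k * p) + of_nat p * poly (map_poly of_int h) (w ^ k)"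
      by (simp add: h op ipoly_pcompose_monom power_mult del: ipoly_hom(2,3))
    also have "poly (map_poly of_int h) (w ^ k) = poly (map_poly of_int (pcompose h (monom 1 k))) w"
      by (simp add: ipoly_pcompose_monom)
    finally have "?v i = of_nat p * poly (map_poly of_int ([:-1:] * pcompose h (monom 1 k))) w"
      using i by (simp add: ipoly_hom(2) map_poly_pCons eq_neg_iff_add_eq_0 add.commute del: mult_pCons_left)
    hence "p dvd D i" using D[of i] i nz by auto
    hence "p \<le> D i" using D by (simp add: dvd_imp_le)
    also have "D i \<le> (\<Sum>i<n. D i)" using i by (intro member_le_sum) auto
    finally show False using p by simp
  qed
  thus ?thesis by blast
qed


text \<open>The large-prime lemma says nothing about small prime factors of \<open>j\<close>. The
  class of \<open>j\<close> modulo \<open>n\<close> however contains a number all of whose prime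
  factors exceed the bound, and this exponent is reached one prime at a time. Such a number is
  written down directly, without primes in arithmetic progressions.\<close>

lemma ipoly_root_of_unity_conjugate:
  fixes w :: complex and F :: "int poly"
  assumes w: "w ^ n = 1" "n > 0" and "coprime j n" and F: "poly (map_poly of_int F) w = 0"
  shows "poly (map_poly of_int F) (w ^ j) = 0"
proof -
  obtain B where B: "\<And>p k. prime p \<Longrightarrow> p > B \<Longrightarrow> poly (map_poly of_int F) (w ^ k) = 0 \<Longrightarrow>
    poly (map_poly of_int F) (w ^ (k * p)) = 0"
    using ipoly_root_of_unity_large_prime[OF w] by blast
  have rough: "poly (map_poly of_int F) (w ^ m) = 0" if "m > 0" "\<And>q. prime q \<Longrightarrow> q dvd m \<Longrightarrow> q > B" for m
    using that
  proof (induction m rule: less_induct)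
    case (less m)
    show ?case
    proof (cases "m = 1")
      case False
      then obtain p where p: "prime p" "p dvd m" using prime_factor_nat by blast
      then obtain k where k: "m = k * p" by (metis dvdE mult.commute)
      have "k < m" using k less.prems(1) prime_gt_1_nat[OF p(1)] by simp
      hence "poly (map_poly of_int F) (w ^ k) = 0" using less k by (metis dvd_mult2 nat_0_less_mult_iff)
      thus ?thesis using B p less.prems(2) k by blast
    qed (use F in simp)
  qed
  \<comment> \<open>A prime \<open>q \<le> B\<close> divides exactly one of \<open>j\<close> and
    \<open>n * \<Prod>S\<close>: if it divides \<open>j\<close>, it is prime to \<open>n\<close> by
    coprimality and not in \<open>S\<close>; otherwise it lies in \<open>S\<close>. So it never
    divides the sum.\<close>
  define S where "S = {q. prime q \<and> q \<le> B \<and> \<not> q dvd j}"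
  define J where "J = j + n * \<Prod>S" \<comment> \<open>congruent to \<open>j\<close> modulo \<open>n\<close>, with all prime factors above \<open>B\<close>\<close>
  have finS: "finite S" by (rule finite_subset[of _ "{..B}"]) (auto simp: S_def)
  have "q > B" if q: "prime q" "q dvd J" for q
  proof (rule ccontr)
    assume qB: "\<not> q > B"
    show False
    proof (cases "q dvd j")
      case True
      hence "q dvd n * \<Prod>S" using q(2) by (simp add: J_def dvd_add_right_iff)
      moreover have "\<not> q dvd n" using True assms(3) q(1) by (meson coprime_common_divisor not_prime_unit)
      ultimately have "q dvd \<Prod>S" using q(1) prime_dvd_mult_iff by blast
      then obtain r where "r \<in> S" "q dvd r" using q(1) finS by (metis prime_dvd_prod_iff)
      thus False using True q(1) by (auto simp: S_def dest: primes_dvd_imp_eq)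
    next
      case False
      hence "q \<in> S" using q qB by (auto simp: S_def)
      hence "q dvd n * \<Prod>S" using dvd_prodI[OF finS, of q "\<lambda>q. q"] by (simp add: dvd_mult)
      thus False using False q(2) by (simp add: J_def dvd_add_left_iff)
    qed
  qed
  moreover have "J > 0"
    using assms(2,3) finS by (cases "j = 0") (auto simp: J_def S_def intro!: prod_pos)
  ultimately have "poly (map_poly of_int F) (w ^ J) = 0" using rough by blast
  moreover have "w ^ J = w ^ j" using w(1) by (simp add: J_def power_add power_mult)
  ultimately show ?thesis by simp
qed

lemma ipoly_of_real:
  "poly (map_poly of_int G) (complex_of_real x) = complex_of_real (poly (map_poly of_int G) x)"
  by (induction G) (auto simp: map_poly_pCons)

section \<open>From roots of unity to cosines\<close>

lemma ipoly_add_inverse: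
  fixes G :: "int poly"
  shows "\<exists>F d. \<forall>w::complex. w \<noteq> 0 \<longrightarrow>
    poly (map_poly of_int F) w = w ^ d * poly (map_poly of_int G) (w + inverse w)"
proof (induction G)
  case 0
  show ?case by (intro exI[of _ 0]) simp
next
  case (pCons a G)
  then obtain F d where F: "\<And>w::complex. w \<noteq> 0 \<Longrightarrow>
    poly (map_poly of_int F) w = w ^ d * poly (map_poly of_int G) (w + inverse w)" by blast
  \<comment> \<open>Of the factors \<open>w ^ Suc d\<close>, one clears the new denominator:
    \<open>w * (w + inverse w) = w\<^sup>2 + 1\<close>.\<close>
  have "poly (map_poly of_int (monom a (Suc d) + [:1, 0, 1:] * F)) w =
      w ^ Suc d * poly (map_poly of_int (pCons a G)) (w + inverse w)" if "w \<noteq> 0" for w :: complex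
    using that F[OF that]
    by (simp add: map_poly_monom poly_monom map_poly_pCons algebra_simps power2_eq_square del: mult_pCons_left)
  thus ?case by blast
qed

lemma ipoly_cos_conjugate:
  fixes G :: "int poly"
  assumes "n > 0" "coprime k n" "coprime j n"
    and "poly (map_poly of_int G) (2 * cos (2 * pi * real k / real n)) = 0"
  shows "poly (map_poly of_int G) (2 * cos (2 * pi * real j / real n)) = 0"
proof -
  obtain F d where F: "\<And>w::complex. w \<noteq> 0 \<Longrightarrow>
    poly (map_poly of_int F) w = w ^ d * poly (map_poly of_int G) (w + inverse w)"
    using ipoly_add_inverse by blast
  have F_cis: "poly (map_poly of_int F) (cis t) = 0 \<longleftrightarrow> poly (map_poly of_int G) (2 * cos t) = 0" for t
  proof -
    have "cis t + inverse (cis t) = complex_of_real (2 * cos t)"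
      by (simp add: complex_eq_iff)
    thus ?thesis using F[of "cis t"] by (simp add: ipoly_of_real del: of_real_mult)
  qed
  \<comment> \<open>Inverting \<open>k\<close> modulo \<open>n\<close> turns the power
    \<open>x * j\<close> of \<open>cis (2 * pi * k / n)\<close> into
    \<open>cis (2 * pi * j / n)\<close>.\<close>
  obtain x where x: "[k * x = 1] (mod n)" using cong_solve_coprime_nat[OF assms(2)] by auto
  hence "coprime x n" by (metis coprime_mult_left_iff coprime_cong_cong_left coprime_1_left)
  hence co: "coprime (x * j) n" using assms(3) by simp
  define w where "w = cis (2 * pi * real k / real n)"
  have w: "w ^ n = 1"
  proof -
    have "real n * (2 * pi * real k / real n) = 2 * pi * real k" using assms(1) by simp
    moreover have "cis (2 * pi * real k) = 1" by (rule cis_multiple_2pi) simp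
    ultimately show ?thesis by (simp only: w_def Complex.DeMoivre)
  qed
  have "poly (map_poly of_int F) w = 0" using assms(4) F_cis by (simp add: w_def)
  hence "poly (map_poly of_int F) (w ^ (x * j)) = 0"
    using ipoly_root_of_unity_conjugate[OF w assms(1) co] by blast
  moreover have "w ^ (x * j) = cis (2 * pi * real j / real n)"
  proof -
    define v where "v = cis (2 * pi / real n)"
    have pow: "v ^ m = cis (2 * pi * real m / real n)" for m
      unfolding v_def Complex.DeMoivre by (simp add: mult_ac)
    have v: "v ^ n = 1" using assms(1) by (simp add: pow)
    have "[k * x * j = 1 * j] (mod n)" using x by (rule cong_scalar_right)
    hence "k * (x * j) mod n = j mod n" by (simp add: cong_def mult.assoc)
    hence "v ^ (k * (x * j)) = v ^ j" using root_of_unity_power_mod[OF v] by metis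
    thus ?thesis by (simp add: w_def flip: pow power_mult)
  qed
  ultimately show ?thesis using F_cis by simp
qed

section \<open>Denominators with few conjugates\<close>

lemma coprime_odd_shift:
  fixes a m n d :: nat
  assumes "odd a" "n = 2 ^ e * m" "d dvd 16" "m = a + d \<or> a = m + d"
  shows "coprime a n"
proof (rule ccontr)
  assume "\<not> coprime a n"
  then obtain p where p: "prime p" "p dvd gcd a n"
    using prime_factor_nat[of "gcd a n"] coprime_iff_gcd_eq_1 by blast
  hence p: "prime p" "p dvd a" "p dvd n" by auto
  have "p \<noteq> 2" using p assms(1) by auto
  hence no2: "\<not> p dvd 2 ^ i" for i
    using p(1) prime_dvd_power[of p 2 i] primes_dvd_imp_eq[of p 2] by auto
  hence "p dvd m" using p assms(2) prime_dvd_mult_iff[OF p(1)] by auto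
  hence "p dvd d" using assms(4) p(2) by (auto simp: dvd_add_right_iff dvd_add_left_iff)
  hence "p dvd 16" using assms(3) dvd_trans by blast
  thus False using no2[of 4] by simp
qed

text \<open>Five residues mean five conjugates of \<open>s\<close>, one too many for the roots of a
  quartic. For odd \<open>n\<close>, powers of two and \<open>(n - 1) / 2\<close> serve; otherwise
  \<open>n / 2\<close>, \<open>n / 4\<close> and \<open>n / 8\<close> are shifted by powers of two,
  which cannot create a common odd prime. The bound excludes \<open>n = 34\<close>, where in the
  case \<open>n = 2 * k\<close> the residue \<open>k - 16\<close> would coincide with 1.\<close>

lemma many_coprime_residues:
  fixes n :: nat
  assumes "n \<ge> 36"
  shows "\<exists>J. J \<subseteq> {j. coprime j n \<and> 2 * j \<le> n} \<and> card J = 5"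
proof -
  consider (1) h where "n = 2 * h + 1" | (2) k where "n = 2 * k" "odd k" | (4) l where "n = 4 * l" "odd l"
    | (8) t where "n = 8 * t" "odd t" | (16) t where "n = 8 * t" "even t"
  proof (cases "odd n")
    case True thus ?thesis using 1 by (elim oddE) auto
  next
    case False
    then obtain k where k: "n = 2 * k" by auto
    show ?thesis
    proof (cases "odd k")
      case False
      then obtain l where l: "k = 2 * l" by auto
      show ?thesis
      proof (cases "odd l")
        case False
        then obtain t where "l = 2 * t" by auto
        thus ?thesis using 8 16 k l by (cases "odd t") auto
      qed (use 4 k l in auto)
    qed (use 2 k in auto)
  qed
  thus ?thesis
  proof cases
    case 1
    have p2: "coprime (2 ^ i) n" for i using 1 by simp
    have "coprime h n"
    proof (rule coprimeI)
      fix c assume "c dvd h" "c dvd n"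
      thus "is_unit c" using 1 by (metis dvd_add_right_iff dvd_mult)
    qed
    hence "{1, 2, 4, 8, h} \<subseteq> {j. coprime j n \<and> 2 * j \<le> n}"
      using 1 assms p2[of 1] p2[of 2] p2[of 3] by auto
    moreover have "card {1, 2, 4, 8, h} = 5" using 1 assms by auto
    ultimately show ?thesis by blast
  next
    case 2
    hence "coprime (k - d) n" if "d \<in> {2, 4, 8, 16}" for d
      using that assms by (intro coprime_odd_shift[of _ n 1 k d]) auto
    hence "{1, k - 2, k - 4, k - 8, k - 16} \<subseteq> {j. coprime j n \<and> 2 * j \<le> n}"
      using 2 assms by auto
    moreover have "card {1, k - 2, k - 4, k - 8, k - 16} = 5"
    proof -
      have "k \<noteq> 18" using 2 by auto
      hence "k \<ge> 19" using 2 assms by auto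
      then obtain i where "k = 19 + i" using le_Suc_ex by blast
      thus ?thesis by simp
    qed
    ultimately show ?thesis by blast
  next
    case 4
    have "coprime (2 * l - 1) n" using 4 assms by (intro coprime_odd_shift[of _ n 1 "2 * l" 1]) auto
    moreover have "coprime (l + 2) n" using 4 assms by (intro coprime_odd_shift[of _ n 2 l 2]) auto
    moreover have "coprime (l - d) n" if "d \<in> {2, 4}" for d
      using 4 assms that by (intro coprime_odd_shift[of _ n 2 l d]) auto
    ultimately have "{1, l - 4, l - 2, l + 2, 2 * l - 1} \<subseteq> {j. coprime j n \<and> 2 * j \<le> n}"
      using 4 assms by auto
    moreover have "card {1, l - 4, l - 2, l + 2, 2 * l - 1} = 5"
    proof -
      have "l \<ge> 9" using 4 assms by auto
      then obtain i where "l = 9 + i" using le_Suc_ex by blast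
      thus ?thesis by simp
    qed
    ultimately show ?thesis by blast
  next
    case 8
    have "coprime (4 * t - 1) n" using 8 assms by (intro coprime_odd_shift[of _ n 1 "4 * t" 1]) auto
    moreover have "coprime (2 * t - 1) n" "coprime (2 * t + 1) n"
      using 8 assms by (intro coprime_odd_shift[of _ n 2 "2 * t" 1]; auto)+
    moreover have "coprime (t + 2) n" using 8 assms by (intro coprime_odd_shift[of _ n 3 t 2]) auto
    ultimately have "{1, t + 2, 2 * t - 1, 2 * t + 1, 4 * t - 1} \<subseteq> {j. coprime j n \<and> 2 * j \<le> n}"
      using 8 assms by auto
    moreover have "card {1, t + 2, 2 * t - 1, 2 * t + 1, 4 * t - 1} = 5"
    proof -
      have "t \<ge> 5" using 8 assms by auto
      then obtain i where "t = 5 + i" using le_Suc_ex by blast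
      thus ?thesis by simp
    qed
    ultimately show ?thesis by blast
  next
    case 16
    have "coprime (4 * t - 1) n" using 16 assms by (intro coprime_odd_shift[of _ n 1 "4 * t" 1]) auto
    moreover have "coprime (2 * t - 1) n" "coprime (2 * t + 1) n"
      using 16 assms by (intro coprime_odd_shift[of _ n 2 "2 * t" 1]; auto)+
    moreover have "coprime (t + 1) n" using 16 assms by (intro coprime_odd_shift[of _ n 3 t 1]) auto
    ultimately have "{1, t + 1, 2 * t - 1, 2 * t + 1, 4 * t - 1} \<subseteq> {j. coprime j n \<and> 2 * j \<le> n}"
      using 16 assms by auto
    moreover have "card {1, t + 1, 2 * t - 1, 2 * t + 1, 4 * t - 1} = 5"
    proof -
      have "t \<ge> 5" using 16 assms by auto
      then obtain i where "t = 5 + i" using le_Suc_ex by blast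
      thus ?thesis by simp
    qed
    ultimately show ?thesis by blast
  qed
qed

text \<open>The alternatives are: a conjugate at which \<open>N\<close> could not be positive, at
  least five conjugates, or a pair that needs its own argument. The range of \<open>k\<close> is
  complete because \<open>3 * k < n < 36\<close>.\<close>

lemma small_denominators:
  "\<forall>n\<in>set [0..<36]. \<forall>k\<in>set [0..<12]. coprime k n \<and> n < 4 * k \<and> 3 * k < n \<longrightarrow>
    (\<exists>j\<in>set [0..<n]. coprime j n \<and> (n < 12 * j \<and> 8 * j < n \<or> 3 * n < 8 * j \<and> 12 * j < 5 * n)) \<or>
    4 < length (filter (\<lambda>j. coprime j n \<and> 2 * j \<le> n) [0..<n]) \<or>
    (n, k) \<in> {(7::nat, 2::nat), (15, 4), (16, 5), (24, 7)}"
  by code_simp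

lemma exceptional_denominators:
  fixes n k :: nat
  assumes "coprime k n" "n < 4 * k" "3 * k < n"
    and card: "\<And>J. J \<subseteq> {j. coprime j n \<and> 2 * j \<le> n} \<Longrightarrow> card J \<le> 4"
    and gap: "\<And>j. coprime j n \<Longrightarrow> \<not> (n < 12 * j \<and> 8 * j < n \<or> 3 * n < 8 * j \<and> 12 * j < 5 * n)"
  shows "(n, k) \<in> {(7, 2), (15, 4), (16, 5), (24, 7)}"
proof -
  have n: "n < 36"
  proof (rule ccontr)
    assume "\<not> n < 36"
    then obtain J where "J \<subseteq> {j. coprime j n \<and> 2 * j \<le> n}" "card J = 5"
      using many_coprime_residues[of n] by auto
    thus False using card[of J] by simp
  qed
  have "length (filter (\<lambda>j. coprime j n \<and> 2 * j \<le> n) [0..<n])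
      = card (set (filter (\<lambda>j. coprime j n \<and> 2 * j \<le> n) [0..<n]))"
    by (metis distinct_card distinct_filter distinct_upt)
  also have "\<dots> \<le> 4" by (intro card) auto
  finally have "\<not> 4 < length (filter (\<lambda>j. coprime j n \<and> 2 * j \<le> n) [0..<n])" by simp
  moreover have "n \<in> set [0..<36]" "k \<in> set [0..<12]" using n assms(3) by auto
  ultimately show ?thesis using small_denominators assms(1-3) gap by blast
qed

section \<open>Tiles whose angles are rational multiples of pi\<close>

text \<open>A conjugate of \<open>s\<close> with square in \<open>{2<..<3}\<close> would make \<open>N = y\<^sup>2 * ((2 - s\<^sup>2) * (3 - s\<^sup>2))\<close>
  non-positive.\<close>

lemma positivity_gap:
  fixes n j :: nat
  assumes "n < 12 * j \<and> 8 * j < n \<or> 3 * n < 8 * j \<and> 12 * j < 5 * n"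
  shows "(2 * cos (2 * pi * real j / real n))\<^sup>2 \<in> {2<..<3}"
proof -
  define x where "x = 2 * pi * real j / real n"
  have n: "n > 0" using assms by auto
  have c: "(2 * cos x)\<^sup>2 = 2 + 2 * cos (2 * x)" by (simp add: cos_double_cos power2_eq_square)
  \<comment> \<open>The two alternatives of the assumption place \<open>2 * x\<close> between
    \<open>pi / 3\<close> and \<open>pi / 2\<close>, or in the mirror image of this interval about
    \<open>pi\<close>.\<close>
  have "0 < cos (2 * x) \<and> cos (2 * x) < 1 / 2"
  proof (cases "n < 12 * j \<and> 8 * j < n")
    case True
    have "real n < 12 * real j" "8 * real j < real n" using True by linarith+
    hence "pi * real n < pi * (12 * real j)" "pi * (8 * real j) < pi * real n" by simp_all
    hence "pi / 3 < 2 * x" "2 * x < pi / 2" using n by (simp_all add: x_def field_simps)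
    thus ?thesis using cos_monotone_0_pi[of "pi / 3" "2 * x"] cos_gt_zero[of "2 * x"] pi_gt_zero
      by (simp add: cos_60 del: pi_gt_zero)
  next
    case False
    hence "3 * real n < 8 * real j" "12 * real j < 5 * real n" using assms by linarith+
    hence "pi * (3 * real n) < pi * (8 * real j)" "pi * (12 * real j) < pi * (5 * real n)" by simp_all
    hence a: "3 * pi / 2 < 2 * x" "2 * x < 5 * pi / 3" using n by (simp_all add: x_def field_simps)
    define z where "z = 2 * pi - 2 * x"
    have "cos (2 * x) = cos z" by (simp add: z_def cos_diff)
    moreover have "pi / 3 < z" "z < pi / 2" using a by (simp_all add: z_def)
    ultimately show ?thesis using cos_monotone_0_pi[of "pi / 3" z] cos_gt_zero[of z] pi_gt_zero
      by (simp add: cos_60 del: pi_gt_zero)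
  qed
  thus ?thesis unfolding x_def[symmetric] c by auto
qed

lemma cos_values_inj:
  fixes n :: nat
  shows "inj_on (\<lambda>j. 2 * cos (2 * pi * real j / real n)) {j. 2 * j \<le> n}"
proof (rule inj_onI)
  fix i j assume ij: "i \<in> {j. 2 * j \<le> n}" "j \<in> {j. 2 * j \<le> n}"
    "2 * cos (2 * pi * real i / real n) = 2 * cos (2 * pi * real j / real n)"
  show "i = j"
  proof (cases "n = 0")
    case False
    have range: "2 * pi * real m / real n \<in> {0..pi}" if "2 * m \<le> n" for m
    proof -
      have "2 * real m \<le> real n" using that by linarith
      hence "pi * (2 * real m) \<le> pi * real n" by simp
      thus ?thesis using False by (simp add: field_simps)
    qed
    have "2 * pi * real i / real n \<in> {0..pi}" "2 * pi * real j / real n \<in> {0..pi}"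
      using range ij(1,2) by blast+
    moreover have "cos (2 * pi * real i / real n) = cos (2 * pi * real j / real n)" using ij(3) by simp
    ultimately have "2 * pi * real i / real n = 2 * pi * real j / real n"
      by (metis cos_inj_pi atLeastAtMost_iff)
    thus ?thesis using False by simp
  qed (use ij in auto)
qed

text \<open>Each \<open>d\<close> contains some prime exactly once, so the two sides would have
  multiplicities of different parity. The values of \<open>d\<close> are those of \<open>h\<close>
  and \<open>h * (h - 1)\<close> for \<open>h \<in> {2, 3}\<close>.\<close>

lemma square_eq_nonsquare_mult_square:
  fixes n m :: int
  assumes "n\<^sup>2 = d * m\<^sup>2" "d \<in> {2, 3, 6}"
  shows "n = 0"
proof (rule ccontr)
  assume n: "n \<noteq> 0"
  hence m: "m \<noteq> 0" using assms by auto
  define q :: int where "q = (if d = 3 then 3 else 2)"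
  have q: "prime_elem q" by (simp add: q_def)
  have "multiplicity q d = 1"
    using assms(2) unfolding q_def by (auto intro!: multiplicity_eqI)
  hence "odd (multiplicity q (n\<^sup>2))"
    using assms m q by (auto simp: prime_elem_multiplicity_mult_distrib prime_elem_multiplicity_power_distrib)
  thus False using n q by (simp add: prime_elem_multiplicity_power_distrib)
qed

text \<open>Vieta's formula for the cubic coefficient, multiplied out so that the leading
  coefficient may vanish.\<close>

lemma quartic_sum_of_roots:
  fixes a0 a1 a2 a3 a4 :: real
  assumes "finite R" "card R = 4" "\<And>x. x \<in> R \<Longrightarrow> poly [:a0, a1, a2, a3, a4:] x = 0"
  shows "a3 = - a4 * \<Sum>R"
proof -
  obtain x1 x2 x3 x4 where R: "R = {x1, x2, x3, x4}" "distinct [x1, x2, x3, x4]"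
  proof -
    obtain xs where xs: "distinct xs" "set xs = R" using finite_distinct_list[OF assms(1)] by blast
    hence "length xs = 4" using assms(2) distinct_card by metis
    then obtain x1 x2 x3 x4 where "xs = [x1, x2, x3, x4]"
      by (auto simp: numeral_eq_Suc length_Suc_conv)
    thus ?thesis using that xs by auto
  qed
  \<comment> \<open>The quartic terms cancel, so \<open>H\<close> has degree at most three but four
    roots, and must be zero.\<close>
  define H where "H = [:a0, a1, a2, a3, a4:] - smult a4 ([:-x1, 1:] * [:-x2, 1:] * [:-x3, 1:] * [:-x4, 1:])"
  have H: "H = [:a0 - a4 * (x1 * x2 * x3 * x4), coeff H 1, coeff H 2, a3 + a4 * (x1 + x2 + x3 + x4):]"
    by (simp add: H_def algebra_simps numeral_2_eq_2)
  have "H = 0"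
  proof (rule ccontr)
    assume "H \<noteq> 0"
    hence "card {x. poly H x = 0} \<le> degree H" by (rule card_poly_roots_bound)
    also have "\<dots> \<le> 3" by (subst H) simp
    finally have "card {x. poly H x = 0} \<le> 3" .
    moreover have "R \<subseteq> {x. poly H x = 0}"
    proof
      fix x assume x: "x \<in> R"
      have "poly ([:-x1, 1:] * [:-x2, 1:] * [:-x3, 1:] * [:-x4, 1:]) x = 0"
        using x R(1) by (auto simp only: poly_mult) auto
      thus "x \<in> {x. poly H x = 0}"
        using assms(3)[OF x] by (simp only: H_def poly_diff poly_smult mem_Collect_eq)
    qed
    ultimately show False
      using card_mono[OF poly_roots_finite[OF \<open>H \<noteq> 0\<close>], of R] assms(2) by simp
  qed
  hence "a3 + a4 * (x1 + x2 + x3 + x4) = 0" using H by (metis pCons_eq_0_iff)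
  thus ?thesis using R by (simp add: algebra_simps)
qed


text \<open>The cases \<open>n = 16\<close> and \<open>n = 24\<close>, where \<open>- t\<close> and \<open>T\<close> are conjugates of \<open>t\<close>: the conjugate \<open>- t\<close>
  forces \<open>u = 0\<close>, and then the product over \<open>t\<close> and \<open>T\<close> makes \<open>h * (h - 1)\<close> a rational square.\<close>

lemma irrational_shift:
  fixes u v w p q r N h :: int and t T :: real
  defines "Y \<equiv> (\<lambda>x::real. v + w - u * x - v * x\<^sup>2)"
  defines "X \<equiv> (\<lambda>x::real. q + r - p * x - q * x\<^sup>2)"
  assumes h: "h \<in> {2, 3}" and t: "t \<noteq> 0" "t\<^sup>2 = 2 - sqrt h" "T\<^sup>2 = 2 + sqrt h"
    and nn: "v \<ge> 0" "w \<ge> 0"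
    and XY: "(2 - t\<^sup>2) * Y t = X t" "(2 - t\<^sup>2) * Y (- t) = X (- t)"
    and N: "N = (Y t)\<^sup>2 * ((2 - t\<^sup>2) * (3 - t\<^sup>2))" "N = (Y (- t))\<^sup>2 * ((2 - t\<^sup>2) * (3 - t\<^sup>2))"
      "N = (Y T)\<^sup>2 * ((2 - T\<^sup>2) * (3 - T\<^sup>2))"
  shows "N = 0"
proof -
  define \<rho> where "\<rho> = sqrt h"
  have \<rho>: "\<rho>\<^sup>2 = h" "\<rho> > 1" using h by (auto simp: \<rho>_def)
  have t2: "t\<^sup>2 = 2 - \<rho>" and T2: "T\<^sup>2 = 2 + \<rho>" using t by (simp_all add: \<rho>_def)
  have "(2 - t\<^sup>2) * (3 - t\<^sup>2) > 0" using \<rho>(2) by (simp add: t2)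
  hence "(Y t)\<^sup>2 = (Y (- t))\<^sup>2" using N(1,2) by auto
  hence "u * t * (v + w - v * t\<^sup>2) = 0" by (simp add: Y_def power2_eq_square algebra_simps)
  hence "(u * (w + v * (\<rho> - 1))) * t = 0" by (simp add: t2 algebra_simps)
  hence "u = 0 \<or> w + v * (\<rho> - 1) = 0" using t(1) by auto
  thus ?thesis
  proof
    assume u: "u = 0"
    have YtT: "Y t = (w - v) + v * \<rho>" "Y T = (w - v) - v * \<rho>"
      unfolding Y_def t2 T2 u by (simp_all add: algebra_simps)
    have "Y t * Y T = (w - v)\<^sup>2 - v\<^sup>2 * \<rho>\<^sup>2" unfolding YtT by (simp add: power2_eq_square algebra_simps)
    hence YY: "Y t * Y T = of_int ((w - v)\<^sup>2 - v\<^sup>2 * h)" by (simp add: \<rho>)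
    have "of_int (N\<^sup>2) = ((Y t)\<^sup>2 * ((2 - t\<^sup>2) * (3 - t\<^sup>2))) * ((Y T)\<^sup>2 * ((2 - T\<^sup>2) * (3 - T\<^sup>2)))"
      using N(1,3) by (simp add: power2_eq_square)
    also have "\<dots> = (Y t * Y T)\<^sup>2 * (\<rho>\<^sup>2 * (\<rho>\<^sup>2 - 1))"
      unfolding t2 T2 by (simp add: power2_eq_square algebra_simps)
    also have "\<dots> = of_int (h * (h - 1) * ((w - v)\<^sup>2 - v\<^sup>2 * h)\<^sup>2)"
      by (simp add: YY \<rho>)
    finally have "N\<^sup>2 = h * (h - 1) * ((w - v)\<^sup>2 - v\<^sup>2 * h)\<^sup>2" by (simp only: of_int_eq_iff)
    thus "N = 0" by (rule square_eq_nonsquare_mult_square) (use h in auto)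
  next
    assume "w + v * (\<rho> - 1) = 0"
    moreover have "0 \<le> v * (\<rho> - 1)" "0 \<le> real_of_int w" using nn \<rho>(2) by simp_all
    ultimately have "v * (\<rho> - 1) = 0" "real_of_int w = 0" by linarith+
    hence vw: "v = 0" "w = 0" using \<rho>(2) by simp_all
    have "\<rho> * (- (u * t)) = q + r - p * t - q * (2 - \<rho>)" "\<rho> * (u * t) = q + r + p * t - q * (2 - \<rho>)"
      using XY vw by (simp_all add: X_def Y_def t2)
    \<comment> \<open>The difference of the relations at \<open>t\<close> and \<open>- t\<close>. It
      yields \<open>p = \<rho> * u\<close> with integers \<open>p\<close> and \<open>u\<close>, and
      the irrational \<open>\<rho>\<close> leaves only zero.\<close>
    hence "2 * (\<rho> * (u * t)) = 2 * (p * t)" unfolding mult_minus_right by linarith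
    hence "\<rho> * u * t = p * t" by simp
    hence p: "\<rho> * u = p" using t(1) by simp
    hence "of_int (p\<^sup>2) = \<rho>\<^sup>2 * u\<^sup>2" by (simp add: power_mult_distrib flip: p)
    also have "\<dots> = of_int (h * u\<^sup>2)" by (simp add: \<rho>)
    finally have "p\<^sup>2 = h * u\<^sup>2" by (simp only: of_int_eq_iff)
    hence "p = 0" by (rule square_eq_nonsquare_mult_square) (use h in auto)
    hence "u = 0" using p \<rho>(2) by simp
    thus "N = 0" using N(1) vw by (simp add: Y_def)
  qed
qed


text \<open>In units of \<open>c\<close>, \<open>y\<close> is the length of \<open>AC\<close>;
  \<open>u\<close>, \<open>v\<close>, \<open>w\<close> count the tile edges of lengths
  \<open>a\<close>, \<open>b\<close>, \<open>c\<close> along \<open>AC\<close>, and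
  \<open>p\<close>, \<open>q\<close>, \<open>r\<close> those along \<open>BC\<close>. The
  polynomials are written in the variable \<open>- s\<close>, which is the cosine value
  \<open>T k\<close>.\<close>

lemma rational_multiple_of_pi_case:
  fixes u v w p q r N n k :: nat and y s :: real
  assumes k: "coprime k n" "n < 4 * k" "3 * k < n"
    and s: "s = - 2 * cos (2 * pi * real k / real n)" "0 < s" "s < 1"
    and y: "y > 0" "y = u * s + v * (1 - s\<^sup>2) + w"
    and x: "(2 - s\<^sup>2) * y = p * s + q * (1 - s\<^sup>2) + r"
    and N: "N = y\<^sup>2 * ((2 - s\<^sup>2) * (3 - s\<^sup>2))"
  shows "n = 7 \<and> k = 2"
proof -
  define T where "T = (\<lambda>j::nat. 2 * cos (2 * pi * real j / real n))"
  have n: "n > 0" using k by auto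
  have Tk: "T k = - s" using s by (simp add: T_def)
  define Y where "Y = (\<lambda>x::real. v + w - u * x - v * x\<^sup>2)"
  define X where "X = (\<lambda>x::real. q + r - p * x - q * x\<^sup>2)"
  define F1 :: "int poly" where
    "F1 = [:2 * (int v + int w) - (int q + int r), int p - 2 * int u, int q - 3 * int v - int w, int u, int v:]"
  define A :: int where "A = int v + int w"
  \<comment> \<open>\<open>F1\<close> and \<open>FN\<close> are the expanded differences of the two sides of \<open>x\<close> and \<open>N\<close> at \<open>s = - X\<close>.\<close>
  define FN :: "int poly" where
    "FN = [:int N - 6 * A\<^sup>2, 12 * A * int u, 5 * A\<^sup>2 - 6 * ((int u)\<^sup>2 - 2 * A * int v), - 12 * int u * int v - 10 * A * int u,
       5 * ((int u)\<^sup>2 - 2 * A * int v) - 6 * (int v)\<^sup>2 - A\<^sup>2, 10 * int u * int v + 2 * A * int u,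
       5 * (int v)\<^sup>2 - ((int u)\<^sup>2 - 2 * A * int v), - 2 * int u * int v, - (int v)\<^sup>2:]"
  have F1: "poly (map_poly of_int F1) x = (2 - x\<^sup>2) * Y x - X x" for x
    by (simp add: F1_def Y_def X_def map_poly_pCons algebra_simps power2_eq_square)
  have FN: "poly (map_poly of_int FN) x = N - (Y x)\<^sup>2 * ((2 - x\<^sup>2) * (3 - x\<^sup>2))" for x
    by (simp add: FN_def A_def Y_def map_poly_pCons algebra_simps power2_eq_square)
  have Ys: "Y (- s) = y" and Xs: "X (- s) = (2 - s\<^sup>2) * y"
    unfolding x by (simp_all add: y(2) Y_def X_def algebra_simps)
  have root1: "poly (map_poly of_int F1) (T j) = 0" if "coprime j n" for j
  proof -
    have "poly (map_poly of_int F1) (T k) = 0" by (simp add: F1 Tk Ys Xs)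
    thus ?thesis unfolding T_def by (rule ipoly_cos_conjugate[OF n k(1) that])
  qed
  have rootN: "poly (map_poly of_int FN) (T j) = 0" if "coprime j n" for j
  proof -
    have "poly (map_poly of_int FN) (T k) = 0" by (simp add: FN Tk Ys N)
    thus ?thesis unfolding T_def by (rule ipoly_cos_conjugate[OF n k(1) that])
  qed
  have s2: "s\<^sup>2 < 1" using s(2,3) by (simp add: power_less_one_iff)
  have Npos: "N > 0"
  proof -
    have "real N > 0" unfolding N using y(1) s2 by (intro mult_pos_pos) auto
    thus ?thesis by simp
  qed
  \<comment> \<open>If \<open>F1\<close> is the zero polynomial it does not bound the number of
    conjugates; but then \<open>u = v = 0\<close> reduces \<open>FN\<close> to degree four with
    leading coefficient \<open>- w\<^sup>2\<close>, and it takes over.\<close>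
  have F1_zero: "u = 0 \<and> v = 0 \<and> w > 0" if "F1 = 0"
    using that y by (auto simp: F1_def intro: Nat.gr0I)
  have card: "card J \<le> 4" if J: "J \<subseteq> {j. coprime j n \<and> 2 * j \<le> n}" for J
  proof -
    have finJ: "finite J" by (rule finite_subset[OF J], rule finite_subset[of _ "{..n}"]) auto
    have "inj_on T J" unfolding T_def by (rule inj_on_subset[OF cos_values_inj]) (use J in auto)
    hence cJ: "card J = card (T ` J)" by (simp add: card_image)
    obtain G :: "int poly" where G: "G \<noteq> 0" "degree G \<le> 4" "\<And>j. j \<in> J \<Longrightarrow> poly (map_poly of_int G) (T j) = 0"
    proof (cases "F1 = 0")
      case True
      hence *: "u = 0" "v = 0" "w > 0" using F1_zero by auto
      have "FN \<noteq> 0" "degree FN \<le> 4" using * by (auto simp: FN_def A_def)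
      thus ?thesis using that[of FN] rootN J by blast
    next
      case False
      moreover have "degree F1 \<le> 4" by (simp add: F1_def)
      ultimately show ?thesis using that[of F1] root1 J by blast
    qed
    let ?G = "map_poly of_int G :: real poly"
    have "?G \<noteq> 0" using G(1) by (metis degree_map_poly leading_coeff_0_iff coeff_map_poly of_int_0 of_int_eq_0_iff)
    moreover have "degree ?G \<le> 4" using G(2) by (simp add: degree_map_poly)
    moreover have "T ` J \<subseteq> {x. poly ?G x = 0}" using G(3) by auto
    ultimately show ?thesis
      using cJ card_mono[OF poly_roots_finite, of ?G "T ` J"] card_poly_roots_bound[of ?G] by linarith
  qed
  have gap: "\<not> (n < 12 * j \<and> 8 * j < n \<or> 3 * n < 8 * j \<and> 12 * j < 5 * n)" if "coprime j n" for j
  proof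
    assume "n < 12 * j \<and> 8 * j < n \<or> 3 * n < 8 * j \<and> 12 * j < 5 * n"
    hence "(T j)\<^sup>2 \<in> {2<..<3}" unfolding T_def by (rule positivity_gap)
    hence "(2 - (T j)\<^sup>2) * (3 - (T j)\<^sup>2) \<le> 0" by (intro mult_nonpos_nonneg) auto
    hence "(Y (T j))\<^sup>2 * ((2 - (T j)\<^sup>2) * (3 - (T j)\<^sup>2)) \<le> 0" by (simp add: mult_nonneg_nonpos)
    thus False using rootN[OF that] Npos by (simp add: FN)
  qed
  have cases: "(n, k) \<in> {(7, 2), (15, 4), (16, 5), (24, 7)}"
    using exceptional_denominators[OF k card gap] by blast
  have shift: False if h: "h \<in> {2, 3::int}" "j \<noteq> 0" "coprime j n" "T j = - T k" "(T k)\<^sup>2 = 2 - sqrt h"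
    "(T 1)\<^sup>2 = 2 + sqrt h" for h j
  proof -
    have "int N = 0"
    proof (rule irrational_shift[OF h(1), of "T k" "T 1" v w u q r p])
      show "T k \<noteq> 0" using Tk s by simp
    qed (use h root1[OF k(1)] root1[OF h(3)] rootN[OF k(1)] rootN[OF h(3)] rootN[of 1] in
        \<open>simp_all add: F1 FN Y_def X_def\<close>)
    thus False using Npos by simp
  qed
  have T2: "(T j)\<^sup>2 = 2 + 2 * cos (2 * (2 * pi * real j / real n))" for j
    unfolding T_def cos_double_cos[of "2 * pi * real j / real n"] by (simp add: power2_eq_square)
  consider "n = 7 \<and> k = 2" | "n = 15 \<and> k = 4" | "n = 16 \<and> k = 5" | "n = 24 \<and> k = 7"
    using cases by auto
  thus ?thesis
  proof cases
    case 2
    \<comment> \<open>Four distinct conjugates with positive sum. In \<open>F1\<close> the cubic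
      coefficient \<open>u\<close> must be \<open>- v\<close> times this sum, so nonnegativity
      forces \<open>u = v = 0\<close>; then \<open>FN\<close> has no cubic term, which forces
      \<open>w = 0\<close>.\<close>
    define R where "R = T ` {1, 2, 4, 7}"
    have "coprime 7 (15::nat)" "coprime 2 (15::nat)" "coprime 4 (15::nat)" by code_simp+
    hence co: "coprime j n" if "j \<in> {1, 2, 4, 7}" for j using that 2 by auto
    have inj: "inj_on T {1, 2, 4, 7}" unfolding T_def by (rule inj_on_subset[OF cos_values_inj]) (use 2 in auto)
    hence cR: "card R = 4" "finite R" by (simp_all add: R_def card_image)
    have "\<Sum>R = T 1 + T 2 + T 4 + T 7" unfolding R_def by (subst sum.reindex[OF inj]) simp
    also have "\<dots> > 0"
    proof -
      have "T 2 + T 7 = 4 * cos (3 * pi / 5) * cos (pi / 3)"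
        using 2 by (simp add: T_def cos_times_cos field_simps)
      moreover have "T 1 + T 4 = 4 * cos (pi / 3) * cos (pi / 5)"
        using 2 by (simp add: T_def cos_times_cos field_simps)
      moreover have "cos (3 * pi / 5) = - cos (2 * pi / 5)"
        using cos_pi_minus[of "2 * pi / 5"] by (simp add: field_simps)
      moreover have "cos (2 * pi / 5) < cos (pi / 5)" by (intro cos_monotone_0_pi) auto
      ultimately show ?thesis by (simp add: cos_60)
    qed
    finally have S: "\<Sum>R > 0" .
    have "u = - real v * \<Sum>R"
      using root1 co cR by (intro quartic_sum_of_roots) (auto simp: R_def F1_def map_poly_pCons)
    moreover have "real v * \<Sum>R \<ge> 0" using S by simp
    ultimately have "real u = 0 \<and> real v * \<Sum>R = 0" by linarith
    hence uv: "u = 0" "v = 0" using S by auto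
    have "0 = - (- (real w)\<^sup>2) * \<Sum>R"
      using rootN co cR uv
      by (intro quartic_sum_of_roots[of R "N - 6 * (real w)\<^sup>2" 0 "5 * (real w)\<^sup>2"])
        (auto simp: R_def FN_def A_def map_poly_pCons)
    hence "w = 0" using S by simp
    thus ?thesis using y uv by simp
  next
    case 3
    \<comment> \<open>The index is \<open>13 = 5 + 16 / 2\<close>: half a period changes the sign of
      the cosine. Likewise \<open>19 = 7 + 24 / 2\<close> below.\<close>
    have "coprime 13 (16::nat)" by code_simp
    moreover have "T 13 = - T 5"
      using 3 cos_periodic_pi[of "2 * pi * 5 / 16"] by (simp add: T_def field_simps)
    moreover have "cos (5 * pi / 4) = - cos (pi / 4)"
      using cos_periodic_pi[of "pi / 4"] by (simp add: field_simps)
    hence "(T 5)\<^sup>2 = 2 - sqrt 2" using 3 by (simp add: T2 cos_45)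
    moreover have "(T 1)\<^sup>2 = 2 + sqrt 2" using 3 by (simp add: T2 cos_45)
    ultimately show ?thesis using 3 shift[of 2 13] by simp
  next
    case 4
    have "coprime 19 (24::nat)" by code_simp
    moreover have "T 19 = - T 7"
      using 4 cos_periodic_pi[of "2 * pi * 7 / 24"] by (simp add: T_def field_simps)
    moreover have "cos (7 * pi / 6) = - cos (pi / 6)"
      using cos_periodic_pi[of "pi / 6"] by (simp add: field_simps)
    hence "(T 7)\<^sup>2 = 2 - sqrt 3" using 4 by (simp add: T2 cos_30)
    moreover have "(T 1)\<^sup>2 = 2 + sqrt 3" using 4 by (simp add: T2 cos_30)
    ultimately show ?thesis using 4 shift[of 3 19] by simp
  qed
qed

section \<open>Counterclockwise triangles\<close>

definition cross2 :: "point \<Rightarrow> point \<Rightarrow> real" where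
  "cross2 u v = u $ 1 * v $ 2 - u $ 2 * v $ 1"

definition rot90 :: "point \<Rightarrow> point" where
  "rot90 v = vector [- (v $ 2), v $ 1]"

text \<open>Positive to the left of the directed edge \<open>e\<close>.\<close>

definition lside :: "point \<times> point \<Rightarrow> point \<Rightarrow> real" where
  "lside e x = cross2 (snd e - fst e) (x - fst e)"

definition ccw :: "point \<Rightarrow> point \<Rightarrow> point \<Rightarrow> bool" where
  "ccw p q r \<longleftrightarrow> cross2 (q - p) (r - p) > 0"

definition ccw_edges :: "point \<Rightarrow> point \<Rightarrow> point \<Rightarrow> (point \<times> point) set" where
  "ccw_edges p q r = {(p, q), (q, r), (r, p)}"

lemma inner2: "u \<bullet> v = u $ 1 * v $ 1 + u $ 2 * v $ 2" for u v :: point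
  by (simp add: inner_vec_def sum_2)

lemma rot90_nth [simp]: "rot90 v $ 1 = - (v $ 2)" "rot90 v $ 2 = v $ 1"
  by (simp_all add: rot90_def)

lemma cross2_rot90: "cross2 u (rot90 v) = u \<bullet> v"
  by (simp add: cross2_def inner2)

lemma cross2_algebra:
  "cross2 (u + v) x = cross2 u x + cross2 v x" "cross2 x (u + v) = cross2 x u + cross2 x v"
  "cross2 (u - v) x = cross2 u x - cross2 v x" "cross2 x (u - v) = cross2 x u - cross2 x v"
  "cross2 (k *\<^sub>R u) x = k * cross2 u x" "cross2 x (k *\<^sub>R u) = k * cross2 x u"
  "cross2 (- u) x = - cross2 u x" "cross2 x (- u) = - cross2 x u"
  "cross2 u u = 0" "cross2 0 u = 0" "cross2 u 0 = 0"
  by (simp_all add: cross2_def algebra_simps)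

lemma cross2_skew: "cross2 u v = - cross2 v u"
  by (simp add: cross2_def)

lemma vec2_eq_iff: "u = v \<longleftrightarrow> u $ 1 = v $ 1 \<and> u $ 2 = v $ 2" for u v :: point
  by (simp add: vec_eq_iff forall_2)

lemma cross2_inner_sq: "(cross2 u v)\<^sup>2 + (u \<bullet> v)\<^sup>2 = (norm u)\<^sup>2 * (norm v)\<^sup>2"
  unfolding power2_norm_eq_inner by (simp add: inner2 cross2_def power2_eq_square algebra_simps)

lemma cross2_decompose:
  "(norm d)\<^sup>2 *\<^sub>R v = (v \<bullet> d) *\<^sub>R d + cross2 d v *\<^sub>R rot90 d"
  unfolding power2_norm_eq_inner by (simp add: inner2 cross2_def vec2_eq_iff algebra_simps)

lemma cross2_eq_0: assumes "d \<noteq> 0" "cross2 d v = 0" shows "v = ((v \<bullet> d) / (norm d)\<^sup>2) *\<^sub>R d"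
proof -
  have "v = (1 / (norm d)\<^sup>2) *\<^sub>R ((norm d)\<^sup>2 *\<^sub>R v)" using assms(1) by simp
  also have "\<dots> = ((v \<bullet> d) / (norm d)\<^sup>2) *\<^sub>R d" unfolding cross2_decompose assms(2) by simp
  finally show ?thesis .
qed

lemma not_collinear_cross2:
  "\<not> collinear {p, q, r} \<longleftrightarrow> cross2 (q - p) (r - p) \<noteq> 0"
proof -
  have "collinear {p, q, r} \<longleftrightarrow> collinear {q, p, r}" by (simp add: insert_commute)
  also have "\<dots> \<longleftrightarrow> collinear {0, q - p, r - p}" by (rule collinear_3[unfolded NO_MATCH_def]) simp
  also have "\<dots> \<longleftrightarrow> cross2 (q - p) (r - p) = 0"
  proof
    assume "collinear {0, q - p, r - p}"
    thus "cross2 (q - p) (r - p) = 0"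
      unfolding collinear_lemma by (elim disjE exE) (simp_all only: cross2_algebra mult_zero_right)
  next
    assume *: "cross2 (q - p) (r - p) = 0"
    show "collinear {0, q - p, r - p}"
      using cross2_eq_0[of "q - p" "r - p"] * unfolding collinear_lemma by blast
  qed
  finally show ?thesis by simp
qed

lemma ccw_rotate: "ccw p q r \<Longrightarrow> ccw q r p"
  by (simp add: ccw_def cross2_def algebra_simps)

lemma ccw_edges_rotate: "ccw_edges q r p = ccw_edges p q r"
  by (auto simp: ccw_edges_def)

lemma tri_rotate: "tri q r p = tri p q r"
  by (simp add: tri_def insert_commute)

lemma ccw_distinct: "ccw p q r \<Longrightarrow> p \<noteq> q \<and> q \<noteq> r \<and> r \<noteq> p"
  by (auto simp: ccw_def cross2_def)

lemma not_collinear_ccw: "\<not> collinear {p, q, r} \<longleftrightarrow> ccw p q r \<or> ccw p r q"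
  unfolding not_collinear_cross2 ccw_def by (subst (3) cross2_skew) auto

lemma sum_ccw_edges:
  assumes "ccw p q r"
  shows "sum f (ccw_edges p q r) = f (p, q) + f (q, r) + f (r, p)"
  using ccw_distinct[OF assms] by (simp add: ccw_edges_def add.assoc)

lemma finite_ccw_edges [simp]: "finite (ccw_edges p q r)"
  by (simp add: ccw_edges_def)

lemma lside_sum:
  "lside (p, q) x + lside (q, r) x + lside (r, p) x = cross2 (q - p) (r - p)"
  by (simp add: lside_def cross2_def algebra_simps)

lemma barycentric:
  "cross2 (q - p) (r - p) *\<^sub>R x = lside (q, r) x *\<^sub>R p + lside (r, p) x *\<^sub>R q + lside (p, q) x *\<^sub>R r"
  by (simp add: lside_def cross2_def vec2_eq_iff algebra_simps)

text \<open>Divided by twice the area, the values of \<open>lside\<close> on the three edges are the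
  barycentric coordinates of \<open>x\<close>.\<close>

lemma tri_iff_lside:
  assumes "ccw p q r"
  shows "x \<in> tri p q r \<longleftrightarrow> (\<forall>e\<in>ccw_edges p q r. 0 \<le> lside e x)"
proof -
  define D where "D = cross2 (q - p) (r - p)"
  have D: "D > 0" using assms by (simp add: D_def ccw_def)
  show ?thesis
  proof
    assume "x \<in> tri p q r"
    then obtain u v w where uvw: "0 \<le> u" "0 \<le> v" "0 \<le> w" "u + v + w = 1" "x = u *\<^sub>R p + v *\<^sub>R q + w *\<^sub>R r"
      unfolding tri_def convex_hull_3 by auto
    have u: "u = 1 - v - w" using uvw by simp
    have "lside (p, q) x = w * D" "lside (q, r) x = u * D" "lside (r, p) x = v * D"
      unfolding uvw(5) u by (simp_all add: D_def lside_def cross2_def algebra_simps)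
    thus "\<forall>e\<in>ccw_edges p q r. 0 \<le> lside e x"
      using uvw D by (simp add: ccw_edges_def)
  next
    assume *: "\<forall>e\<in>ccw_edges p q r. 0 \<le> lside e x"
    have "x = (1 / D) *\<^sub>R (D *\<^sub>R x)" using D by simp
    also have "\<dots> = (lside (q, r) x / D) *\<^sub>R p + (lside (r, p) x / D) *\<^sub>R q + (lside (p, q) x / D) *\<^sub>R r"
      unfolding D_def barycentric by (simp add: scaleR_add_right)
    finally have "x = (lside (q, r) x / D) *\<^sub>R p + (lside (r, p) x / D) *\<^sub>R q + (lside (p, q) x / D) *\<^sub>R r" .
    moreover have "lside (q, r) x / D + lside (r, p) x / D + lside (p, q) x / D = 1"
      using lside_sum[of p q x r] D by (simp add: D_def add_divide_distrib[symmetric] add_ac)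
    moreover have "0 \<le> lside (q, r) x / D" "0 \<le> lside (r, p) x / D" "0 \<le> lside (p, q) x / D"
      using * D by (auto simp: ccw_edges_def)
    ultimately show "x \<in> tri p q r" unfolding tri_def convex_hull_3 by blast
  qed
qed

lemma lside_add: "lside e (x + h) = lside e x + cross2 (snd e - fst e) h"
  by (simp add: lside_def cross2_algebra)

lemma continuous_on_lside [continuous_intros]: "continuous_on S (lside e)"
  unfolding lside_def cross2_def by (intro continuous_intros)

lemma interior_tri_iff:
  assumes "ccw p q r"
  shows "x \<in> interior (tri p q r) \<longleftrightarrow> (\<forall>e\<in>ccw_edges p q r. 0 < lside e x)"
proof
  have "open (\<Inter>e\<in>ccw_edges p q r. {x. 0 < lside e x})"
    by (intro open_INT ballI open_Collect_less continuous_intros) simp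
  moreover have "(\<Inter>e\<in>ccw_edges p q r. {x. 0 < lside e x}) \<subseteq> tri p q r"
    using tri_iff_lside[OF assms] by (auto intro: less_imp_le)
  ultimately have "(\<Inter>e\<in>ccw_edges p q r. {x. 0 < lside e x}) \<subseteq> interior (tri p q r)"
    by (rule interior_maximal[rotated])
  thus "\<forall>e\<in>ccw_edges p q r. 0 < lside e x \<Longrightarrow> x \<in> interior (tri p q r)" by auto
next
  assume x: "x \<in> interior (tri p q r)"
  then obtain \<delta> where \<delta>: "\<delta> > 0" "cball x \<delta> \<subseteq> tri p q r" using mem_interior_cball by blast
  show "\<forall>e\<in>ccw_edges p q r. 0 < lside e x"
  proof
    fix e assume e: "e \<in> ccw_edges p q r"
    define v where "v = snd e - fst e"
    have v: "v \<noteq> 0" using e ccw_distinct[OF assms] by (auto simp: v_def ccw_edges_def)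
    define y where "y = x - (\<delta> / norm v) *\<^sub>R rot90 v"
    have nrot: "norm (rot90 v) = norm v" by (simp add: norm_eq_sqrt_inner inner2 add.commute)
    have "dist x y = \<delta>" using v \<delta>(1) by (simp add: y_def dist_norm nrot)
    hence "y \<in> tri p q r" using \<delta> by (auto simp: subset_eq)
    hence "0 \<le> lside e y" using e tri_iff_lside[OF assms] by blast
    also have "lside e y = lside e x - (\<delta> / norm v) * (v \<bullet> v)"
      using lside_add[of e x "- (\<delta> / norm v) *\<^sub>R rot90 v"]
      by (simp add: y_def v_def cross2_algebra cross2_rot90)
    finally have "(\<delta> / norm v) * (v \<bullet> v) \<le> lside e x" by simp
    moreover have "(\<delta> / norm v) * (v \<bullet> v) > 0" using v \<delta>(1) by simp
    ultimately show "0 < lside e x" by linarith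
  qed
qed

lemma closed_tri: "closed (tri p q r)"
  by (simp add: tri_def compact_imp_closed finite_imp_compact_convex_hull)

lemma frontier_tri_iff:
  assumes "ccw p q r"
  shows "x \<in> frontier (tri p q r) \<longleftrightarrow> x \<in> tri p q r \<and> (\<exists>e\<in>ccw_edges p q r. lside e x = 0)"
proof -
  have "frontier (tri p q r) = tri p q r - interior (tri p q r)"
    by (simp add: frontier_def closed_tri)
  thus ?thesis using interior_tri_iff[OF assms] tri_iff_lside[OF assms] by force
qed

lemma interior_tri_nonempty:
  assumes "ccw p q r"
  shows "interior (tri p q r) \<noteq> {}"
proof -
  let ?x = "(1/3) *\<^sub>R (p + q + r)"
  have "lside e ?x = cross2 (q - p) (r - p) / 3" if "e \<in> ccw_edges p q r" for e
    using that by (auto simp: ccw_edges_def lside_def cross2_def field_simps)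
  hence "\<forall>e\<in>ccw_edges p q r. 0 < lside e ?x" using assms by (metis ccw_def divide_pos_pos zero_less_numeral)
  hence "?x \<in> interior (tri p q r)" using interior_tri_iff[OF assms] by blast
  thus ?thesis by blast
qed

lemma edge_point:
  assumes "ccw p q r" "lside (p, q) x = 0"
  shows "\<exists>\<tau>. x = p + \<tau> *\<^sub>R (q - p) \<and> lside (q, r) x = (1 - \<tau>) * cross2 (q - p) (r - p) \<and>
    lside (r, p) x = \<tau> * cross2 (q - p) (r - p)"
proof -
  have "q - p \<noteq> 0" using ccw_distinct[OF assms(1)] by auto
  moreover have "cross2 (q - p) (x - p) = 0" using assms(2) by (simp add: lside_def)
  ultimately obtain \<tau> where \<tau>: "x - p = \<tau> *\<^sub>R (q - p)" using cross2_eq_0 by blast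
  hence x: "x = p + \<tau> *\<^sub>R (q - p)" by (simp add: algebra_simps)
  show ?thesis
    by (intro exI[of _ \<tau>] conjI x; unfold x) (simp_all add: lside_def cross2_def algebra_simps)
qed

section \<open>Tile edges on a line\<close>

text \<open>For a non-degenerate edge \<open>e\<close> and \<open>v \<noteq> 0\<close>, this says that \<open>e\<close> lies on the line \<open>x0 + \<real> v\<close>.\<close>

definition on_line :: "point \<Rightarrow> point \<Rightarrow> point \<times> point \<Rightarrow> bool" where
  "on_line x0 v e \<longleftrightarrow> cross2 (snd e - fst e) v = 0 \<and> lside e x0 = 0"

lemma on_line_lside: "on_line x0 v e \<Longrightarrow> lside e (x0 + \<tau> *\<^sub>R v) = 0"
  by (simp add: on_line_def lside_add cross2_algebra)

lemma on_line_unique: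
  assumes "ccw p q r" "v \<noteq> 0" "on_line x0 v (p, q)" "e \<in> ccw_edges p q r" "on_line x0 v e"
  shows "e = (p, q)"
proof (rule ccontr)
  assume ne: "e \<noteq> (p, q)"
  have par: "\<exists>c. u = c *\<^sub>R v" if "cross2 u v = 0" for u
    using cross2_eq_0[OF assms(2), of u] that cross2_skew[of u v] by auto
  obtain a where a: "q - p = a *\<^sub>R v" using par assms(3) by (auto simp: on_line_def)
  have "cross2 (r - q) v = 0 \<or> cross2 (p - r) v = 0"
    using assms(4,5) ne by (auto simp: on_line_def ccw_edges_def)
  then obtain b where b: "r - q = b *\<^sub>R v \<or> p - r = b *\<^sub>R v" using par by blast
  have "cross2 (q - p) (r - p) = cross2 (q - p) (r - q)" "cross2 (q - p) (r - p) = - cross2 (q - p) (p - r)"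
    by (simp_all add: cross2_def algebra_simps)
  moreover have "cross2 (q - p) (r - q) = 0 \<or> cross2 (q - p) (p - r) = 0"
    using b unfolding a by (elim disjE) (simp_all only: cross2_algebra mult_zero_right simp_thms)
  ultimately have "cross2 (q - p) (r - p) = 0" by auto
  thus False using assms(1) by (simp add: ccw_def)
qed

text \<open>Across the line only the edge \<open>(p, q)\<close> can decide membership, since the
  other two \<open>lside\<close> values keep their signs. A shift by
  \<open>\<sigma> * \<epsilon>\<close> along \<open>rot90 v\<close> changes
  \<open>lside (p, q)\<close> by \<open>\<sigma> * \<epsilon> * ((q - p) \<bullet> v)\<close>, so
  the triangle lies on the \<open>rot90 v\<close> side exactly when its edge points along
  \<open>v\<close>.\<close>

lemma jump_first_edge:
  assumes pqr: "ccw p q r" and v: "v \<noteq> 0" and on: "on_line x0 v (p, q)"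
    and x: "x = x0 + \<tau> *\<^sub>R v"
    and nz: "lside (q, r) x \<noteq> 0" "lside (r, p) x \<noteq> 0" and \<epsilon>: "\<epsilon> > 0"
    and sg: "\<And>e \<sigma>. e \<in> {(q, r), (r, p)} \<Longrightarrow> \<sigma> \<in> {1, - 1} \<Longrightarrow>
      sgn (lside e (x + (\<sigma> * \<epsilon>) *\<^sub>R rot90 v)) = sgn (lside e x)"
  shows "indicat_real (tri p q r) (x + \<epsilon> *\<^sub>R rot90 v) - indicat_real (tri p q r) (x - \<epsilon> *\<^sub>R rot90 v) =
    sgn ((q - p) \<bullet> v) * indicat_real (closed_segment p q) x"
proof -
  define D where "D = cross2 (q - p) (r - p)"
  have D: "D > 0" using pqr by (simp add: D_def ccw_def)
  have x0: "lside (p, q) x = 0" using on_line_lside[OF on] x by simp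
  obtain t where t: "x = p + t *\<^sub>R (q - p)" "lside (q, r) x = (1 - t) * D" "lside (r, p) x = t * D"
    using edge_point[OF pqr x0] by (auto simp: D_def)
  have pq: "q - p \<noteq> 0" using ccw_distinct[OF pqr] by auto
  have t_sgn: "0 \<le> sgn (t * D) \<longleftrightarrow> 0 < t" "0 \<le> sgn ((1 - t) * D) \<longleftrightarrow> t < 1"
    using nz t D by (auto simp: sgn_if zero_less_mult_iff)
  have seg: "x \<in> closed_segment p q \<longleftrightarrow> 0 < t \<and> t < 1"
  proof -
    have "x \<in> closed_segment p q \<longleftrightarrow> (\<exists>u. 0 \<le> u \<and> u \<le> 1 \<and> (t - u) *\<^sub>R (q - p) = 0)"
      unfolding in_segment t(1) by (simp add: algebra_simps)
    also have "\<dots> \<longleftrightarrow> 0 \<le> t \<and> t \<le> 1" using pq by auto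
    also have "\<dots> \<longleftrightarrow> 0 < t \<and> t < 1" using nz t by auto
    finally show ?thesis .
  qed
  have in_tri: "x + (\<sigma> * \<epsilon>) *\<^sub>R rot90 v \<in> tri p q r \<longleftrightarrow> 0 \<le> \<sigma> * ((q - p) \<bullet> v) \<and> 0 < t \<and> t < 1"
    if \<sigma>: "\<sigma> \<in> {1, - 1}" for \<sigma>
  proof -
    have "lside (p, q) (x + (\<sigma> * \<epsilon>) *\<^sub>R rot90 v) = \<epsilon> * (\<sigma> * ((q - p) \<bullet> v))"
      by (simp add: lside_add x0 cross2_algebra cross2_rot90)
    hence "0 \<le> lside (p, q) (x + (\<sigma> * \<epsilon>) *\<^sub>R rot90 v) \<longleftrightarrow> 0 \<le> \<sigma> * ((q - p) \<bullet> v)"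
      using \<epsilon> by (simp add: zero_le_mult_iff)
    moreover have "0 \<le> lside (q, r) (x + (\<sigma> * \<epsilon>) *\<^sub>R rot90 v) \<longleftrightarrow> t < 1"
      using sg[of "(q, r)", OF _ \<sigma>] t_sgn(2) t(2) by (metis insertI1 zero_le_sgn_iff)
    moreover have "0 \<le> lside (r, p) (x + (\<sigma> * \<epsilon>) *\<^sub>R rot90 v) \<longleftrightarrow> 0 < t"
      using sg[of "(r, p)", OF _ \<sigma>] t_sgn(1) t(3) by (metis insertI1 insertI2 zero_le_sgn_iff)
    ultimately show ?thesis unfolding tri_iff_lside[OF pqr] by (auto simp: ccw_edges_def)
  qed
  have "(q - p) \<bullet> v \<noteq> 0"
  proof
    assume "(q - p) \<bullet> v = 0"
    moreover have "cross2 (q - p) v = 0" using on by (simp add: on_line_def)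
    ultimately have "(norm (q - p))\<^sup>2 * (norm v)\<^sup>2 = 0" using cross2_inner_sq[of "q - p" v] by simp
    thus False using pq v by simp
  qed
  thus ?thesis using in_tri[of 1] in_tri[of "-1"] by (auto simp: indicator_def seg sgn_if)
qed

lemma indicator_jump:
  assumes pqr: "ccw p q r" and v: "v \<noteq> 0"
    and x: "x = x0 + \<tau> *\<^sub>R v"
    and nz: "\<And>e. e \<in> ccw_edges p q r \<Longrightarrow> \<not> on_line x0 v e \<Longrightarrow> lside e x \<noteq> 0" and \<epsilon>: "\<epsilon> > 0"
    and sg: "\<And>e \<sigma>. e \<in> ccw_edges p q r \<Longrightarrow> \<not> on_line x0 v e \<Longrightarrow> \<sigma> \<in> {1, - 1} \<Longrightarrow>
      sgn (lside e (x + (\<sigma> * \<epsilon>) *\<^sub>R rot90 v)) = sgn (lside e x)"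
  shows "indicat_real (tri p q r) (x + \<epsilon> *\<^sub>R rot90 v) - indicat_real (tri p q r) (x - \<epsilon> *\<^sub>R rot90 v) =
    (\<Sum>e\<in>{e\<in>ccw_edges p q r. on_line x0 v e}. sgn ((snd e - fst e) \<bullet> v) * indicat_real (closed_segment (fst e) (snd e)) x)"
proof (cases "\<exists>e\<in>ccw_edges p q r. on_line x0 v e")
  case False
  hence "sgn (lside e (x + (\<sigma> * \<epsilon>) *\<^sub>R rot90 v)) = sgn (lside e x)"
    if "e \<in> ccw_edges p q r" "\<sigma> \<in> {1, - 1}" for e \<sigma>
    using sg that by blast
  hence "x + (\<sigma> * \<epsilon>) *\<^sub>R rot90 v \<in> tri p q r \<longleftrightarrow> x \<in> tri p q r" if "\<sigma> \<in> {1, - 1}" for \<sigma>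
    unfolding tri_iff_lside[OF pqr] using that by (metis zero_le_sgn_iff)
  from this[of 1] this[of "-1"]
  have "indicat_real (tri p q r) (x + \<epsilon> *\<^sub>R rot90 v) = indicat_real (tri p q r) (x - \<epsilon> *\<^sub>R rot90 v)"
    by (simp add: indicator_def)
  moreover have "{e\<in>ccw_edges p q r. on_line x0 v e} = {}" using False by blast
  ultimately show ?thesis by (simp only:) simp
next
  case True
  \<comment> \<open>A triangle has at most one edge on a line; a cyclic relabelling of the vertices
    makes it the first one.\<close>
  have main: ?thesis if pqr': "ccw p' q' r'" "on_line x0 v (p', q')" "ccw_edges p q r = ccw_edges p' q' r'"
    "tri p q r = tri p' q' r'" for p' q' r'
  proof -
    have uniq: "\<And>e. e \<in> ccw_edges p' q' r' \<Longrightarrow> on_line x0 v e \<Longrightarrow> e = (p', q')"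
      using on_line_unique[OF pqr'(1) v pqr'(2)] by blast
    have "(p', q') \<noteq> (q', r')" "(p', q') \<noteq> (r', p')" using ccw_distinct[OF pqr'(1)] by auto
    hence off: "\<not> on_line x0 v e" if "e \<in> {(q', r'), (r', p')}" for e
      using uniq[of e] that by (auto simp: ccw_edges_def)
    have "{e\<in>ccw_edges p' q' r'. on_line x0 v e} = {(p', q')}"
      using uniq pqr'(2) by (auto simp: ccw_edges_def)
    moreover have "indicat_real (tri p' q' r') (x + \<epsilon> *\<^sub>R rot90 v) - indicat_real (tri p' q' r') (x - \<epsilon> *\<^sub>R rot90 v) =
      sgn ((q' - p') \<bullet> v) * indicat_real (closed_segment p' q') x"
    proof (rule jump_first_edge[OF pqr'(1) v pqr'(2) x _ _ \<epsilon>])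
      have mem: "e \<in> ccw_edges p q r" if "e \<in> {(q', r'), (r', p')}" for e
        using that unfolding pqr'(3) by (auto simp: ccw_edges_def)
      show "lside (q', r') x \<noteq> 0" "lside (r', p') x \<noteq> 0"
        using nz off mem by blast+
      show "sgn (lside e (x + (\<sigma> * \<epsilon>) *\<^sub>R rot90 v)) = sgn (lside e x)"
        if "e \<in> {(q', r'), (r', p')}" "\<sigma> \<in> {1, - 1}" for e \<sigma>
        using sg mem off that by blast
    qed
    ultimately show ?thesis by (simp add: pqr'(3,4))
  qed
  consider "on_line x0 v (p, q)" | "on_line x0 v (q, r)" | "on_line x0 v (r, p)"
    using True by (auto simp: ccw_edges_def)
  thus ?thesis
  proof cases
    case 1 thus ?thesis using main[OF pqr] by simp
  next
    case 2 thus ?thesis using main[OF ccw_rotate[OF pqr]] by (simp add: ccw_edges_rotate tri_rotate)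
  next
    case 3 thus ?thesis using main[OF ccw_rotate[OF ccw_rotate[OF pqr]]]
      by (simp add: ccw_edges_rotate[of p q r] ccw_edges_rotate[of q r p] tri_rotate[of p q r] tri_rotate[of q r p])
  qed
qed

lemma eventually_sgn_lside:
  assumes "lside e x \<noteq> 0"
  shows "\<forall>\<^sub>F \<epsilon> in at_right 0. sgn (lside e (x + (\<sigma> * \<epsilon>) *\<^sub>R w)) = sgn (lside e x)"
proof -
  let ?f = "\<lambda>\<epsilon>. lside e (x + (\<sigma> * \<epsilon>) *\<^sub>R w)"
  have "((\<lambda>\<epsilon>. lside e x + \<epsilon> * (\<sigma> * cross2 (snd e - fst e) w)) \<longlongrightarrow> lside e x + 0 * (\<sigma> * cross2 (snd e - fst e) w)) (at_right 0)"
    by (intro tendsto_intros)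
  hence lim: "(?f \<longlongrightarrow> lside e x) (at_right 0)"
    by (simp add: lside_add cross2_algebra mult_ac)
  show ?thesis
  proof (cases "lside e x > 0")
    case True
    from order_tendstoD(1)[OF lim True] show ?thesis by eventually_elim (use True in simp)
  next
    case False
    hence neg: "lside e x < 0" using assms by simp
    from order_tendstoD(2)[OF lim neg] show ?thesis by eventually_elim (use neg in simp)
  qed
qed


lemma on_line_parametrization:
  assumes "v \<noteq> 0" "fst e \<noteq> snd e" "on_line x0 v e"
  obtains a b where "fst e = x0 + a *\<^sub>R v" "snd e = x0 + b *\<^sub>R v"
proof -
  have par: "\<exists>c. u = c *\<^sub>R v" if "cross2 u v = 0" for u
    using cross2_eq_0[OF assms(1), of u] that cross2_skew[of u v] by auto
  obtain c where c: "snd e - fst e = c *\<^sub>R v" using par assms(3) by (auto simp: on_line_def)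
  hence "c \<noteq> 0" using assms(2) by auto
  moreover have "c * cross2 v (x0 - fst e) = 0"
    using assms(3) by (simp add: on_line_def lside_def c cross2_algebra(5))
  ultimately have "cross2 (x0 - fst e) v = 0" using cross2_skew[of v] by simp
  then obtain a where "x0 - fst e = a *\<^sub>R v" using par by blast
  hence "fst e = x0 + (- a) *\<^sub>R v" by (simp add: algebra_simps)
  moreover have "snd e = x0 + (c - a) *\<^sub>R v" using c calculation by (simp add: algebra_simps)
  ultimately show ?thesis using that by blast
qed

text \<open>If the edge runs from parameter \<open>a\<close> to parameter \<open>b\<close>, the
  signed indicator integrates to \<open>b - a\<close>, whichever of the two is larger.\<close>

lemma has_bochner_integral_edge_indicator:
  assumes "v \<noteq> 0" "fst e \<noteq> snd e" "on_line x0 v e"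
  shows "has_bochner_integral lborel
    (\<lambda>\<tau>. sgn ((snd e - fst e) \<bullet> v) * indicat_real (closed_segment (fst e) (snd e)) (x0 + \<tau> *\<^sub>R v))
    ((snd e - fst e) \<bullet> v / (norm v)\<^sup>2)"
proof -
  obtain a b where ab: "fst e = x0 + a *\<^sub>R v" "snd e = x0 + b *\<^sub>R v"
    using on_line_parametrization[OF assms] .
  have vv: "v \<bullet> v > 0" using assms(1) by simp
  have seg: "x0 + \<tau> *\<^sub>R v \<in> closed_segment (fst e) (snd e) \<longleftrightarrow> \<tau> \<in> closed_segment a b" for \<tau>
  proof -
    have "x0 + \<tau> *\<^sub>R v = (1 - u) *\<^sub>R fst e + u *\<^sub>R snd e \<longleftrightarrow> (\<tau> - ((1 - u) * a + u * b)) *\<^sub>R v = 0" for u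
      by (simp add: ab algebra_simps)
    thus ?thesis using assms(1) by (simp add: in_segment)
  qed
  have d: "(snd e - fst e) \<bullet> v = (b - a) * (v \<bullet> v)"
    by (simp add: ab algebra_simps inner_diff_left)
  have "has_bochner_integral lborel (\<lambda>\<tau>. sgn (b - a) * indicat_real {min a b..max a b} \<tau>)
      (sgn (b - a) * measure lborel {min a b..max a b})"
    by (intro has_bochner_integral_mult_right has_bochner_integral_real_indicator) auto
  moreover have "sgn (b - a) * measure lborel {min a b..max a b} = b - a"
    by (auto simp: min_def max_def sgn_if)
  moreover have "(snd e - fst e) \<bullet> v / (norm v)\<^sup>2 = b - a"
    using vv by (simp add: d power2_norm_eq_inner)
  moreover have "sgn ((snd e - fst e) \<bullet> v) = sgn (b - a)"
    using vv by (simp add: d sgn_mult)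
  moreover have "indicat_real (closed_segment (fst e) (snd e)) (x0 + \<tau> *\<^sub>R v) = indicat_real {min a b..max a b} \<tau>" for \<tau>
    using seg by (auto simp: indicator_def closed_segment_eq_real_ivl min_def max_def)
  ultimately show ?thesis by simp
qed

definition is_ccw_triangle :: "point set \<Rightarrow> (point \<times> point) set \<Rightarrow> bool" where
  "is_ccw_triangle t F \<longleftrightarrow> (\<exists>p q r. ccw p q r \<and> t = tri p q r \<and> F = ccw_edges p q r)"

lemma is_ccw_triangleD:
  assumes "is_ccw_triangle t F"
  shows "finite F" "\<And>e. e \<in> F \<Longrightarrow> fst e \<noteq> snd e"
    "x \<in> t \<longleftrightarrow> (\<forall>e\<in>F. 0 \<le> lside e x)" "x \<in> interior t \<longleftrightarrow> (\<forall>e\<in>F. 0 < lside e x)"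
    "x \<in> frontier t \<longleftrightarrow> x \<in> t \<and> (\<exists>e\<in>F. lside e x = 0)"
    "closed t" "convex t" "interior t \<noteq> {}"
proof -
  obtain p q r where pqr: "ccw p q r" "t = tri p q r" "F = ccw_edges p q r"
    using assms by (auto simp: is_ccw_triangle_def)
  show "finite F" "\<And>e. e \<in> F \<Longrightarrow> fst e \<noteq> snd e"
    using ccw_distinct[OF pqr(1)] by (auto simp: pqr(3) ccw_edges_def)
  show "x \<in> t \<longleftrightarrow> (\<forall>e\<in>F. 0 \<le> lside e x)" "x \<in> interior t \<longleftrightarrow> (\<forall>e\<in>F. 0 < lside e x)"
    "x \<in> frontier t \<longleftrightarrow> x \<in> t \<and> (\<exists>e\<in>F. lside e x = 0)"
    unfolding pqr(2,3) using tri_iff_lside interior_tri_iff frontier_tri_iff pqr(1) by blast+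
  show "closed t" "interior t \<noteq> {}" unfolding pqr(2) using closed_tri interior_tri_nonempty[OF pqr(1)] by auto
  show "convex t" unfolding pqr(2) tri_def by simp
qed

lemma indicator_jump_triangle:
  assumes "is_ccw_triangle t F" and v: "v \<noteq> 0"
    and x: "x = x0 + \<tau> *\<^sub>R v"
    and nz: "\<And>e. e \<in> F \<Longrightarrow> \<not> on_line x0 v e \<Longrightarrow> lside e x \<noteq> 0" and \<epsilon>: "\<epsilon> > 0"
    and sg: "\<And>e \<sigma>. e \<in> F \<Longrightarrow> \<not> on_line x0 v e \<Longrightarrow> \<sigma> \<in> {1, - 1} \<Longrightarrow>
      sgn (lside e (x + (\<sigma> * \<epsilon>) *\<^sub>R rot90 v)) = sgn (lside e x)"
  shows "indicat_real t (x + \<epsilon> *\<^sub>R rot90 v) - indicat_real t (x - \<epsilon> *\<^sub>R rot90 v) =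
    (\<Sum>e\<in>{e\<in>F. on_line x0 v e}. sgn ((snd e - fst e) \<bullet> v) * indicat_real (closed_segment (fst e) (snd e)) x)"
proof -
  obtain p q r where pqr: "ccw p q r" "t = tri p q r" "F = ccw_edges p q r"
    using assms(1) by (auto simp: is_ccw_triangle_def)
  show ?thesis
    unfolding pqr(2,3) by (rule indicator_jump[OF pqr(1) v x _ \<epsilon>]) (use nz sg pqr(3) in blast)+
qed

section \<open>Balance of edge lengths on a line\<close>

locale ccw_tiling =
  fixes \<T> :: "point set set" and S :: "point set"
    and E :: "point set \<Rightarrow> (point \<times> point) set" and ES :: "(point \<times> point) set"
  assumes finite_tiles: "finite \<T>"
    and tile: "t \<in> \<T> \<Longrightarrow> is_ccw_triangle t (E t)"
    and outer: "is_ccw_triangle S ES"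
    and cover: "\<Union>\<T> = S"
    and overlap: "t \<in> \<T> \<Longrightarrow> u \<in> \<T> \<Longrightarrow> t \<noteq> u \<Longrightarrow> t \<inter> u \<subseteq> frontier t \<inter> frontier u"
begin

lemmas tileD = is_ccw_triangleD[OF tile] and outerD = is_ccw_triangleD[OF outer]

lemma sum_indicator_tiles:
  assumes "\<And>t. t \<in> \<T> \<Longrightarrow> y \<notin> frontier t"
  shows "(\<Sum>t\<in>\<T>. indicat_real t y) = indicat_real S y"
proof (cases "y \<in> S")
  case True
  then obtain t where t: "t \<in> \<T>" "y \<in> t" using cover by blast
  have "indicat_real u y = (if u = t then 1 else 0)" if "u \<in> \<T>" for u
    using t that assms overlap[of t u] by (auto simp: indicator_def)
  hence "(\<Sum>u\<in>\<T>. indicat_real u y) = (\<Sum>u\<in>\<T>. if u = t then 1 else 0)" by (intro sum.cong) auto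
  thus ?thesis using t True finite_tiles by simp
next
  case False
  hence "indicat_real t y = 0" if "t \<in> \<T>" for t using that cover by (auto simp: indicator_def)
  thus ?thesis using False by simp
qed

text \<open>Compare the number of tiles containing \<open>x + \<epsilon> *\<^sub>R rot90 v\<close> with the number containing
  \<open>x - \<epsilon> *\<^sub>R rot90 v\<close>, for small \<open>\<epsilon> > 0\<close>.\<close>

lemma generic_point_jump:
  assumes v: "v \<noteq> 0" and x: "x = x0 + \<tau> *\<^sub>R v"
    and nz: "\<And>e. e \<in> (\<Union>t\<in>\<T>. E t) \<union> ES \<Longrightarrow> \<not> on_line x0 v e \<Longrightarrow> lside e x \<noteq> 0"
  shows "(\<Sum>t\<in>\<T>. \<Sum>e\<in>{e\<in>E t. on_line x0 v e}. sgn ((snd e - fst e) \<bullet> v) * indicat_real (closed_segment (fst e) (snd e)) x)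
    = (\<Sum>e\<in>{e\<in>ES. on_line x0 v e}. sgn ((snd e - fst e) \<bullet> v) * indicat_real (closed_segment (fst e) (snd e)) x)"
proof -
  let ?A = "(\<Union>t\<in>\<T>. E t) \<union> ES"
  have finA: "finite ?A" using finite_tiles tileD(1) outerD(1) by auto
  have finB: "finite {e\<in>?A. \<not> on_line x0 v e}" by (rule finite_subset[OF _ finA]) auto
  have "\<forall>\<^sub>F \<epsilon> in at_right 0. \<forall>e\<in>{e\<in>?A. \<not> on_line x0 v e}. \<forall>\<sigma>\<in>{1, - 1}.
      sgn (lside e (x + (\<sigma> * \<epsilon>) *\<^sub>R rot90 v)) = sgn (lside e x)"
    by (intro eventually_ball_finite finB ballI eventually_sgn_lside) (use nz in auto)
  moreover have "\<forall>\<^sub>F \<epsilon> in at_right (0::real). \<epsilon> > 0" by (rule eventually_at_right_less)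
  ultimately have "\<forall>\<^sub>F \<epsilon> in at_right (0::real). \<epsilon> > 0 \<and> (\<forall>e\<in>{e\<in>?A. \<not> on_line x0 v e}. \<forall>\<sigma>\<in>{1, - 1}.
      sgn (lside e (x + (\<sigma> * \<epsilon>) *\<^sub>R rot90 v)) = sgn (lside e x))" by eventually_elim simp
  then obtain \<epsilon> where \<epsilon>: "\<epsilon> > 0" and sg: "\<And>e \<sigma>. e \<in> ?A \<Longrightarrow> \<not> on_line x0 v e \<Longrightarrow> \<sigma> \<in> {1, - 1} \<Longrightarrow>
      sgn (lside e (x + (\<sigma> * \<epsilon>) *\<^sub>R rot90 v)) = sgn (lside e x)"
    using eventually_happens'[OF trivial_limit_at_right_real] by blast
  have off: "lside e (x + (\<sigma> * \<epsilon>) *\<^sub>R rot90 v) \<noteq> 0" if e: "e \<in> ?A" and \<sigma>: "\<sigma> \<in> {1, - 1}" for e \<sigma>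
  proof (cases "on_line x0 v e")
    case False
    thus ?thesis using sg[OF e False \<sigma>] nz[OF e False] by (metis sgn_0_0)
  next
    case True
    have "fst e \<noteq> snd e" using e tileD(2) outerD(2) by blast
    hence ne: "snd e - fst e \<noteq> 0" by simp
    have "(snd e - fst e) \<bullet> v \<noteq> 0"
    proof
      assume "(snd e - fst e) \<bullet> v = 0"
      moreover have "cross2 (snd e - fst e) v = 0" using True by (simp add: on_line_def)
      ultimately have "(norm (snd e - fst e))\<^sup>2 * (norm v)\<^sup>2 = 0" using cross2_inner_sq[of "snd e - fst e" v] by simp
      thus False using ne v by simp
    qed
    thus ?thesis using \<epsilon> \<sigma> on_line_lside[OF True, of \<tau>] x by (auto simp: lside_add cross2_algebra cross2_rot90)
  qed
  have sum_ind: "(\<Sum>t\<in>\<T>. indicat_real t (x + (\<sigma> * \<epsilon>) *\<^sub>R rot90 v)) = indicat_real S (x + (\<sigma> * \<epsilon>) *\<^sub>R rot90 v)"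
    if "\<sigma> \<in> {1, - 1}" for \<sigma>
    by (rule sum_indicator_tiles) (use off that tileD(5) in blast)
  have jump: "(\<Sum>e\<in>{e\<in>F. on_line x0 v e}. sgn ((snd e - fst e) \<bullet> v) * indicat_real (closed_segment (fst e) (snd e)) x)
      = indicat_real t (x + \<epsilon> *\<^sub>R rot90 v) - indicat_real t (x - \<epsilon> *\<^sub>R rot90 v)"
    if "is_ccw_triangle t F" "F \<subseteq> ?A" for t F
  proof (rule indicator_jump_triangle[OF that(1) v x _ \<epsilon>, symmetric])
    fix e \<sigma> assume "e \<in> F" and off_line: "\<not> on_line x0 v e"
    hence e: "e \<in> ?A" using that(2) by blast
    show "lside e x \<noteq> 0" by (rule nz[OF e off_line])
    show "\<sigma> \<in> {1, - 1} \<Longrightarrow> sgn (lside e (x + (\<sigma> * \<epsilon>) *\<^sub>R rot90 v)) = sgn (lside e x)"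
      by (rule sg[OF e off_line])
  qed
  have "(\<Sum>t\<in>\<T>. \<Sum>e\<in>{e\<in>E t. on_line x0 v e}. sgn ((snd e - fst e) \<bullet> v) * indicat_real (closed_segment (fst e) (snd e)) x)
      = (\<Sum>t\<in>\<T>. indicat_real t (x + \<epsilon> *\<^sub>R rot90 v) - indicat_real t (x - \<epsilon> *\<^sub>R rot90 v))"
    by (intro sum.cong refl jump tile) auto
  also have "\<dots> = indicat_real S (x + \<epsilon> *\<^sub>R rot90 v) - indicat_real S (x - \<epsilon> *\<^sub>R rot90 v)"
    using sum_ind[of 1] sum_ind[of "-1"] by (simp add: sum_subtractf)
  also have "\<dots> = (\<Sum>e\<in>{e\<in>ES. on_line x0 v e}. sgn ((snd e - fst e) \<bullet> v) * indicat_real (closed_segment (fst e) (snd e)) x)"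
    by (rule jump[OF outer, symmetric]) auto
  finally show ?thesis .
qed

text \<open>The pointwise identity of \<open>generic_point_jump\<close> is integrated along the
  line. It is available except where the line crosses the line of some other edge, and these are
  finitely many parameters. No vertex of one tile has to meet a vertex of another.\<close>

lemma line_sum:
  assumes v: "v \<noteq> 0"
  shows "(\<Sum>t\<in>\<T>. \<Sum>e\<in>{e\<in>E t. on_line x0 v e}. (snd e - fst e) \<bullet> v)
    = (\<Sum>e\<in>{e\<in>ES. on_line x0 v e}. (snd e - fst e) \<bullet> v)"
proof -
  let ?A = "(\<Union>t\<in>\<T>. E t) \<union> ES"
  let ?f = "\<lambda>e \<tau>. sgn ((snd e - fst e) \<bullet> v) * indicat_real (closed_segment (fst e) (snd e)) (x0 + \<tau> *\<^sub>R v)"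
  let ?L = "\<lambda>\<tau>. \<Sum>t\<in>\<T>. \<Sum>e\<in>{e\<in>E t. on_line x0 v e}. ?f e \<tau>"
  let ?R = "\<lambda>\<tau>. \<Sum>e\<in>{e\<in>ES. on_line x0 v e}. ?f e \<tau>"
  have finA: "finite ?A" using finite_tiles tileD(1) outerD(1) by auto
  have ne: "fst e \<noteq> snd e" if "e \<in> ?A" for e using that tileD(2) outerD(2) by blast
  have L: "has_bochner_integral lborel ?L (\<Sum>t\<in>\<T>. \<Sum>e\<in>{e\<in>E t. on_line x0 v e}. (snd e - fst e) \<bullet> v / (norm v)\<^sup>2)"
    by (intro has_bochner_integral_sum has_bochner_integral_edge_indicator v ne) auto
  have R: "has_bochner_integral lborel ?R (\<Sum>e\<in>{e\<in>ES. on_line x0 v e}. (snd e - fst e) \<bullet> v / (norm v)\<^sup>2)"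
    by (intro has_bochner_integral_sum has_bochner_integral_edge_indicator v ne) auto
  define bad where "bad = (\<Union>e\<in>{e\<in>?A. \<not> on_line x0 v e}. {\<tau>. lside e (x0 + \<tau> *\<^sub>R v) = 0})"
  have "finite {\<tau>. lside e (x0 + \<tau> *\<^sub>R v) = 0}" if "\<not> on_line x0 v e" for e
  proof (cases "cross2 (snd e - fst e) v = 0")
    case True
    thus ?thesis using that by (simp add: on_line_def lside_add cross2_algebra)
  next
    case False
    have "{\<tau>. lside e (x0 + \<tau> *\<^sub>R v) = 0} \<subseteq> {- lside e x0 / cross2 (snd e - fst e) v}"
      using False by (auto simp: lside_add cross2_algebra field_simps)
    thus ?thesis by (rule finite_subset) simp
  qed
  moreover have "finite {e\<in>?A. \<not> on_line x0 v e}" by (rule finite_subset[OF _ finA]) auto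
  ultimately have "finite bad" by (simp add: bad_def)
  hence "AE \<tau> in lborel. \<tau> \<notin> bad" by (intro AE_not_in finite_imp_null_set_lborel)
  hence "AE \<tau> in lborel. ?L \<tau> = ?R \<tau>"
  proof eventually_elim
    case (elim \<tau>)
    show ?case by (rule generic_point_jump[OF v refl]) (use elim in \<open>auto simp: bad_def\<close>)
  qed
  hence "integral\<^sup>L lborel ?L = integral\<^sup>L lborel ?R"
    using L R by (intro integral_cong_AE) (auto dest: borel_measurable_has_bochner_integral)
  hence "(\<Sum>t\<in>\<T>. \<Sum>e\<in>{e\<in>E t. on_line x0 v e}. (snd e - fst e) \<bullet> v / (norm v)\<^sup>2)
      = (\<Sum>e\<in>{e\<in>ES. on_line x0 v e}. (snd e - fst e) \<bullet> v / (norm v)\<^sup>2)"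
    using has_bochner_integral_integral_eq[OF L] has_bochner_integral_integral_eq[OF R] by simp
  thus ?thesis using v by (simp flip: sum_divide_distrib)
qed

end

section \<open>Boundary lengths, weighted sums and neighbouring tiles\<close>

abbreviation evec :: "point \<times> point \<Rightarrow> point" where "evec e \<equiv> snd e - fst e"

abbreviation elen :: "point \<times> point \<Rightarrow> real" where "elen e \<equiv> norm (evec e)"

lemma is_ccw_triangle_rotate:
  assumes "is_ccw_triangle t F" "e \<in> F"
  obtains r where "ccw (fst e) (snd e) r" "t = tri (fst e) (snd e) r" "F = ccw_edges (fst e) (snd e) r"
proof -
  obtain p q r where pqr: "ccw p q r" "t = tri p q r" "F = ccw_edges p q r"
    using assms(1) by (auto simp: is_ccw_triangle_def)
  have "e = (p, q) \<or> e = (q, r) \<or> e = (r, p)" using assms(2) by (auto simp: pqr(3) ccw_edges_def)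
  thus ?thesis
  proof (elim disjE)
    assume "e = (p, q)" thus ?thesis using that[of r] pqr by simp
  next
    assume "e = (q, r)" thus ?thesis using that[of p] pqr ccw_rotate ccw_edges_rotate tri_rotate by simp
  next
    assume "e = (r, p)" thus ?thesis
      using that[of q] pqr ccw_rotate[OF ccw_rotate[OF pqr(1)]] ccw_edges_rotate[of p q r] ccw_edges_rotate[of q r p]
        tri_rotate[of p q r] tri_rotate[of q r p] by simp
  qed
qed

lemma on_line_sym:
  assumes "fst e \<noteq> snd e" "fst f \<noteq> snd f" "on_line (fst f) (evec f) e"
  shows "on_line (fst e) (evec e) f"
proof -
  have v: "evec f \<noteq> 0" using assms(2) by simp
  obtain a b where "fst e = fst f + a *\<^sub>R evec f"
    using on_line_parametrization[OF v assms(1,3)] .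
  hence "lside f (fst e) = 0" by (simp add: lside_def cross2_algebra(6,9))
  moreover have "cross2 (evec f) (evec e) = 0"
    using assms(3) cross2_skew[of "evec f"] by (simp add: on_line_def)
  ultimately show ?thesis by (simp add: on_line_def)
qed

lemma on_line_iff_same_line:
  assumes "fst e \<noteq> snd e" "fst f \<noteq> snd f"
  shows "on_line (fst f) (evec f) e \<longleftrightarrow> {x. lside e x = 0} = {x. lside f x = 0}"
proof
  have sub: "{x. lside f x = 0} \<subseteq> {x. lside e x = 0}"
    if "fst f \<noteq> snd f" "on_line (fst f) (evec f) e" for e f
  proof
    fix x assume "x \<in> {x. lside f x = 0}"
    hence "cross2 (evec f) (x - fst f) = 0" by (simp add: lside_def)
    moreover have "evec f \<noteq> 0" using that(1) by simp
    ultimately obtain \<tau> where "x - fst f = \<tau> *\<^sub>R evec f" using cross2_eq_0 by blast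
    hence "x = fst f + \<tau> *\<^sub>R evec f" by (simp add: algebra_simps)
    thus "x \<in> {x. lside e x = 0}" using on_line_lside[OF that(2)] by simp
  qed
  show "{x. lside e x = 0} = {x. lside f x = 0}" if "on_line (fst f) (evec f) e"
    using sub[OF assms(2) that] sub[OF assms(1) on_line_sym[OF assms that]] by blast
next
  assume eq: "{x. lside e x = 0} = {x. lside f x = 0}"
  have "lside f (fst f) = 0" "lside f (snd f) = 0" by (simp_all add: lside_def cross2_algebra(9,11))
  hence e: "lside e (fst f) = 0" "lside e (snd f) = 0" using eq by blast+
  have "lside e (fst f + evec f) = lside e (fst f) + cross2 (evec e) (evec f)" by (rule lside_add)
  hence "cross2 (evec e) (evec f) = 0" using e by simp
  thus "on_line (fst f) (evec f) e" using e(1) by (simp add: on_line_def)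
qed

lemma frontier_nonvertex:
  assumes "is_ccw_triangle t F" "x \<in> frontier t" "x \<notin> fst ` F"
  obtains e where "e \<in> F" "lside e x = 0" "\<And>e'. e' \<in> F \<Longrightarrow> e' \<noteq> e \<Longrightarrow> lside e' x > 0"
proof -
  obtain e where e: "e \<in> F" "lside e x = 0" and xt: "x \<in> t"
    using assms(2) is_ccw_triangleD(5)[OF assms(1)] by blast
  obtain r where r: "ccw (fst e) (snd e) r" "t = tri (fst e) (snd e) r" "F = ccw_edges (fst e) (snd e) r"
    using is_ccw_triangle_rotate[OF assms(1) e(1)] .
  define D where "D = cross2 (snd e - fst e) (r - fst e)"
  have D: "D > 0" using r(1) by (simp add: D_def ccw_def)
  obtain \<tau> where \<tau>: "x = fst e + \<tau> *\<^sub>R (snd e - fst e)" "lside (snd e, r) x = (1 - \<tau>) * D" "lside (r, fst e) x = \<tau> * D"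
    using edge_point[OF r(1), of x] e(2) by (auto simp: D_def)
  have "0 \<le> lside (snd e, r) x" "0 \<le> lside (r, fst e) x"
    using xt is_ccw_triangleD(3)[OF assms(1), of x] r(3) by (auto simp: ccw_edges_def)
  hence "0 \<le> \<tau>" "\<tau> \<le> 1" using \<tau> D by (auto simp: zero_le_mult_iff)
  moreover have "x \<noteq> fst e" "x \<noteq> snd e" using assms(3) by (auto simp: r(3) ccw_edges_def)
  hence "\<tau> \<noteq> 0" "\<tau> \<noteq> 1" using \<tau>(1) by auto
  ultimately have "0 < lside (snd e, r) x" "0 < lside (r, fst e) x" using \<tau> D by auto
  hence "lside e' x > 0" if "e' \<in> F" "e' \<noteq> e" for e'
    using that by (auto simp: r(3) ccw_edges_def)
  thus ?thesis using that e by blast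
qed

text \<open>The test vector is a quarter turn of the bisector direction of \<open>u\<close> and
  \<open>v\<close>. Its cross products with both are positive multiples of
  \<open>norm u * norm v + u \<bullet> v\<close>, which therefore cannot be positive: this is
  equality in Cauchy-Schwarz for \<open>- u\<close> and \<open>v\<close>.\<close>

lemma antiparallel:
  fixes u v :: point
  assumes "u \<noteq> 0" "v \<noteq> 0" and no: "\<And>h. cross2 u h > 0 \<Longrightarrow> cross2 v h > 0 \<Longrightarrow> False"
  shows "sgn v = - sgn u"
proof -
  define h where "h = rot90 (norm v *\<^sub>R u + norm u *\<^sub>R v)"
  have "cross2 u h = norm u * (norm u * norm v + u \<bullet> v)" "cross2 v h = norm v * (norm u * norm v + u \<bullet> v)"
    by (simp_all add: h_def cross2_rot90 inner_add_right power2_norm_eq_inner[symmetric] power2_eq_square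
        inner_commute algebra_simps)
  hence "\<not> norm u * norm v + u \<bullet> v > 0" using no[of h] assms(1,2) by auto
  moreover have "- (u \<bullet> v) \<le> norm u * norm v" using norm_cauchy_schwarz[of "- u" v] by simp
  ultimately have "(- u) \<bullet> v = norm (- u) * norm v" by simp
  hence "norm (- u) *\<^sub>R v = norm v *\<^sub>R (- u)" by (rule norm_cauchy_schwarz_eq[THEN iffD1])
  hence "norm u *\<^sub>R v = norm v *\<^sub>R (- u)" by (simp only: norm_minus_cancel)
  hence "(1 / (norm u * norm v)) *\<^sub>R (norm u *\<^sub>R v) = (1 / (norm u * norm v)) *\<^sub>R (norm v *\<^sub>R (- u))" by simp
  moreover have "(1 / (norm u * norm v)) *\<^sub>R (norm u *\<^sub>R v) = sgn v"
    "(1 / (norm u * norm v)) *\<^sub>R (norm v *\<^sub>R (- u)) = - sgn u"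
    using assms(1,2) by (simp_all add: sgn_div_norm field_simps)
  ultimately show ?thesis by simp
qed

context ccw_tiling
begin

text \<open>Every tile lies on the inner side of \<open>f\<close>, so all tile edges on its line
  point the same way as \<open>f\<close>, and the signed lengths in \<open>line_sum\<close> are
  plain lengths.\<close>

lemma boundary_edge_sum:
  assumes f: "f \<in> ES"
  shows "elen f = (\<Sum>t\<in>\<T>. \<Sum>e\<in>{e\<in>E t. on_line (fst f) (evec f) e}. elen e)"
proof -
  define v where "v = evec f"
  have v: "v \<noteq> 0" using outerD(2)[OF f] by (simp add: v_def)
  obtain R where R: "ccw (fst f) (snd f) R" "ES = ccw_edges (fst f) (snd f) R"
    using is_ccw_triangle_rotate[OF outer f] .
  have on_f: "on_line (fst f) v f" by (simp add: on_line_def v_def lside_def cross2_algebra(9,11))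
  have "{e\<in>ES. on_line (fst f) v e} = {f}"
    using on_line_unique[OF R(1) v, of "fst f"] on_f f unfolding R(2) by auto
  hence "(\<Sum>t\<in>\<T>. \<Sum>e\<in>{e\<in>E t. on_line (fst f) v e}. evec e \<bullet> v) = v \<bullet> v"
    using line_sum[OF v, of "fst f"] by (simp add: v_def)
  moreover have "evec e \<bullet> v = elen e * norm v"
    if t: "t \<in> \<T>" and e: "e \<in> E t" "on_line (fst f) v e" for t e
  proof -
    obtain r where r: "ccw (fst e) (snd e) r" "t = tri (fst e) (snd e) r" "E t = ccw_edges (fst e) (snd e) r"
      using is_ccw_triangle_rotate[OF tile[OF t] e(1)] .
    have "r \<in> S" using t cover r(2) by (auto simp: tri_def hull_inc)
    hence rf: "0 \<le> lside f r" using outerD(3) f by blast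
    have par: "\<exists>c. u = c *\<^sub>R v" if "cross2 u v = 0" for u
      using cross2_eq_0[OF v, of u] that cross2_skew[of u v] by auto
    obtain c where c: "evec e = c *\<^sub>R v" using par e(2) by (auto simp: on_line_def)
    obtain a b where ab: "fst e = fst f + a *\<^sub>R v"
      using on_line_parametrization[OF v _ e(2)] tileD(2)[OF t e(1)] by metis
    have "lside f r = cross2 v (r - fst f)" by (simp add: lside_def v_def)
    moreover have "cross2 (evec e) (r - fst e) = cross2 (c *\<^sub>R v) (r - fst e)" by (simp only: c)
    moreover have "\<dots> = c * cross2 v (r - fst f)" unfolding ab by (simp add: cross2_algebra right_diff_distrib)
    ultimately have "cross2 (evec e) (r - fst e) = c * lside f r" by simp
    moreover have "cross2 (evec e) (r - fst e) > 0" using r(1) by (simp add: ccw_def)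
    ultimately have "c > 0" using rf by (auto simp: zero_less_mult_iff)
    thus ?thesis unfolding c by (simp add: power2_norm_eq_inner[symmetric] power2_eq_square)
  qed
  ultimately have "(\<Sum>t\<in>\<T>. \<Sum>e\<in>{e\<in>E t. on_line (fst f) v e}. elen e * norm v) = norm v * norm v"
    by (simp add: power2_norm_eq_inner[symmetric] power2_eq_square)
  hence "(\<Sum>t\<in>\<T>. \<Sum>e\<in>{e\<in>E t. on_line (fst f) v e}. elen e) * norm v = norm v * norm v"
    by (simp add: sum_distrib_right)
  thus ?thesis using v by (simp add: v_def)
qed

text \<open>On a fixed line only two opposite directions occur. As \<open>g\<close> is odd, the
  weighted length of an edge there is a fixed multiple of its signed length, so
  \<open>line_sum\<close> applies line by line.\<close>

lemma odd_weight_sum: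
  assumes odd: "\<And>u. g (- u) = - g u"
  shows "(\<Sum>t\<in>\<T>. \<Sum>e\<in>E t. g (sgn (evec e)) * elen e) = (\<Sum>e\<in>ES. g (sgn (evec e)) * elen e)"
proof -
  define A where "A = (\<Union>t\<in>\<T>. E t) \<union> ES"
  have finA: "finite A" using finite_tiles tileD(1) outerD(1) by (auto simp: A_def)
  have ne: "fst e \<noteq> snd e" if "e \<in> A" for e using that tileD(2) outerD(2) by (auto simp: A_def)
  define L where "L = (\<lambda>e. {x. lside e x = 0})"
  \<comment> \<open>One edge is chosen for each occurring line; it fixes the base point and the
    direction in which signed lengths are measured.\<close>
  define rep where "rep = (\<lambda>l. SOME f. f \<in> A \<and> L f = l)"
  have rep: "rep l \<in> A \<and> L (rep l) = l" if "l \<in> L ` A" for l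
    unfolding rep_def by (rule someI_ex) (use that in auto)
  have on_L: "on_line (fst (rep l)) (evec (rep l)) e \<longleftrightarrow> L e = l" if "l \<in> L ` A" "e \<in> A" for l e
    using on_line_iff_same_line[OF ne[OF that(2)] ne, of "rep l"] rep[OF that(1)] by (simp add: L_def)
  define k where "k = (\<lambda>l. g (sgn (evec (rep l))) / elen (rep l))"
  have weight: "g (sgn (evec e)) * elen e = (\<Sum>l\<in>L ` A. if L e = l then k l * (evec e \<bullet> evec (rep l)) else 0)"
    if e: "e \<in> A" for e
  proof -
    define v where "v = evec (rep (L e))"
    have "fst (rep (L e)) \<noteq> snd (rep (L e))" using rep[of "L e"] ne e by blast
    hence v: "v \<noteq> 0" by (simp add: v_def)
    have "on_line (fst (rep (L e))) v e" using on_L[of "L e" e] e by (simp add: v_def)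
    hence "cross2 v (evec e) = 0" using cross2_skew[of v] by (simp add: on_line_def)
    then obtain c where c: "evec e = c *\<^sub>R v" using cross2_eq_0[OF v] by blast
    have c0: "c \<noteq> 0" using c ne[OF e] by auto
    have "g (sgn (evec e)) = sgn c * g (sgn v)"
      using c0 odd by (cases "c > 0") (auto simp: c sgn_scaleR)
    moreover have "elen e = \<bar>c\<bar> * norm v" by (simp add: c)
    ultimately have "g (sgn (evec e)) * elen e = (sgn c * \<bar>c\<bar>) * g (sgn v) * norm v" by (simp add: mult_ac)
    also have "\<dots> = c * g (sgn v) * norm v" by (simp only: mult_sgn_abs)
    also have "\<dots> = k (L e) * (evec e \<bullet> evec (rep (L e)))"
      using v by (simp add: k_def v_def[symmetric] c power2_norm_eq_inner[symmetric] power2_eq_square)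
    finally show ?thesis using e finA by (simp add: sum.delta)
  qed
  have swap: "(\<Sum>e\<in>F. g (sgn (evec e)) * elen e) =
      (\<Sum>l\<in>L ` A. k l * (\<Sum>e\<in>{e\<in>F. on_line (fst (rep l)) (evec (rep l)) e}. evec e \<bullet> evec (rep l)))"
    if F: "F \<subseteq> A" for F
  proof -
    have finF: "finite F" using F finA finite_subset by blast
    have "(\<Sum>e\<in>F. g (sgn (evec e)) * elen e) =
        (\<Sum>e\<in>F. \<Sum>l\<in>L ` A. if L e = l then k l * (evec e \<bullet> evec (rep l)) else 0)"
      by (intro sum.cong refl weight) (use F in auto)
    also have "\<dots> = (\<Sum>l\<in>L ` A. \<Sum>e\<in>F. if L e = l then k l * (evec e \<bullet> evec (rep l)) else 0)"
      by (rule sum.swap)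
    also have "\<dots> = (\<Sum>l\<in>L ` A. \<Sum>e\<in>F. if on_line (fst (rep l)) (evec (rep l)) e then k l * (evec e \<bullet> evec (rep l)) else 0)"
    proof (intro sum.cong refl)
      fix l e assume "l \<in> L ` A" "e \<in> F"
      thus "(if L e = l then k l * (evec e \<bullet> evec (rep l)) else 0) =
          (if on_line (fst (rep l)) (evec (rep l)) e then k l * (evec e \<bullet> evec (rep l)) else 0)"
        using on_L[of l e] F by auto
    qed
    also have "\<dots> = (\<Sum>l\<in>L ` A. \<Sum>e\<in>{e\<in>F. on_line (fst (rep l)) (evec (rep l)) e}. k l * (evec e \<bullet> evec (rep l)))"
      by (intro sum.cong refl sum.inter_filter[symmetric] finF)
    finally show ?thesis by (simp add: sum_distrib_left)
  qed
  have "(\<Sum>t\<in>\<T>. \<Sum>e\<in>E t. g (sgn (evec e)) * elen e) =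
      (\<Sum>t\<in>\<T>. \<Sum>l\<in>L ` A. k l * (\<Sum>e\<in>{e\<in>E t. on_line (fst (rep l)) (evec (rep l)) e}. evec e \<bullet> evec (rep l)))"
    by (intro sum.cong refl swap) (auto simp: A_def)
  also have "\<dots> = (\<Sum>l\<in>L ` A. \<Sum>t\<in>\<T>. k l * (\<Sum>e\<in>{e\<in>E t. on_line (fst (rep l)) (evec (rep l)) e}. evec e \<bullet> evec (rep l)))"
    by (rule sum.swap)
  also have "\<dots> = (\<Sum>l\<in>L ` A. k l * (\<Sum>e\<in>{e\<in>ES. on_line (fst (rep l)) (evec (rep l)) e}. evec e \<bullet> evec (rep l)))"
  proof (intro sum.cong refl)
    fix l assume "l \<in> L ` A"
    hence "evec (rep l) \<noteq> 0" using rep ne by (metis right_minus_eq)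
    thus "(\<Sum>t\<in>\<T>. k l * (\<Sum>e\<in>{e\<in>E t. on_line (fst (rep l)) (evec (rep l)) e}. evec e \<bullet> evec (rep l))) =
        k l * (\<Sum>e\<in>{e\<in>ES. on_line (fst (rep l)) (evec (rep l)) e}. evec e \<bullet> evec (rep l))"
      by (simp add: line_sum flip: sum_distrib_left)
  qed
  also have "\<dots> = (\<Sum>e\<in>ES. g (sgn (evec e)) * elen e)"
    by (intro swap[symmetric]) (auto simp: A_def)
  finally show ?thesis .
qed

text \<open>Near a common point that is not a vertex, each tile looks like the half-plane to the
  left of one edge. Two such half-planes have disjoint interiors only if their edges are opposite,
  and then the tiles share a short segment from \<open>x\<close> along the edge.\<close>

lemma shared_edge:
  assumes t: "t \<in> \<T>" and u: "u \<in> \<T>" and "t \<noteq> u" and x: "x \<in> t" "x \<in> u" "x \<notin> fst ` E t" "x \<notin> fst ` E u"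
  shows "\<exists>e\<in>E t. \<exists>f\<in>E u. sgn (evec f) = - sgn (evec e) \<and>
    (\<exists>y z. y \<noteq> z \<and> closed_segment y z \<subseteq> frontier t \<inter> frontier u)"
proof -
  have fr: "x \<in> frontier t" "x \<in> frontier u" using overlap[OF t u \<open>t \<noteq> u\<close>] x by auto
  obtain e where e: "e \<in> E t" "lside e x = 0" "\<And>e'. e' \<in> E t \<Longrightarrow> e' \<noteq> e \<Longrightarrow> lside e' x > 0"
    using frontier_nonvertex[OF tile[OF t] fr(1) x(3)] by blast
  obtain f where f: "f \<in> E u" "lside f x = 0" "\<And>f'. f' \<in> E u \<Longrightarrow> f' \<noteq> f \<Longrightarrow> lside f' x > 0"
    using frontier_nonvertex[OF tile[OF u] fr(2) x(4)] by blast
  have "fst e \<noteq> snd e" "fst f \<noteq> snd f" using tileD(2) t u e(1) f(1) by blast+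
  hence ne: "evec e \<noteq> 0" "evec f \<noteq> 0" by simp_all
  have near: "\<forall>\<^sub>F \<epsilon> in at_right 0. \<forall>e'\<in>E t - {e} \<union> (E u - {f}). 0 < lside e' (x + \<epsilon> *\<^sub>R h)" for h
  proof -
    have "\<forall>\<^sub>F \<epsilon> in at_right 0. \<forall>e'\<in>E t - {e} \<union> (E u - {f}). sgn (lside e' (x + (1 * \<epsilon>) *\<^sub>R h)) = sgn (lside e' x)"
      by (intro eventually_ball_finite ballI eventually_sgn_lside)
        (use tileD(1) t u e(3) f(3) in \<open>auto simp: less_le\<close>)
    thus ?thesis
    proof eventually_elim
      case (elim \<epsilon>)
      show ?case
      proof
        fix e' assume e': "e' \<in> E t - {e} \<union> (E u - {f})"
        hence "lside e' x > 0" using e(3) f(3) by blast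
        moreover have "sgn (lside e' (x + \<epsilon> *\<^sub>R h)) = sgn (lside e' x)" using elim e' by simp
        ultimately show "0 < lside e' (x + \<epsilon> *\<^sub>R h)" by (simp add: sgn_1_pos)
      qed
    qed
  qed
  have pos: "\<forall>\<^sub>F \<epsilon> in at_right (0::real). \<epsilon> > 0" by (rule eventually_at_right_less)
  have anti: "sgn (evec f) = - sgn (evec e)"
  proof (rule antiparallel[OF ne])
    fix h assume h: "0 < cross2 (evec e) h" "0 < cross2 (evec f) h"
    from near[of h] pos have "\<forall>\<^sub>F \<epsilon> in at_right (0::real). x + \<epsilon> *\<^sub>R h \<in> interior t \<inter> interior u"
    proof eventually_elim
      case (elim \<epsilon>)
      have "0 < lside e (x + \<epsilon> *\<^sub>R h)" "0 < lside f (x + \<epsilon> *\<^sub>R h)"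
        using h elim(2) e(2) f(2) by (simp_all add: lside_add cross2_algebra(6))
      thus ?case using elim(1) tileD(4)[OF t] tileD(4)[OF u] by blast
    qed
    then obtain \<epsilon> where "x + \<epsilon> *\<^sub>R h \<in> interior t \<inter> interior u"
      using eventually_happens'[OF trivial_limit_at_right_real] by blast
    moreover have "interior t \<inter> interior u = {}"
      using overlap[OF t u \<open>t \<noteq> u\<close>] interior_subset[of t] interior_subset[of u] by (auto simp: frontier_def)
    ultimately show False by blast
  qed
  have par: "cross2 (evec f) (evec e) = 0" "cross2 (evec e) (evec e) = 0"
  proof -
    have "evec f = elen f *\<^sub>R (- sgn (evec e))" "evec e = elen e *\<^sub>R sgn (evec e)"
      using ne unfolding anti[symmetric] by (simp_all add: sgn_div_norm)
    hence "cross2 (evec f) (evec e) = cross2 (elen f *\<^sub>R (- sgn (evec e))) (elen e *\<^sub>R sgn (evec e))"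
      by (rule arg_cong2)
    also have "\<dots> = 0" by (simp only: cross2_algebra(5,6,7,9) mult_zero_right minus_zero)
    finally show "cross2 (evec f) (evec e) = 0" .
    show "cross2 (evec e) (evec e) = 0" by (rule cross2_algebra(9))
  qed
  from near[of "evec e"] pos have "\<forall>\<^sub>F \<epsilon> in at_right (0::real). \<epsilon> > 0 \<and> x + \<epsilon> *\<^sub>R evec e \<in> t \<inter> u"
  proof eventually_elim
    case (elim \<epsilon>)
    have "lside e (x + \<epsilon> *\<^sub>R evec e) = 0" "lside f (x + \<epsilon> *\<^sub>R evec e) = 0"
      using e(2) f(2) par by (simp_all only: lside_add cross2_algebra(6) mult_zero_right add_0_right)
    hence "\<forall>e'\<in>E t \<union> E u. 0 \<le> lside e' (x + \<epsilon> *\<^sub>R evec e)" using elim(1) by (metis DiffI Un_iff less_imp_le order_refl singletonD)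
    thus ?case using elim(2) tileD(3)[OF t] tileD(3)[OF u] by blast
  qed
  then obtain \<epsilon> where \<epsilon>: "\<epsilon> > 0" "x + \<epsilon> *\<^sub>R evec e \<in> t \<inter> u"
    using eventually_happens'[OF trivial_limit_at_right_real] by blast
  let ?z = "x + \<epsilon> *\<^sub>R evec e"
  have "closed_segment x ?z \<subseteq> frontier t \<inter> frontier u"
  proof
    fix y assume y: "y \<in> closed_segment x ?z"
    have "convex (t \<inter> u)" using tileD(7) t u by (simp add: convex_Int)
    hence "y \<in> t \<inter> u" using y \<epsilon>(2) x(1,2) closed_segment_subset[of x "t \<inter> u" ?z] by blast
    moreover obtain s where "y = (1 - s) *\<^sub>R x + s *\<^sub>R ?z" using y by (auto simp: in_segment)
    hence "y = x + (s * \<epsilon>) *\<^sub>R evec e" by (simp add: algebra_simps)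
    hence "lside e y = 0" "lside f y = 0"
      using e(2) f(2) par by (simp_all only: lside_add cross2_algebra(6) mult_zero_right add_0_right)
    ultimately show "y \<in> frontier t \<inter> frontier u"
      using tileD(5)[OF t] tileD(5)[OF u] e(1) f(1) by blast
  qed
  moreover have "x \<noteq> ?z" using \<epsilon>(1) ne(1) by simp
  ultimately show ?thesis using e(1) f(1) anti by blast
qed

text \<open>The interior of \<open>S\<close> stays connected when the finitely many vertices are removed, so any two tiles
  are linked by a chain of tiles sharing edge segments.\<close>

lemma constant_across_edges:
  assumes adj: "\<And>t u e f. t \<in> \<T> \<Longrightarrow> u \<in> \<T> \<Longrightarrow> t \<noteq> u \<Longrightarrow> e \<in> E t \<Longrightarrow> f \<in> E u \<Longrightarrow> sgn (evec f) = - sgn (evec e) \<Longrightarrow>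
      \<exists>y z. y \<noteq> z \<and> closed_segment y z \<subseteq> frontier t \<inter> frontier u \<Longrightarrow> h t = h u"
    and t0: "t0 \<in> \<T>" and t1: "t1 \<in> \<T>"
  shows "h t1 = h t0"
proof (rule ccontr)
  assume ne: "h t1 \<noteq> h t0"
  define W where "W = (\<Union>t\<in>\<T>. fst ` E t)"
  have finW: "finite W" using finite_tiles tileD(1) by (auto simp: W_def)
  define A where "A = \<Union>{t\<in>\<T>. h t = h t0}"
  define B where "B = \<Union>{t\<in>\<T>. h t \<noteq> h t0}"
  have closed: "closed A" "closed B" unfolding A_def B_def using finite_tiles tileD(6) by (auto intro!: closed_Union)
  have AB: "A \<union> B = S" unfolding A_def B_def using cover by blast
  have "connected (interior S)" using outerD(7) by (intro convex_connected convex_interior)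
  hence conn: "connected (interior S - W)" by (intro connected_open_delete_finite finW) auto
  have meets: "t \<inter> (interior S - W) \<noteq> {}" if t: "t \<in> \<T>" for t
  proof -
    obtain x r where r: "r > 0" "ball x r \<subseteq> interior t"
      using tileD(8)[OF t] open_interior[of t] open_contains_ball by blast
    have "infinite (ball x r)" using uncountable_ball[OF r(1), of x] countable_finite by blast
    then obtain y where y: "y \<in> ball x r" "y \<notin> W" using finW by (meson finite_subset subsetI)
    have "interior t \<subseteq> interior S" using t cover by (intro interior_mono) auto
    thus ?thesis using y r interior_subset[of t] by blast
  qed
  have "A \<inter> (interior S - W) \<noteq> {}" using meets[OF t0] t0 by (auto simp: A_def)
  moreover have "B \<inter> (interior S - W) \<noteq> {}" using meets[OF t1] t1 ne by (auto simp: B_def)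
  moreover have "interior S - W \<subseteq> A \<union> B" using AB interior_subset[of S] by blast
  ultimately have "A \<inter> B \<inter> (interior S - W) \<noteq> {}" using connected_closedD[OF conn _ _ closed] by blast
  then obtain x t u where x: "x \<notin> W" and t: "t \<in> \<T>" "h t = h t0" "x \<in> t" and u: "u \<in> \<T>" "h u \<noteq> h t0" "x \<in> u"
    by (auto simp: A_def B_def)
  have "t \<noteq> u" using t u by auto
  moreover have "x \<notin> fst ` E t" "x \<notin> fst ` E u" using x t(1) u(1) by (auto simp: W_def)
  ultimately have "h t = h u" using shared_edge[OF t(1) u(1) _ t(3) u(3)] adj[OF t(1) u(1)] by blast
  thus False using t u by simp
qed

end

section \<open>Angles, areas and similarity\<close>

definition cx :: "point \<Rightarrow> complex" where "cx v = Complex (v $ 1) (v $ 2)"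

lemma cx_minus [simp]: "cx (- v) = - cx v"
  by (simp add: cx_def complex_eq_iff)

lemma cx_scaleR: "cx (k *\<^sub>R v) = of_real k * cx v"
  by (simp add: cx_def complex_eq_iff)

lemma cx_sgn: "cx (sgn v) = cx v / of_real (norm v)"
  by (simp add: sgn_div_norm cx_scaleR field_simps)

lemma norm_cx [simp]: "norm (cx v) = norm v"
  by (simp add: cx_def cmod_def norm_eq_sqrt_inner inner2 power2_eq_square)

lemma cx_eq_0_iff [simp]: "cx v = 0 \<longleftrightarrow> v = 0"
  by (metis norm_cx norm_eq_zero)

lemma cnj_cx_mult: "cnj (cx u) * cx v = Complex (u \<bullet> v) (cross2 u v)"
  by (simp add: cx_def complex_eq_iff inner2 cross2_def)

lemma abs_inner_quotient_le_1:
  fixes u v :: "'a::real_inner"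
  shows "\<bar>u \<bullet> v / (norm u * norm v)\<bar> \<le> 1"
proof (cases "u = 0 \<or> v = 0")
  case False
  hence "norm u * norm v > 0" by simp
  thus ?thesis using Cauchy_Schwarz_ineq2[of u v] by (simp add: abs_mult divide_le_eq)
qed auto

lemma angle_bounds: "0 \<le> angle X Y Z" "angle X Y Z \<le> pi"
proof -
  have "\<bar>inner (X - Y) (Z - Y) / (norm (X - Y) * norm (Z - Y))\<bar> \<le> 1"
    by (rule abs_inner_quotient_le_1)
  thus "0 \<le> angle X Y Z" "angle X Y Z \<le> pi"
    unfolding angle_def abs_le_iff by (intro arccos_lbound arccos_ubound; linarith)+
qed

lemma angle_cos:
  assumes "X \<noteq> Y" "Z \<noteq> Y"
  shows "norm (X - Y) * norm (Z - Y) * cos (angle X Y Z) = (X - Y) \<bullet> (Z - Y)"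
proof -
  have "\<bar>inner (X - Y) (Z - Y) / (norm (X - Y) * norm (Z - Y))\<bar> \<le> 1"
    by (rule abs_inner_quotient_le_1)
  hence "cos (angle X Y Z) = inner (X - Y) (Z - Y) / (norm (X - Y) * norm (Z - Y))"
    unfolding angle_def abs_le_iff by (intro cos_arccos; linarith)
  thus ?thesis using assms by simp
qed

lemma angle_sin:
  assumes "X \<noteq> Y" "Z \<noteq> Y"
  shows "norm (X - Y) * norm (Z - Y) * sin (angle X Y Z) = \<bar>cross2 (X - Y) (Z - Y)\<bar>"
proof (rule power2_eq_imp_eq)
  let ?m = "norm (X - Y) * norm (Z - Y)"
  have "(?m * sin (angle X Y Z))\<^sup>2 = ?m\<^sup>2 - (?m * cos (angle X Y Z))\<^sup>2"
    by (simp add: power_mult_distrib sin_squared_eq right_diff_distrib)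
  also have "\<dots> = (cross2 (X - Y) (Z - Y))\<^sup>2"
    unfolding angle_cos[OF assms] using cross2_inner_sq[of "X - Y" "Z - Y"] by (simp add: power_mult_distrib)
  finally show "(?m * sin (angle X Y Z))\<^sup>2 = \<bar>cross2 (X - Y) (Z - Y)\<bar>\<^sup>2" by simp
  show "0 \<le> ?m * sin (angle X Y Z)"
    using angle_bounds[of X Y Z] by (simp add: sin_ge_zero)
qed simp

lemma angle_commute: "angle X Y Z = angle Z Y X"
  by (simp add: angle_def inner_commute mult.commute)

text \<open>At a vertex the boundary turns left by the exterior angle, and
  \<open>cis (pi - x) = - cis (- x)\<close>.\<close>

lemma sgn_evec_turn:
  assumes "ccw p q r"
  shows "cx (sgn (r - q)) = - cis (- angle p q r) * cx (sgn (q - p))"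
proof -
  have ne: "p \<noteq> q" "r \<noteq> q" using ccw_distinct[OF assms] by auto
  have "cross2 (r - q) (p - q) > 0" using ccw_rotate[OF assms] by (simp add: ccw_def)
  hence "norm (r - q) * norm (p - q) * sin (angle p q r) = cross2 (r - q) (p - q)"
    "norm (r - q) * norm (p - q) * cos (angle p q r) = (r - q) \<bullet> (p - q)"
    using angle_sin[of r q p] angle_cos[of r q p] ne angle_commute[of p q r] by simp_all
  hence "cnj (cx (r - q)) * cx (p - q) = of_real (norm (r - q) * norm (p - q)) * cis (angle p q r)"
    unfolding cnj_cx_mult by (simp add: complex_eq_iff)
  hence "cx (r - q) * (cnj (cx (r - q)) * cx (p - q)) * cis (- angle p q r) =
      cx (r - q) * (of_real (norm (r - q) * norm (p - q)) * (cis (angle p q r) * cis (- angle p q r)))"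
    by simp
  moreover have "cx (r - q) * cnj (cx (r - q)) = of_real ((norm (r - q))\<^sup>2)"
    using complex_norm_square[of "cx (r - q)"] by simp
  ultimately have "of_real ((norm (r - q))\<^sup>2) * cx (p - q) * cis (- angle p q r) =
      of_real (norm (r - q) * norm (p - q)) * cx (r - q)"
    by (simp add: cis_mult mult_ac)
  hence "of_real (norm (r - q)) * (of_real (norm (r - q)) * cx (p - q) * cis (- angle p q r)) =
      of_real (norm (r - q)) * (of_real (norm (p - q)) * cx (r - q))"
    by (simp add: power2_eq_square mult_ac)
  hence eq: "of_real (norm (r - q)) * cx (p - q) * cis (- angle p q r) = of_real (norm (p - q)) * cx (r - q)"
    using ne by (subst (asm) mult_left_cancel) auto
  have "cx (sgn (r - q)) = cis (- angle p q r) * cx (sgn (p - q))"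
    using eq ne by (simp add: cx_sgn field_simps)
  also have "sgn (p - q) = - sgn (q - p)" using sgn_minus[of "q - p"] by simp
  finally show ?thesis by simp
qed

lemma law_of_sines:
  fixes p q r :: point
  assumes "\<not> collinear {p, q, r}"
  defines "D \<equiv> \<bar>cross2 (q - p) (r - p)\<bar>"
  shows "D > 0"
    and "dist p q * dist p r * sin (angle q p r) = D"
    and "dist p q * dist q r * sin (angle p q r) = D"
    and "dist p r * dist q r * sin (angle p r q) = D"
    and "p \<noteq> q" "q \<noteq> r" "p \<noteq> r"
proof -
  show "D > 0" using assms(1) not_collinear_cross2 by (simp add: D_def)
  show ne: "p \<noteq> q" "q \<noteq> r" "p \<noteq> r" using assms(1) by (auto simp: insert_commute)
  have "D = \<bar>cross2 (p - q) (r - q)\<bar>" "D = \<bar>cross2 (p - r) (q - r)\<bar>"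
    by (simp_all add: D_def cross2_def algebra_simps)
  thus "dist p q * dist p r * sin (angle q p r) = D"
    "dist p q * dist q r * sin (angle p q r) = D"
    "dist p r * dist q r * sin (angle p r q) = D"
    using angle_sin[of q p r] angle_sin[of p q r] angle_sin[of p r q] ne
    by (simp_all add: D_def dist_norm norm_minus_commute mult_ac)
qed

lemma angle_strict_bounds:
  assumes "\<not> collinear {p, q, r}"
  shows "0 < angle q p r" "angle q p r < pi"
proof -
  have "sin (angle q p r) \<noteq> 0" using law_of_sines(1,2)[OF assms] by auto
  thus "0 < angle q p r" "angle q p r < pi"
    using angle_bounds[of q p r] by (auto simp: less_le)
qed

text \<open>Three turns lead back to the initial direction, which makes the sum an odd multiple of
  \<open>pi\<close>; each angle is strictly between 0 and \<open>pi\<close>, so the multiple is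
  one.\<close>

lemma angle_sum_ccw:
  assumes "ccw p q r"
  shows "angle q p r + angle p q r + angle p r q = pi"
proof -
  define \<theta> where "\<theta> = angle q p r + angle p q r + angle p r q"
  let ?d = "cx (sgn (q - p))"
  have "?d = - cis (- angle r p q) * (- cis (- angle q r p) * (- cis (- angle p q r) * ?d))"
    unfolding sgn_evec_turn[OF assms, symmetric] sgn_evec_turn[OF ccw_rotate[OF assms], symmetric]
    by (rule sgn_evec_turn[OF ccw_rotate[OF ccw_rotate[OF assms]]])
  also have "\<dots> = - cis (- \<theta>) * ?d"
  proof -
    have "cis (- \<theta>) = cis (- angle r p q) * cis (- angle q r p) * cis (- angle p q r)"
      unfolding cis_mult \<theta>_def angle_commute[of r p q] angle_commute[of q r p] by (simp add: add_ac)
    thus ?thesis by simp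
  qed
  finally have "?d = - (cis (- \<theta>) * ?d)" by simp
  hence "?d + cis (- \<theta>) * ?d = 0" by (simp only: eq_neg_iff_add_eq_0)
  hence "(1 + cis (- \<theta>)) * ?d = 0" by (simp add: distrib_right)
  moreover have "?d \<noteq> 0" using ccw_distinct[OF assms] by (auto simp: sgn_zero_iff)
  ultimately have "cis (- \<theta>) = - 1" by (simp add: eq_neg_iff_add_eq_0 add.commute)
  hence "cos \<theta> = - 1" by (simp add: complex_eq_iff)
  then obtain n :: int where n: "\<theta> = (2 * n + 1) * pi" using cos_eq_minus1 by auto
  have nc: "\<not> collinear {p, q, r}" using assms not_collinear_ccw by blast
  hence nc': "\<not> collinear {q, p, r}" "\<not> collinear {r, p, q}" by (simp_all add: insert_commute)
  have "0 < \<theta>" "\<theta> < 3 * pi"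
    using angle_strict_bounds[OF nc] angle_strict_bounds[OF nc'(1)] angle_strict_bounds[OF nc'(2)]
    by (simp_all add: \<theta>_def)
  hence "0 * pi < (2 * n + 1) * pi" "(2 * n + 1) * pi < 3 * pi" using n by simp_all
  hence "0 < real_of_int (2 * n + 1)" "real_of_int (2 * n + 1) < 3"
    by (simp_all only: mult_less_cancel_right_pos[OF pi_gt_zero] of_int_add of_int_mult of_int_numeral of_int_1)
  hence "n = 0" by linarith
  thus ?thesis using n by (simp add: \<theta>_def)
qed

lemma angle_sum:
  assumes "\<not> collinear {p, q, r}"
  shows "angle q p r + angle p q r + angle p r q = pi"
proof (cases "ccw p q r")
  case False
  hence "ccw p r q" using assms not_collinear_ccw by blast
  from angle_sum_ccw[OF this] show ?thesis using angle_commute[of r p q] by simp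
qed (rule angle_sum_ccw)

lemma isometry_inner:
  fixes f :: "point \<Rightarrow> point"
  assumes "\<forall>x y. dist (f x) (f y) = dist x y"
  shows "(f x - f z) \<bullet> (f y - f z) = (x - z) \<bullet> (y - z)"
proof -
  have "(norm (f x - f y))\<^sup>2 = (norm (x - y))\<^sup>2" "(norm (f x - f z))\<^sup>2 = (norm (x - z))\<^sup>2"
    "(norm (f y - f z))\<^sup>2 = (norm (y - z))\<^sup>2"
    using assms by (simp_all add: dist_norm)
  thus ?thesis unfolding power2_norm_eq_inner by (simp add: inner_diff_left inner_diff_right inner_commute)
qed

lemma isometry_angle:
  assumes "\<forall>x y. dist (f x) (f y) = dist x y"
  shows "angle (f X) (f Y) (f Z) = angle X Y Z"
  using assms unfolding angle_def isometry_inner[OF assms] dist_norm by simp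

lemma isometry_abs_cross2:
  assumes "\<forall>x y. dist (f x) (f y) = dist x y"
  shows "\<bar>cross2 (f Q - f P) (f R - f P)\<bar> = \<bar>cross2 (Q - P) (R - P)\<bar>"
proof -
  have "(cross2 (f Q - f P) (f R - f P))\<^sup>2 = (cross2 (Q - P) (R - P))\<^sup>2"
    using cross2_inner_sq[of "f Q - f P" "f R - f P"] cross2_inner_sq[of "Q - P" "R - P"] assms
    by (simp add: isometry_inner[OF assms] flip: dist_norm)
  thus ?thesis by (simp only: power2_eq_iff) auto
qed

lemma isometry_tri:
  assumes "\<forall>x y. dist (f x) (f y) = dist x y"
  shows "f ` tri P Q R = tri (f P) (f Q) (f R)"
proof -
  define L where "L = (\<lambda>x. f x - f 0)"
  have "orthogonal_transformation L"
    using assms unfolding orthogonal_transformation_isometry by (simp add: L_def dist_norm)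
  hence lin: "linear L" by (rule orthogonal_transformation_linear)
  have f: "f x = f 0 + L x" for x by (simp add: L_def)
  have "f ` tri P Q R = (+) (f 0) ` L ` (convex hull {P, Q, R})"
    unfolding tri_def image_image by (intro image_cong refl f)
  also have "\<dots> = convex hull ((+) (f 0) ` L ` {P, Q, R})"
    by (simp only: convex_hull_linear_image[OF lin] convex_hull_translation)
  also have "(+) (f 0) ` L ` {P, Q, R} = {f P, f Q, f R}" by (simp add: f[symmetric])
  finally show ?thesis by (simp add: tri_def)
qed

lemma content_tri: "measure lebesgue (tri p q r) = \<bar>cross2 (q - p) (r - p)\<bar> / 2"
proof -
  have "measure lebesgue (tri p q r) = measure lborel (convex hull {p, q, r})"
    unfolding tri_def
    by (intro measure_completion) (simp add: borel_compact finite_imp_compact_convex_hull)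
  also have "\<dots> = \<bar>cross2 (q - p) (r - p)\<bar> / 2"
    unfolding content_triangle by (simp add: cross2_def algebra_simps abs_minus_commute)
  finally show ?thesis .
qed

text \<open>Overlaps lie in frontiers of convex sets and are therefore null sets, so areas add
  up.\<close>

lemma tiling_area:
  assumes "tiling N \<T> (tri A B C) (tri P Q R)" and "\<not> collinear {P, Q, R}"
  shows "\<bar>cross2 (B - A) (C - A)\<bar> = real N * \<bar>cross2 (Q - P) (R - P)\<bar>"
proof -
  have fin: "finite \<T>" and N: "card \<T> = N" and U: "\<Union>\<T> = tri A B C" using assms(1) by (simp_all add: tiling_def)
  have cong: "\<forall>t\<in>\<T>. congruent_sets t (tri P Q R)"
    and ov: "\<forall>t\<in>\<T>. \<forall>u\<in>\<T>. t \<noteq> u \<longrightarrow> t \<inter> u \<subseteq> frontier t \<inter> frontier u"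
    using assms(1) by (simp_all add: tiling_def)
  have tile: "\<exists>p q r. t = tri p q r \<and> measure lebesgue t = \<bar>cross2 (Q - P) (R - P)\<bar> / 2" if "t \<in> \<T>" for t
  proof -
    obtain f where f: "\<forall>x y. dist (f x) (f y) = dist x y" "t = f ` tri P Q R"
      using bspec[OF cong \<open>t \<in> \<T>\<close>] unfolding congruent_sets_def by blast
    have "\<bar>cross2 (f Q - f P) (f R - f P)\<bar> = \<bar>cross2 (Q - P) (R - P)\<bar>"
      by (rule isometry_abs_cross2[OF f(1)])
    thus ?thesis using f(2) isometry_tri[OF f(1)] content_tri by metis
  qed
  have "measure lebesgue (\<Union>\<T>) = (\<Sum>t\<in>\<T>. measure lebesgue t)"
  proof (rule measure_negligible_finite_Union[OF fin])
    show "S \<in> lmeasurable" if "S \<in> \<T>" for S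
      using tile[OF that] by (auto simp: tri_def intro!: lmeasurable_compact finite_imp_compact_convex_hull)
    show "pairwise (\<lambda>S T. negligible (S \<inter> T)) \<T>"
    proof (rule pairwiseI)
      fix S T assume ST: "S \<in> \<T>" "T \<in> \<T>" "S \<noteq> T"
      have "convex S" using tile[OF ST(1)] by (auto simp: tri_def)
      moreover have "S \<inter> T \<subseteq> frontier S" using ov ST by auto
      ultimately show "negligible (S \<inter> T)" using negligible_convex_frontier negligible_subset by blast
    qed
  qed
  also have "\<dots> = (\<Sum>t\<in>\<T>. \<bar>cross2 (Q - P) (R - P)\<bar> / 2)" using tile by (intro sum.cong) auto
  finally show ?thesis using N by (simp add: U content_tri)
qed

lemma similar_setsI:
  assumes nc: "\<not> collinear {P, Q, R}" and k: "k > 0"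
    and d: "dist p q = k * dist P Q" "dist q r = k * dist Q R" "dist r p = k * dist R P"
  shows "similar_sets (tri p q r) (tri P Q R)"
proof -
  define u1 u2 v1 v2 where uv: "u1 = Q - P" "u2 = R - P" "v1 = q - p" "v2 = r - p"
  define D where "D = cross2 u1 u2"
  have D: "D \<noteq> 0" using nc not_collinear_cross2 by (simp add: D_def uv)
  \<comment> \<open>Cramer's rule: the linear map with \<open>u1\<close> to \<open>v1\<close> and
    \<open>u2\<close> to \<open>v2\<close>. Equal side ratios scale all inner products of the basis
    by \<open>k\<^sup>2\<close>.\<close>
  define L where "L = (\<lambda>x. (cross2 x u2 / D) *\<^sub>R v1 + (cross2 u1 x / D) *\<^sub>R v2)"
  have lin: "linear L"
    by (rule linearI) (simp_all add: L_def cross2_algebra add_divide_distrib algebra_simps)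
  have "norm (u1 - u2) = dist Q R" "norm (v1 - v2) = dist q r" "norm u1 = dist P Q" "norm v1 = dist p q"
    "norm u2 = dist R P" "norm v2 = dist r p"
    by (simp_all add: uv dist_norm norm_minus_commute)
  hence "norm v1 = k * norm u1" "norm v2 = k * norm u2" "norm (v1 - v2) = k * norm (u1 - u2)"
    using d by simp_all
  hence "(norm v1)\<^sup>2 = k\<^sup>2 * (norm u1)\<^sup>2" "(norm v2)\<^sup>2 = k\<^sup>2 * (norm u2)\<^sup>2" "(norm (v1 - v2))\<^sup>2 = k\<^sup>2 * (norm (u1 - u2))\<^sup>2"
    by (simp_all add: power_mult_distrib)
  hence ip: "v1 \<bullet> v1 = k\<^sup>2 * (u1 \<bullet> u1)" "v2 \<bullet> v2 = k\<^sup>2 * (u2 \<bullet> u2)" "v1 \<bullet> v2 = k\<^sup>2 * (u1 \<bullet> u2)"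
    unfolding power2_norm_eq_inner by (simp_all add: inner_diff_left inner_diff_right inner_commute algebra_simps)
  have Lnorm: "norm (L x) = k * norm x" for x
  proof -
    define a b where ab: "a = cross2 x u2 / D" "b = cross2 u1 x / D"
    have "D *\<^sub>R x = cross2 x u2 *\<^sub>R u1 + cross2 u1 x *\<^sub>R u2"
      by (simp add: D_def cross2_def vec2_eq_iff algebra_simps)
    hence "(1 / D) *\<^sub>R (D *\<^sub>R x) = a *\<^sub>R u1 + b *\<^sub>R u2"
      by (simp add: ab scaleR_add_right)
    hence x: "x = a *\<^sub>R u1 + b *\<^sub>R u2" using D by simp
    have "L x = a *\<^sub>R v1 + b *\<^sub>R v2" by (simp add: L_def ab)
    hence "L x \<bullet> L x = a\<^sup>2 * (v1 \<bullet> v1) + 2 * a * b * (v1 \<bullet> v2) + b\<^sup>2 * (v2 \<bullet> v2)"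
      by (simp add: inner_add_left inner_add_right inner_commute power2_eq_square)
    also have "\<dots> = k\<^sup>2 * (x \<bullet> x)"
      unfolding ip x by (simp add: inner_add_left inner_add_right inner_commute power2_eq_square algebra_simps)
    finally have "(norm (L x))\<^sup>2 = (k * norm x)\<^sup>2" by (simp add: power2_norm_eq_inner power_mult_distrib)
    thus ?thesis using k by (simp add: power2_eq_iff_nonneg)
  qed
  define f where "f = (\<lambda>x. p + L (x - P))"
  have L0: "L 0 = 0" "L u1 = v1" "L u2 = v2" using D cross2_skew[of u2 u1] by (simp_all add: L_def cross2_algebra D_def)
  have fPQR: "f P = p" "f Q = q" "f R = r" using L0 by (simp_all add: f_def uv)
  have f: "f x = (p - L P) + L x" for x by (simp add: f_def linear_diff[OF lin])
  have "f ` tri P Q R = (+) (p - L P) ` L ` (convex hull {P, Q, R})"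
    unfolding tri_def image_image using f by simp
  also have "\<dots> = convex hull ((+) (p - L P) ` L ` {P, Q, R})"
    by (simp only: convex_hull_linear_image[OF lin] convex_hull_translation)
  also have "(+) (p - L P) ` L ` {P, Q, R} = {f P, f Q, f R}" using f by auto
  finally have "tri p q r = f ` tri P Q R" by (simp add: tri_def fPQR)
  moreover have "dist (f x) (f y) = k * dist x y" for x y
    using Lnorm[of "x - y"] by (simp add: dist_norm f linear_diff[OF lin])
  ultimately show ?thesis unfolding similar_sets_def using k by blast
qed

section \<open>Shapes of the tiles and edge directions\<close>

lemma angles_via_gamma:
  fixes \<alpha> \<beta> \<gamma> :: real
  assumes "0 < \<alpha>" "0 < \<beta>" "\<alpha> + \<beta> + \<gamma> = pi" "3 * \<alpha> + 2 * \<beta> = pi"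
  shows "\<alpha> = 2 * \<gamma> - pi" "\<beta> = 2 * pi - 3 * \<gamma>" "pi / 2 < \<gamma>" "\<gamma> < 2 * pi / 3"
  using assms by simp_all

text \<open>All of this is the sine rule. In the tile,
  \<open>sin \<alpha> = - sin (2 * \<gamma>)\<close> and
  \<open>sin \<beta> = - sin (3 * \<gamma>)\<close>; in \<open>ABC\<close>, the angle
  \<open>2 * \<beta> = pi - 3 * \<alpha>\<close> has the sine of \<open>3 * \<alpha>\<close>, and
  \<open>2 * cos \<alpha> = 2 - s\<^sup>2\<close>.\<close>

lemma sides_via_s:
  assumes tile: "triangle_with_angles P Q R \<alpha> \<beta> \<gamma>"
    and sides: "a = dist Q R" "b = dist R P" "c = dist P Q"
    and ABC: "triangle_with_angles A B C (2 * \<alpha>) \<alpha> (2 * \<beta>)"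
    and s: "s = a / c"
  shows "\<alpha> = 2 * \<gamma> - pi" "\<beta> = 2 * pi - 3 * \<gamma>" "pi / 2 < \<gamma>" "\<gamma> < 2 * pi / 3"
    and "a > 0" "b > 0" "c > 0" "s = - 2 * cos \<gamma>" "0 < s" "s < 1"
    and "b = c * (1 - s\<^sup>2)"
    and "dist A C > 0" "dist B C = (2 - s\<^sup>2) * dist A C" "dist A B = (1 - s\<^sup>2) * (3 - s\<^sup>2) * dist A C"
    and "\<bar>cross2 (Q - P) (R - P)\<bar> = c * b * sin \<alpha>"
    and "\<bar>cross2 (B - A) (C - A)\<bar> = dist A B * dist A C * (sin \<alpha> * (2 - s\<^sup>2))" "sin \<alpha> > 0"
proof -
  have nc: "\<not> collinear {P, Q, R}" "\<not> collinear {A, B, C}"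
    using tile ABC by (auto simp: triangle_with_angles_def)
  have ang: "angle Q P R = \<alpha>" "angle P Q R = \<beta>" "angle P R Q = \<gamma>"
    "angle B A C = 2 * \<alpha>" "angle A B C = \<alpha>" "angle A C B = 2 * \<beta>"
    using tile ABC angle_commute by (auto simp: triangle_with_angles_def)
  have "\<not> collinear {Q, P, R}" using nc(1) by (simp add: insert_commute)
  hence pos: "0 < \<alpha>" "0 < \<beta>" using angle_strict_bounds(1)[OF nc(1)] angle_strict_bounds(1)[of Q P R] ang by auto
  have "\<alpha> + \<beta> + \<gamma> = pi" "2 * \<alpha> + \<alpha> + 2 * \<beta> = pi" using angle_sum[OF nc(1)] angle_sum[OF nc(2)] ang by simp_all
  thus \<gamma>: "\<alpha> = 2 * \<gamma> - pi" "\<beta> = 2 * pi - 3 * \<gamma>" "pi / 2 < \<gamma>" "\<gamma> < 2 * pi / 3"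
    using angles_via_gamma[OF pos, of \<gamma>] by simp_all
  note T = law_of_sines[OF nc(1), unfolded ang] and U = law_of_sines[OF nc(2), unfolded ang]
  show abc: "a > 0" "b > 0" "c > 0" using T(5-7) by (simp_all add: sides)
  have sin_pos: "sin \<alpha> > 0" using pos \<gamma> by (intro sin_gt_zero) auto
  have sin_gamma: "sin \<gamma> > 0" using \<gamma> pi_gt_zero by (intro sin_gt_zero) linarith+
  show "sin \<alpha> > 0" by (rule sin_pos)
  have eqs: "c * b * sin \<alpha> = b * a * sin \<gamma>" "c * a * sin \<beta> = c * b * sin \<alpha>"
    using T(2-4) by (simp_all add: sides dist_commute)
  have sa: "sin \<alpha> = - 2 * sin \<gamma> * cos \<gamma>"
    using \<gamma>(1) by (simp add: sin_diff sin_double)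
  have "c * sin \<alpha> = a * sin \<gamma>" using eqs(1) abc by simp
  hence "(c * (- 2 * cos \<gamma>)) * sin \<gamma> = a * sin \<gamma>" by (simp add: sa mult_ac)
  hence "c * (- 2 * cos \<gamma>) = a" using sin_gamma by (metis mult_right_cancel less_irrefl)
  moreover have "c * s = a" using abc s by simp
  ultimately show s_cos: "s = - 2 * cos \<gamma>" using abc by (metis mult_left_cancel less_irrefl)
  have "cos \<gamma> < 0" using cos_monotone_0_pi[of "pi / 2" \<gamma>] \<gamma> by simp
  thus "0 < s" using s_cos by simp
  have "cos (2 * pi / 3) < cos \<gamma>" by (rule cos_monotone_0_pi) (use \<gamma> pi_gt_zero in linarith)+
  thus "s < 1" using s_cos cos_120 by simp
  have sb: "sin \<beta> = sin \<gamma> * (1 - s\<^sup>2)"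
  proof -
    have "sin \<beta> = - sin (3 * \<gamma>)" using \<gamma>(2) by (simp add: sin_diff)
    also have "\<dots> = - sin (\<gamma> + 2 * \<gamma>)" by simp
    also have "\<dots> = - (sin \<gamma> * (2 * (cos \<gamma>)\<^sup>2 - 1) + cos \<gamma> * (2 * sin \<gamma> * cos \<gamma>))"
      by (simp only: sin_add cos_double_cos sin_double)
    also have "\<dots> = sin \<gamma> * (1 - s\<^sup>2)" by (simp add: s_cos power2_eq_square algebra_simps)
    finally show ?thesis .
  qed
  have "a * sin \<beta> = b * sin \<alpha>" using eqs(2) abc by simp
  also have "b * sin \<alpha> = b * (s * sin \<gamma>)" by (simp add: sa s_cos)
  finally have "(a * (1 - s\<^sup>2)) * sin \<gamma> = (b * s) * sin \<gamma>" unfolding sb by (simp add: mult_ac)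
  hence "a * (1 - s\<^sup>2) = b * s" using sin_gamma by simp
  moreover have "a = s * c" using s abc by simp
  ultimately show b: "b = c * (1 - s\<^sup>2)" using \<open>0 < s\<close> by simp
  have cos_alpha: "2 * cos \<alpha> = 2 - s\<^sup>2"
  proof -
    have "cos \<alpha> = - cos (2 * \<gamma>)" using \<gamma>(1) by (simp add: cos_diff)
    thus ?thesis unfolding cos_double_cos s_cos by (simp add: power2_eq_square)
  qed
  have s2a: "sin (2 * \<alpha>) = sin \<alpha> * (2 - s\<^sup>2)"
    unfolding sin_double cos_alpha[symmetric] by simp
  have s2b: "sin (2 * \<beta>) = sin \<alpha> * ((1 - s\<^sup>2) * (3 - s\<^sup>2))"
  proof -
    have "2 * \<beta> = pi - 3 * \<alpha>" using \<gamma> by simp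
    hence "sin (2 * \<beta>) = sin (3 * \<alpha>)" by simp
    also have "\<dots> = sin (\<alpha> + 2 * \<alpha>)" by simp
    also have "\<dots> = sin \<alpha> * ((2 * cos \<alpha>)\<^sup>2 - 1)"
      by (simp only: sin_add cos_double_cos sin_double) (simp add: power2_eq_square algebra_simps)
    also have "\<dots> = sin \<alpha> * ((1 - s\<^sup>2) * (3 - s\<^sup>2))"
      unfolding cos_alpha by (simp add: power2_eq_square algebra_simps)
    finally show ?thesis .
  qed
  show AC: "dist A C > 0" using U(7) by simp
  have AB: "dist A B > 0" and BC: "dist B C > 0" using U(5,6) by simp_all
  have "dist A B * dist A C * (sin \<alpha> * (2 - s\<^sup>2)) = dist A B * dist B C * sin \<alpha>"
    using U(2,3) by (simp add: s2a)
  thus "dist B C = (2 - s\<^sup>2) * dist A C" using AB sin_pos by (simp add: mult_ac)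
  have "dist A C * dist B C * (sin \<alpha> * ((1 - s\<^sup>2) * (3 - s\<^sup>2))) = dist A B * dist B C * sin \<alpha>"
    using U(3,4) by (simp add: s2b)
  hence "(dist B C * sin \<alpha>) * ((1 - s\<^sup>2) * (3 - s\<^sup>2) * dist A C) = (dist B C * sin \<alpha>) * dist A B"
    by (simp only: mult_ac)
  thus "dist A B = (1 - s\<^sup>2) * (3 - s\<^sup>2) * dist A C" using BC sin_pos by simp
  show "\<bar>cross2 (Q - P) (R - P)\<bar> = c * b * sin \<alpha>" using T(2) by (simp add: sides dist_commute)
  show "\<bar>cross2 (B - A) (C - A)\<bar> = dist A B * dist A C * (sin \<alpha> * (2 - s\<^sup>2))" using U(2) s2a by simp
qed

text \<open>The vertices are listed so that \<open>q - p\<close> is the side of length \<open>c\<close>; the two alternatives are the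
  two orientations of the tile.\<close>

definition tile_shape :: "real \<Rightarrow> real \<Rightarrow> real \<Rightarrow> real \<Rightarrow> real \<Rightarrow> real \<Rightarrow> point set \<Rightarrow> (point \<times> point) set \<Rightarrow> bool" where
  "tile_shape \<alpha> \<beta> \<gamma> a b c t F \<longleftrightarrow> (\<exists>p q r. ccw p q r \<and> t = tri p q r \<and> F = ccw_edges p q r \<and>
     norm (q - p) = c \<and> angle q r p = \<gamma> \<and>
     (norm (r - q) = a \<and> norm (p - r) = b \<and> angle p q r = \<beta> \<or>
      norm (r - q) = b \<and> norm (p - r) = a \<and> angle p q r = \<alpha>))"

lemma tile_shape_exists:
  assumes tile: "triangle_with_angles P Q R \<alpha> \<beta> \<gamma>"
    and sides: "a = dist Q R" "b = dist R P" "c = dist P Q"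
    and "congruent_sets t (tri P Q R)"
  shows "\<exists>F. tile_shape \<alpha> \<beta> \<gamma> a b c t F"
proof -
  obtain f where f: "\<forall>x y. dist (f x) (f y) = dist x y" "t = f ` tri P Q R"
    using assms(5) unfolding congruent_sets_def by blast
  define p q r where pqr: "p = f P" "q = f Q" "r = f R"
  have t: "t = tri p q r" using f isometry_tri[OF f(1)] by (simp add: pqr)
  have ang: "angle q p r = \<alpha>" "angle p q r = \<beta>" "angle p r q = \<gamma>"
    using tile isometry_angle[OF f(1)] angle_commute by (auto simp: triangle_with_angles_def pqr)
  have len: "norm (q - r) = a" "norm (p - r) = b" "norm (q - p) = c"
    using f(1) by (simp_all add: pqr sides dist_commute flip: dist_norm)
  have "\<not> collinear {P, Q, R}" using tile by (simp add: triangle_with_angles_def)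
  hence "\<bar>cross2 (Q - P) (R - P)\<bar> > 0" by (simp add: not_collinear_cross2)
  hence "\<bar>cross2 (q - p) (r - p)\<bar> > 0" unfolding isometry_abs_cross2[OF f(1), of Q P R, folded pqr] .
  hence "\<not> collinear {p, q, r}" by (simp add: not_collinear_cross2)
  then consider "ccw p q r" | "ccw q p r" using not_collinear_ccw ccw_rotate by blast
  thus ?thesis
  proof cases
    case 1
    hence "tile_shape \<alpha> \<beta> \<gamma> a b c t (ccw_edges p q r)" unfolding tile_shape_def
      using t ang len angle_commute[of q r p] norm_minus_commute by (intro exI[of _ p] exI[of _ q] exI[of _ r]) auto
    thus ?thesis by blast
  next
    case 2
    moreover have "tri q p r = tri p q r" by (simp add: tri_def insert_commute)
    ultimately have "tile_shape \<alpha> \<beta> \<gamma> a b c t (ccw_edges q p r)" unfolding tile_shape_def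
      using t ang len norm_minus_commute by (intro exI[of _ q] exI[of _ p] exI[of _ r]) auto
    thus ?thesis by blast
  qed
qed

lemma tile_shape_is_ccw_triangle: "tile_shape \<alpha> \<beta> \<gamma> a b c t F \<Longrightarrow> is_ccw_triangle t F"
  unfolding tile_shape_def is_ccw_triangle_def by blast

lemma tile_shape_elen: "tile_shape \<alpha> \<beta> \<gamma> a b c t F \<Longrightarrow> e \<in> F \<Longrightarrow> elen e \<in> {a, b, c}"
  unfolding tile_shape_def ccw_edges_def by auto

lemma sum_nat_combination:
  fixes a b c :: real
  assumes "finite I" "\<And>i. i \<in> I \<Longrightarrow> \<exists>u v w. f i = real u * a + real v * b + real w * c"
  shows "\<exists>u v w. sum f I = real u * a + real v * b + real w * c"
  using assms
proof (induction I)
  case empty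
  show ?case by (intro exI[of _ 0]) simp
next
  case (insert i I)
  have "\<exists>u v w. f i = real u * a + real v * b + real w * c" by (rule insert.prems) simp
  then obtain u v w where "f i = real u * a + real v * b + real w * c" by blast
  moreover have "\<exists>u v w. sum f I = real u * a + real v * b + real w * c"
    by (rule insert.IH) (rule insert.prems, simp)
  then obtain u' v' w' where "sum f I = real u' * a + real v' * b + real w' * c" by blast
  ultimately have "sum f (insert i I) = real (u + u') * a + real (v + v') * b + real (w + w') * c"
    using insert.hyps by (simp add: algebra_simps)
  thus ?case by blast
qed

lemma (in ccw_tiling) boundary_edge_nat_combination:
  fixes a b c :: real
  assumes len: "\<And>t e. t \<in> \<T> \<Longrightarrow> e \<in> E t \<Longrightarrow> elen e \<in> {a, b, c}" and f: "f \<in> ES"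
  shows "\<exists>u v w. elen f = real u * a + real v * b + real w * c"
  unfolding boundary_edge_sum[OF f]
proof (intro sum_nat_combination finite_tiles)
  fix t e assume t: "t \<in> \<T>"
  thus "finite {e \<in> E t. on_line (fst f) (evec f) e}" using tileD(1) by simp
  assume "e \<in> {e \<in> E t. on_line (fst f) (evec f) e}"
  hence "elen e \<in> {a, b, c}" using len t by blast
  moreover have "a = real 1 * a + real 0 * b + real 0 * c" "b = real 0 * a + real 1 * b + real 0 * c"
    "c = real 0 * a + real 0 * b + real 1 * c" by simp_all
  ultimately show "\<exists>u v w. elen e = real u * a + real v * b + real w * c" by (metis insertE singletonD)
qed

section \<open>Weights on edge directions\<close>

lemma direction_weight_exists:
  fixes \<gamma> \<eta> :: real and d :: complex
  assumes irr: "\<gamma> / pi \<notin> \<rat>" and d: "d \<noteq> 0" and \<eta>: "\<eta> \<in> {1, - 1}"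
  shows "\<exists>G :: complex \<Rightarrow> real. (\<forall>z. G (- z) = - G z) \<and> (\<forall>z. G (cis \<gamma> * z) = \<eta> * G z) \<and>
    (\<forall>z. G (cis (- \<gamma>) * z) = \<eta> * G z) \<and> G d = 1 \<and> (\<forall>z. G z \<in> {- 1, 0, 1})"
proof -
  \<comment> \<open>The graph of the weight on the orbit of \<open>d\<close> under signs and
    rotations by \<open>\<gamma>\<close>. All other directions receive weight 0, so a tile whose
    edges miss the orbit contributes nothing.\<close>
  define rel where "rel = (\<lambda>z v. \<exists>(k::int) \<sigma>. \<sigma> \<in> {1, - 1::real} \<and> z = of_real \<sigma> * cis (k * \<gamma>) * d \<and> v = \<sigma> * \<eta> powi k)"
  have uniq: "v = v'" if v: "rel z v" and v': "rel z v'" for z v v'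
  proof -
    obtain k :: int and \<sigma> where k: "\<sigma> \<in> {1, - 1::real}" "z = of_real \<sigma> * cis (k * \<gamma>) * d" "v = \<sigma> * \<eta> powi k"
      using v by (auto simp: rel_def)
    obtain k' :: int and \<sigma>' where k': "\<sigma>' \<in> {1, - 1::real}" "z = of_real \<sigma>' * cis (k' * \<gamma>) * d" "v' = \<sigma>' * \<eta> powi k'"
      using v' by (auto simp: rel_def)
    have eq: "of_real \<sigma> * cis (k * \<gamma>) = of_real \<sigma>' * cis (k' * \<gamma>)" using k(2) k'(2) d by simp
    have "of_real \<sigma> * (cis (k * \<gamma>) * cis (- (k' * \<gamma>))) = of_real \<sigma>' * (cis (k' * \<gamma>) * cis (- (k' * \<gamma>)))"
      using eq by (simp only: mult.assoc[symmetric])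
    hence "of_real \<sigma> * cis ((k - k') * \<gamma>) = of_real \<sigma>'" by (simp add: cis_mult left_diff_distrib)
    hence "Im (of_real \<sigma> * cis ((k - k') * \<gamma>)) = 0" by simp
    hence "sin ((k - k') * \<gamma>) = 0" using k(1) by auto
    \<comment> \<open>Two descriptions of one direction with different exponents would make
      \<open>\<gamma> / pi\<close> rational.\<close>
    then obtain m :: int where m: "(k - k') * \<gamma> = m * pi" using sin_zero_iff_int2 by auto
    have "k = k'"
    proof (rule ccontr)
      assume "k \<noteq> k'"
      hence "\<gamma> / pi = of_int m / of_int (k - k')" using m by (simp add: field_simps)
      thus False using irr by (metis Rats_divide Rats_of_int)
    qed
    moreover from this have "\<sigma> = \<sigma>'" using eq by simp
    ultimately show ?thesis using k k' by simp
  qed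
  define G where "G = (\<lambda>z. if \<exists>v. rel z v then THE v. rel z v else 0)"
  have G: "G z = v" if "rel z v" for z v
  proof -
    have "(THE v. rel z v) = v" using that uniq by (intro the_equality) auto
    thus ?thesis using that by (auto simp: G_def)
  qed
  have G0: "G z = 0" if "\<And>v. \<not> rel z v" for z using that by (auto simp: G_def)
  have rel_minus: "rel (- z) (- v)" if r: "rel z v" for z v
  proof -
    obtain k :: int and \<sigma> where "\<sigma> \<in> {1, - 1::real}" "z = of_real \<sigma> * cis (k * \<gamma>) * d" "v = \<sigma> * \<eta> powi k"
      using r by (auto simp: rel_def)
    thus ?thesis unfolding rel_def by (intro exI[of _ k] exI[of _ "- \<sigma>"]) auto
  qed
  have \<eta>2: "\<eta> * \<eta> = 1" "\<eta> \<noteq> 0" using \<eta> by auto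
  have rel_cis: "rel (cis \<gamma> * z) (\<eta> * v)" "rel (cis (- \<gamma>) * z) (\<eta> * v)" if r: "rel z v" for z v
  proof -
    obtain k :: int and \<sigma> where k: "\<sigma> \<in> {1, - 1::real}" "z = of_real \<sigma> * cis (k * \<gamma>) * d" "v = \<sigma> * \<eta> powi k"
      using r by (auto simp: rel_def)
    have "cis \<gamma> * z = of_real \<sigma> * (cis \<gamma> * cis (k * \<gamma>)) * d" using k(2) by (simp add: mult_ac)
    also have "cis \<gamma> * cis (k * \<gamma>) = cis (of_int (k + 1) * \<gamma>)" by (simp add: cis_mult algebra_simps)
    finally have 1: "cis \<gamma> * z = of_real \<sigma> * cis (of_int (k + 1) * \<gamma>) * d" .
    have "cis (- \<gamma>) * z = of_real \<sigma> * (cis (- \<gamma>) * cis (k * \<gamma>)) * d" using k(2) by (simp add: mult_ac)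
    also have "cis (- \<gamma>) * cis (k * \<gamma>) = cis (of_int (k - 1) * \<gamma>)" by (simp add: cis_mult algebra_simps)
    finally have 2: "cis (- \<gamma>) * z = of_real \<sigma> * cis (of_int (k - 1) * \<gamma>) * d" .
    have "\<eta> powi (k + 1) = \<eta> powi k * \<eta>" using \<eta>2 by (simp add: power_int_add)
    hence p1: "\<eta> * v = \<sigma> * \<eta> powi (k + 1)" using k(3) by simp
    have "\<eta> powi (k - 1) * \<eta> = \<eta> powi k" using \<eta>2 power_int_add[of \<eta> "k - 1" 1] by simp
    hence "\<eta> * v = \<sigma> * \<eta> powi (k - 1) * (\<eta> * \<eta>)" using k(3) by (simp add: mult_ac)
    hence p2: "\<eta> * v = \<sigma> * \<eta> powi (k - 1)" using \<eta>2 by simp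
    show "rel (cis \<gamma> * z) (\<eta> * v)" unfolding rel_def using k(1) 1 p1 by blast
    show "rel (cis (- \<gamma>) * z) (\<eta> * v)" unfolding rel_def using k(1) 2 p2 by blast
  qed
  have cancel: "cis (- \<gamma>) * (cis \<gamma> * z) = z" "cis \<gamma> * (cis (- \<gamma>) * z) = z" for z
    by (simp_all add: cis_mult mult.assoc[symmetric])
  have "G (- z) = - G z" for z
  proof (cases "\<exists>v. rel z v")
    case True thus ?thesis using G rel_minus by metis
  next
    case False
    hence "\<not> rel (- z) v" for v using rel_minus[of "- z" v] by auto
    thus ?thesis using G0 False by simp
  qed
  moreover have "G (cis \<gamma> * z) = \<eta> * G z" for z
  proof (cases "\<exists>v. rel z v")
    case True thus ?thesis using G rel_cis(1) by metis
  next
    case False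
    hence "\<not> rel (cis \<gamma> * z) v" for v using rel_cis(2)[of "cis \<gamma> * z" v] cancel by auto
    thus ?thesis using G0 False by simp
  qed
  moreover have "G (cis (- \<gamma>) * z) = \<eta> * G z" for z
  proof (cases "\<exists>v. rel z v")
    case True thus ?thesis using G rel_cis(2) by metis
  next
    case False
    hence "\<not> rel (cis (- \<gamma>) * z) v" for v using rel_cis(1)[of "cis (- \<gamma>) * z" v] cancel by auto
    thus ?thesis using G0 False by simp
  qed
  moreover have "rel d 1" unfolding rel_def by (intro exI[of _ 0] exI[of _ 1]) simp
  hence "G d = 1" by (rule G)
  moreover have "G z \<in> {- 1, 0, 1}" for z
  proof (cases "\<exists>v. rel z v")
    case True
    then obtain v where v: "rel z v" by blast
    have "\<eta> powi k \<in> {1, - 1}" for k :: int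
      using \<eta> by (cases "even k") auto
    hence "v \<in> {- 1, 0, 1}" using v by (force simp: rel_def)
    thus ?thesis using G[OF v] by simp
  next
    case False
    thus ?thesis using G0[of z] by blast
  qed
  ultimately show ?thesis by blast
qed

text \<open>For \<open>\<eta> = - 1\<close> the three edges of a tile have equal weights, and tiles on opposite sides of a
  common segment have opposite weights: the weight is a colouring of the tiles.\<close>

locale direction_weight =
  fixes G :: "complex \<Rightarrow> real" and \<eta> \<alpha> \<beta> \<gamma> :: real
  assumes odd: "G (- z) = - G z"
    and cis_gamma: "G (cis \<gamma> * z) = \<eta> * G z" "G (cis (- \<gamma>) * z) = \<eta> * G z"
    and eta: "\<eta> \<in> {1, - 1}"
    and alpha: "\<alpha> = 2 * \<gamma> - pi" and beta: "\<beta> = 2 * pi - 3 * \<gamma>"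
begin

lemma eta_sq: "\<eta> * \<eta> = 1"
  using eta by auto

lemma cis_double_mult: "cis (2 * x) * u = cis x * (cis x * u)" "cis (- (2 * x)) * u = cis (- x) * (cis (- x) * u)"
  by (simp_all add: cis_mult mult.assoc[symmetric])

lemma cis_double: "G (cis (2 * \<gamma>) * z) = G z" "G (cis (- (2 * \<gamma>)) * z) = G z"
  unfolding cis_double_mult cis_gamma by (simp_all add: mult.assoc[symmetric] eta_sq)

lemma cis_alpha: "G (cis (- \<alpha>) * z) = - G z"
proof -
  have "cis (- \<alpha>) = - cis (- (2 * \<gamma>))" by (simp add: alpha complex_eq_iff cos_diff sin_diff)
  thus ?thesis using odd cis_double by simp
qed

lemma cis_beta: "G (cis (- \<beta>) * z) = \<eta> * G z"
proof -
  have "cis (- \<beta>) = cis \<gamma> * cis (2 * \<gamma>)"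
  proof -
    have "cis (- \<beta>) = cis (3 * \<gamma> - 2 * pi)" by (simp add: beta)
    also have "\<dots> = cis (3 * \<gamma>)" by (simp add: complex_eq_iff cos_diff sin_diff)
    finally show ?thesis by (simp add: cis_mult)
  qed
  thus ?thesis by (simp only: mult.assoc cis_gamma cis_double)
qed

lemma cis_double_alpha: "G (cis (- (2 * \<alpha>)) * z) = G z"
  unfolding cis_double_mult cis_alpha by simp

lemma cis_double_beta: "G (cis (- (2 * \<beta>)) * z) = G z"
  unfolding cis_double_mult cis_beta by (simp add: mult.assoc[symmetric] eta_sq)

lemma turn:
  assumes "ccw p q r"
  shows "G (cx (sgn (r - q))) = - G (cis (- angle p q r) * cx (sgn (q - p)))"
  unfolding sgn_evec_turn[OF assms] by (simp add: odd)

text \<open>Each turn contributes a sign, and the angles \<open>\<alpha>\<close>,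
  \<open>\<beta>\<close>, \<open>\<gamma>\<close> contribute \<open>- 1\<close>,
  \<open>\<eta>\<close>, \<open>\<eta>\<close>. Hence, in either orientation, the edge
  \<open>b\<close> has the weight of the edge \<open>c\<close>, and the edge \<open>a\<close> has
  \<open>- \<eta>\<close> times this weight.\<close>

lemma tile_weight:
  assumes "tile_shape \<alpha> \<beta> \<gamma> a b c t F"
  shows "\<exists>z. (\<Sum>e\<in>F. G (cx (sgn (evec e))) * elen e) = G z * (c + b - \<eta> * a) \<and>
    (\<eta> = - 1 \<longrightarrow> (\<forall>e\<in>F. G (cx (sgn (evec e))) = G z))"
proof -
  obtain p q r where pqr: "ccw p q r" "F = ccw_edges p q r" "norm (q - p) = c" "angle q r p = \<gamma>"
    and shape: "norm (r - q) = a \<and> norm (p - r) = b \<and> angle p q r = \<beta> \<or>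
      norm (r - q) = b \<and> norm (p - r) = a \<and> angle p q r = \<alpha>"
    using assms unfolding tile_shape_def by blast
  define z where "z = cx (sgn (q - p))"
  have rp: "G (cx (sgn (p - r))) = - (\<eta> * G (cx (sgn (r - q))))"
    using turn[OF ccw_rotate[OF pqr(1)]] pqr(4) cis_gamma by simp
  have sum: "(\<Sum>e\<in>F. G (cx (sgn (evec e))) * elen e) =
      G z * c + G (cx (sgn (r - q))) * norm (r - q) + G (cx (sgn (p - r))) * norm (p - r)"
    unfolding pqr(2) sum_ccw_edges[OF pqr(1)] using pqr(3) by (simp add: z_def)
  from shape show ?thesis
  proof (elim disjE conjE)
    assume s: "norm (r - q) = a" "norm (p - r) = b" "angle p q r = \<beta>"
    have qr: "G (cx (sgn (r - q))) = - (\<eta> * G z)" using turn[OF pqr(1)] s(3) cis_beta by (simp add: z_def)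
    have rp': "G (cx (sgn (p - r))) = G z"
      unfolding rp qr using eta_sq by (simp add: mult.assoc[symmetric])
    show ?thesis
      by (rule exI[of _ z], unfold sum s qr rp')
        (use qr rp' in \<open>auto simp: pqr(2) ccw_edges_def z_def algebra_simps\<close>)
  next
    assume s: "norm (r - q) = b" "norm (p - r) = a" "angle p q r = \<alpha>"
    have qr: "G (cx (sgn (r - q))) = G z" using turn[OF pqr(1)] s(3) cis_alpha by (simp add: z_def)
    have rp': "G (cx (sgn (p - r))) = - (\<eta> * G z)" unfolding rp qr by simp
    show ?thesis
      by (rule exI[of _ z], unfold sum s qr rp')
        (use qr rp' in \<open>auto simp: pqr(2) ccw_edges_def z_def algebra_simps\<close>)
  qed
qed

text \<open>At \<open>B\<close> the sign of the turn is undone by that of \<open>cis_alpha\<close>;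
  at \<open>A\<close> and \<open>C\<close> the angles are doubled and only the sign of the turn
  remains. So \<open>AB\<close> and \<open>BC\<close> agree and \<open>AC\<close> is opposite to
  both.\<close>

lemma outer_weight:
  assumes "ccw A B C" "angle B A C = 2 * \<alpha>" "angle C B A = \<alpha>" "angle A C B = 2 * \<beta>" "G (cx (sgn (B - A))) = 1"
  shows "(\<Sum>e\<in>ccw_edges A B C. G (cx (sgn (evec e))) * elen e) = dist A B + dist B C - dist A C"
proof -
  have BC: "G (cx (sgn (C - B))) = 1"
    using turn[OF assms(1)] assms(3,5) angle_commute[of A B C] cis_alpha by simp
  have CA: "G (cx (sgn (A - C))) = - 1"
    using turn[OF ccw_rotate[OF assms(1)]] BC assms(4) angle_commute[of B C A] cis_double_beta by simp
  show ?thesis unfolding sum_ccw_edges[OF assms(1)]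
    by (simp add: assms(5) BC CA dist_norm norm_minus_commute)
qed

lemma outer_weight':
  assumes "ccw A C B" "angle B A C = 2 * \<alpha>" "angle C B A = \<alpha>" "angle A C B = 2 * \<beta>" "G (cx (sgn (A - B))) = 1"
  shows "(\<Sum>e\<in>ccw_edges A C B. G (cx (sgn (evec e))) * elen e) = dist A B + dist B C - dist A C"
proof -
  have AC: "G (cx (sgn (C - A))) = - 1"
    using turn[OF ccw_rotate[OF ccw_rotate[OF assms(1)]]] assms(2,5) cis_double_alpha by simp
  have CB: "G (cx (sgn (B - C))) = 1"
    using turn[OF assms(1)] AC assms(4) cis_double_beta by simp
  show ?thesis unfolding sum_ccw_edges[OF assms(1)]
    by (simp add: assms(5) AC CB dist_norm norm_minus_commute)
qed

end

section \<open>Elimination and conclusion\<close>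

lemma irrational_case_algebra:
  fixes s y :: real and N :: nat and M M1 :: int
  assumes s: "0 < s" "s < 1" and y: "y > 0"
    and N: "N = y\<^sup>2 * ((2 - s\<^sup>2) * (3 - s\<^sup>2))"
    and M: "y * ((2 - s\<^sup>2) + (1 - s\<^sup>2) * (3 - s\<^sup>2) - 1) = M * (1 + (1 - s\<^sup>2) + s)"
    and M1: "y * ((2 - s\<^sup>2) + (1 - s\<^sup>2) * (3 - s\<^sup>2) - 1) = M1 * (1 + (1 - s\<^sup>2) - s)"
  shows "s \<in> \<rat> \<and> real N / (real_of_int M)\<^sup>2 = ((2 - s\<^sup>2) * (3 - s\<^sup>2)) / ((1 - s)\<^sup>2 * (2 + s)\<^sup>2)"
proof -
  \<comment> \<open>The factor multiplying \<open>y\<close> splits into exactly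
    \<open>a + b + c\<close> and \<open>b + c - a\<close> in units of \<open>c\<close>. Each
    equation therefore loses one of them, leaving \<open>y\<close> times the other equal to an
    integer.\<close>
  have f: "(2 - s\<^sup>2) + (1 - s\<^sup>2) * (3 - s\<^sup>2) - 1 = ((1 - s) * (2 + s)) * ((1 + s) * (2 - s))"
    "1 + (1 - s\<^sup>2) + s = (1 + s) * (2 - s)" "1 + (1 - s\<^sup>2) - s = (1 - s) * (2 + s)"
    by (simp_all add: power2_eq_square algebra_simps)
  have pos: "(1 + s) * (2 - s) > 0" "(1 - s) * (2 + s) > 0" using s by simp_all
  have "(y * ((1 - s) * (2 + s))) * ((1 + s) * (2 - s)) = M * ((1 + s) * (2 - s))"
    using M unfolding f by (simp only: mult_ac)
  hence yM: "y * ((1 - s) * (2 + s)) = M" using pos by (metis mult_right_cancel less_irrefl)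
  have "(y * ((1 + s) * (2 - s))) * ((1 - s) * (2 + s)) = M1 * ((1 - s) * (2 + s))"
    using M1 unfolding f by (simp only: mult_ac)
  hence yM1: "y * ((1 + s) * (2 - s)) = M1" using pos by (metis mult_right_cancel less_irrefl)
  have Mpos: "real_of_int M > 0" using yM y pos(2) by (metis mult_pos_pos)
  have NM: "real N * ((1 - s) * (2 + s))\<^sup>2 = (real_of_int M)\<^sup>2 * ((2 - s\<^sup>2) * (3 - s\<^sup>2))"
    unfolding N yM[symmetric] by (simp add: power_mult_distrib)
  \<comment> \<open>\<open>s\<^sup>2 = 2 - \<kappa> * s\<close> with rational \<open>\<kappa>\<close> turns the area equation into a linear equation for \<open>s\<close>.\<close>
  define \<kappa> where "\<kappa> = (real_of_int M + real_of_int M1) / (real_of_int M1 - real_of_int M)"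
  have sumM: "real_of_int M + real_of_int M1 = 2 * y * (2 - s\<^sup>2)" "real_of_int M1 - real_of_int M = 2 * y * s"
    unfolding yM[symmetric] yM1[symmetric] by (simp_all add: power2_eq_square algebra_simps)
  have \<kappa>: "\<kappa> = (2 - s\<^sup>2) / s" unfolding \<kappa>_def sumM using y by simp
  have \<kappa>_rat: "\<kappa> \<in> \<rat>" unfolding \<kappa>_def by simp
  have s2: "2 - s\<^sup>2 = \<kappa> * s" using \<kappa> s by simp
  have "s\<^sup>2 < 1" using s by (simp add: power_less_one_iff)
  hence \<kappa>pos: "\<kappa> > 0" using \<kappa> s by simp
  have "(1 - s) * (2 + s) = (2 - s\<^sup>2) - s" by (simp add: power2_eq_square algebra_simps)
  hence fac: "(1 - s) * (2 + s) = (\<kappa> - 1) * s" unfolding s2 by (simp add: algebra_simps)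
  have fac2: "3 - s\<^sup>2 = 1 + \<kappa> * s" using s2 by simp
  have "(real N * (\<kappa> - 1)\<^sup>2 * s) * s = ((real_of_int M)\<^sup>2 * (\<kappa> * (1 + \<kappa> * s))) * s"
    using NM unfolding fac fac2 s2 by (simp add: power2_eq_square mult_ac)
  hence "real N * (\<kappa> - 1)\<^sup>2 * s = (real_of_int M)\<^sup>2 * (\<kappa> * (1 + \<kappa> * s))" using s by simp
  hence lin: "s * (real N * (\<kappa> - 1)\<^sup>2 - (real_of_int M)\<^sup>2 * \<kappa>\<^sup>2) = (real_of_int M)\<^sup>2 * \<kappa>"
    by (simp add: power2_eq_square algebra_simps)
  \<comment> \<open>A positive right-hand side rules out a zero coefficient of \<open>s\<close>, so
    the linear equation can be solved.\<close>
  moreover have "(real_of_int M)\<^sup>2 * \<kappa> > 0" using Mpos \<kappa>pos by simp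
  ultimately have "real N * (\<kappa> - 1)\<^sup>2 - (real_of_int M)\<^sup>2 * \<kappa>\<^sup>2 \<noteq> 0" by auto
  hence "s = (real_of_int M)\<^sup>2 * \<kappa> / (real N * (\<kappa> - 1)\<^sup>2 - (real_of_int M)\<^sup>2 * \<kappa>\<^sup>2)"
    using lin by (simp add: field_simps)
  moreover have "\<dots> \<in> \<rat>" using \<kappa>_rat by (intro Rats_divide Rats_mult Rats_diff Rats_power) auto
  ultimately have "s \<in> \<rat>" by simp
  moreover have "real N / (real_of_int M)\<^sup>2 = ((2 - s\<^sup>2) * (3 - s\<^sup>2)) / ((1 - s)\<^sup>2 * (2 + s)\<^sup>2)"
  proof (subst frac_eq_eq)
    show "(real_of_int M)\<^sup>2 \<noteq> 0" "(1 - s)\<^sup>2 * (2 + s)\<^sup>2 \<noteq> 0" using Mpos s by auto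
    show "real N * ((1 - s)\<^sup>2 * (2 + s)\<^sup>2) = (2 - s\<^sup>2) * (3 - s\<^sup>2) * (real_of_int M)\<^sup>2"
      using NM by (simp only: power_mult_distrib mult.commute)
  qed
  ultimately show ?thesis by blast
qed

text \<open>Here \<open>2 * \<alpha> = \<beta>\<close> and \<open>2 * \<beta> = \<gamma>\<close>, so
  the vertices \<open>B\<close>, \<open>A\<close>, \<open>C\<close> correspond to \<open>P\<close>,
  \<open>Q\<close>, \<open>R\<close>.\<close>

lemma rational_angle_similar:
  assumes tile: "triangle_with_angles P Q R \<alpha> \<beta> \<gamma>"
    and ABC: "triangle_with_angles A B C (2 * \<alpha>) \<alpha> (2 * \<beta>)"
    and \<gamma>: "\<gamma> = 4 * pi / 7" "\<alpha> = 2 * \<gamma> - pi" "\<beta> = 2 * pi - 3 * \<gamma>"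
  shows "similar_sets (tri A B C) (tri P Q R)"
proof -
  have nc: "\<not> collinear {P, Q, R}" "\<not> collinear {B, A, C}"
    using tile ABC by (auto simp: triangle_with_angles_def insert_commute)
  have eq: "2 * \<alpha> = \<beta>" "2 * \<beta> = \<gamma>" using \<gamma> by simp_all
  have ang: "angle Q P R = \<alpha>" "angle P Q R = \<beta>" "angle P R Q = \<gamma>"
    "angle A B C = \<alpha>" "angle B A C = \<beta>" "angle B C A = \<gamma>"
    using tile ABC angle_commute eq by (auto simp: triangle_with_angles_def)
  note T = law_of_sines[OF nc(1), unfolded ang] and U = law_of_sines[OF nc(2), unfolded ang]
  have pos: "dist P Q > 0" "dist Q R > 0" "dist P R > 0" "dist B A > 0" "dist A C > 0" "dist B C > 0"
    using T(5-7) U(5-7) by simp_all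
  have sin: "sin \<alpha> > 0" "sin \<beta> > 0" "sin \<gamma> > 0"
    using T(1-4) pos by (metis mult_pos_pos zero_less_mult_pos)+
  define k where "k = dist B A / dist P Q"
  have k: "k > 0" "dist B A = k * dist P Q" using pos by (simp_all add: k_def)
  have "dist Q R * (dist P R * sin \<gamma>) = dist Q R * (dist P Q * sin \<beta>)"
    using T(3,4) by (metis mult.assoc mult.commute)
  moreover have "dist P R * (dist Q R * sin \<gamma>) = dist P R * (dist P Q * sin \<alpha>)"
    using T(2,4) by (metis mult.assoc mult.commute)
  ultimately have t: "dist P R * sin \<gamma> = dist P Q * sin \<beta>" "dist Q R * sin \<gamma> = dist P Q * sin \<alpha>"
    using pos by simp_all
  have "dist A C * (dist B C * sin \<gamma>) = dist A C * (dist B A * sin \<beta>)"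
    using U(3,4) by (metis mult.assoc mult.commute)
  moreover have "dist B C * (dist A C * sin \<gamma>) = dist B C * (dist B A * sin \<alpha>)"
    using U(2,4) by (metis mult.assoc mult.commute)
  ultimately have u: "dist B C * sin \<gamma> = dist B A * sin \<beta>" "dist A C * sin \<gamma> = dist B A * sin \<alpha>"
    using pos by simp_all
  have "dist B C * sin \<gamma> = (k * dist P R) * sin \<gamma>" using u(1) t(1) k(2) by (simp add: mult.assoc)
  hence 1: "dist B C = k * dist P R" using sin by simp
  have "dist A C * sin \<gamma> = (k * dist Q R) * sin \<gamma>" using u(2) t(2) k(2) by (simp add: mult.assoc)
  hence 2: "dist A C = k * dist Q R" using sin by simp
  have "similar_sets (tri B A C) (tri P Q R)"
    by (rule similar_setsI[OF nc(1) k(1)]) (use k 1 2 in \<open>simp_all add: dist_commute\<close>)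
  moreover have "tri B A C = tri A B C" by (simp add: tri_def insert_commute)
  ultimately show ?thesis by simp
qed

theorem theorem9:
  fixes A B C P Q R :: point
    and \<alpha> \<beta> \<gamma> a b c s :: real
    and N :: nat and M :: int
    and \<T> Black :: "point set set"
  assumes tile: "triangle_with_angles P Q R \<alpha> \<beta> \<gamma>"
    and sides: "a = dist Q R" "b = dist R P" "c = dist P Q"
    and ABC: "triangle_with_angles A B C (2 * \<alpha>) \<alpha> (2 * \<beta>)"
    and not_similar: "\<not> similar_sets (tri A B C) (tri P Q R)"
    and tiling: "tiling N \<T> (tri A B C) (tri P Q R)"
    and coloring: "colored_alternately \<T> Black"
    and black_at_B: "\<exists>t\<in>Black. B \<in> t"
    and M: "M = int (card Black) - int (card (\<T> - Black))"
    and s: "s = a / c"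
  shows "s \<in> \<rat> \<and>
    real N / (real_of_int M)\<^sup>2 = ((2 - s\<^sup>2) * (3 - s\<^sup>2)) / ((1 - s)\<^sup>2 * (2 + s)\<^sup>2)"
proof -
  note geo = sides_via_s[OF tile sides ABC s]
  have fin: "finite \<T>" and U: "\<Union>\<T> = tri A B C" and cong: "\<forall>t\<in>\<T>. congruent_sets t (tri P Q R)"
    and ov: "\<forall>t\<in>\<T>. \<forall>u\<in>\<T>. t \<noteq> u \<longrightarrow> t \<inter> u \<subseteq> frontier t \<inter> frontier u"
    using tiling by (simp_all add: tiling_def)
  have Black: "Black \<subseteq> \<T>" and alternate: "\<And>t u. t \<in> \<T> \<Longrightarrow> u \<in> \<T> \<Longrightarrow> t \<noteq> u \<Longrightarrow>
      \<exists>x y. x \<noteq> y \<and> closed_segment x y \<subseteq> frontier t \<inter> frontier u \<Longrightarrow> t \<in> Black \<longleftrightarrow> u \<notin> Black"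
    using coloring by (simp_all add: colored_alternately_def)
  have angles: "angle B A C = 2 * \<alpha>" "angle C B A = \<alpha>" "angle A C B = 2 * \<beta>"
    using ABC by (simp_all add: triangle_with_angles_def)
  have "\<forall>t\<in>\<T>. \<exists>F. tile_shape \<alpha> \<beta> \<gamma> a b c t F"
    using tile_shape_exists[OF tile sides] cong by blast
  then obtain E where E: "\<And>t. t \<in> \<T> \<Longrightarrow> tile_shape \<alpha> \<beta> \<gamma> a b c t (E t)" using bchoice[of \<T>] by metis
  have nc: "ccw A B C \<or> ccw A C B"
    using ABC not_collinear_ccw by (simp add: triangle_with_angles_def)
  define ES where "ES = (if ccw A B C then ccw_edges A B C else ccw_edges A C B)"
  have "tri A C B = tri A B C" by (simp add: tri_def insert_commute)
  hence ES: "is_ccw_triangle (tri A B C) ES"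
    using nc unfolding is_ccw_triangle_def ES_def by metis
  have "is_ccw_triangle t (E t)" if "t \<in> \<T>" for t
    using tile_shape_is_ccw_triangle[OF E[OF that]] .
  then interpret T: ccw_tiling \<T> "tri A B C" E ES
    by unfold_locales (use fin U ov ES in auto)
  note c = \<open>c > 0\<close>
  have s1: "0 < s" "s < 1" by fact+
  have "s\<^sup>2 < 1" using s1 by (simp add: power_less_one_iff)
  define y where "y = dist A C / c"
  have y: "y > 0" "dist A C = c * y" using c \<open>dist A C > 0\<close> by (simp_all add: y_def)
  have BC: "dist B C = c * ((2 - s\<^sup>2) * y)" and AB: "dist A B = c * ((1 - s\<^sup>2) * (3 - s\<^sup>2) * y)"
    using geo(13,14) y(2) by simp_all
  have ac: "a = c * s" using s c by simp
  have bc: "b = c * (1 - s\<^sup>2)" by fact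
  have N: "real N = y\<^sup>2 * ((2 - s\<^sup>2) * (3 - s\<^sup>2))"
  proof -
    have "\<not> collinear {P, Q, R}" using tile by (simp add: triangle_with_angles_def)
    hence "dist A B * dist A C * (sin \<alpha> * (2 - s\<^sup>2)) = real N * (c * b * sin \<alpha>)"
      using tiling_area[OF tiling] unfolding geo(15,16) by blast
    hence "(c * c * sin \<alpha> * (1 - s\<^sup>2)) * (y\<^sup>2 * ((2 - s\<^sup>2) * (3 - s\<^sup>2))) = (c * c * sin \<alpha> * (1 - s\<^sup>2)) * real N"
      unfolding AB y(2) bc by (simp only: power2_eq_square mult_ac)
    moreover have "c * c * sin \<alpha> * (1 - s\<^sup>2) \<noteq> 0" using c geo(17) \<open>s\<^sup>2 < 1\<close> by simp
    ultimately show ?thesis by simp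
  qed
  show ?thesis
  proof (cases "\<gamma> / pi \<in> \<rat>")
    case True
    have len: "elen e \<in> {a, b, c}" if "t \<in> \<T>" "e \<in> E t" for t e using tile_shape_elen E that by blast
    have combination: "\<exists>u v w. elen f = real u * a + real v * b + real w * c" if "f \<in> ES" for f
      by (rule T.boundary_edge_nat_combination) (use len that in auto)
    have "\<exists>f\<in>ES. elen f = dist A C"
      by (auto simp: ES_def ccw_edges_def dist_norm norm_minus_commute)
    then obtain u v w where "dist A C = real u * a + real v * b + real w * c"
      using combination by metis
    hence "c * y = c * (real u * s + real v * (1 - s\<^sup>2) + real w)"
      unfolding y(2) ac bc by (simp add: algebra_simps)
    hence yuvw: "y = real u * s + real v * (1 - s\<^sup>2) + real w" using c by simp
    have "\<exists>f\<in>ES. elen f = dist B C"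
      by (auto simp: ES_def ccw_edges_def dist_norm norm_minus_commute)
    then obtain p q r where "dist B C = real p * a + real q * b + real r * c"
      using combination by metis
    hence "c * ((2 - s\<^sup>2) * y) = c * (real p * s + real q * (1 - s\<^sup>2) + real r)"
      unfolding BC ac bc by (simp add: algebra_simps)
    hence xpqr: "(2 - s\<^sup>2) * y = real p * s + real q * (1 - s\<^sup>2) + real r" using c by simp
    \<comment> \<open>Halved so that \<open>\<gamma>\<close> becomes \<open>2 * pi * k / n\<close>,
      the argument of an \<open>n\<close>-th root of unity.\<close>
    have "\<gamma> / pi / 2 \<in> \<rat>" by (rule Rats_divide[OF True]) simp
    then obtain k n :: nat where kn: "n \<noteq> 0" "\<bar>\<gamma> / pi / 2\<bar> = real k / real n" "coprime k n"
      by (rule Rats_abs_nat_div_natE)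
    have \<gamma>_pos: "\<gamma> > 0" using geo(3) pi_gt_zero by linarith
    hence g: "\<gamma> = 2 * pi * real k / real n" using kn(2) by (simp add: field_simps)
    have "pi * real n < pi * (4 * real k)" "pi * (3 * real k) < pi * real n"
      using geo(3,4) kn(1) unfolding g by (simp_all add: field_simps)
    hence "real n < 4 * real k" "3 * real k < real n" by simp_all
    hence "n < 4 * k" "3 * k < n" by linarith+
    hence "n = 7 \<and> k = 2"
      using rational_multiple_of_pi_case[OF kn(3) _ _ _ s1 y(1) yuvw xpqr N] geo(8) unfolding g by simp
    hence "\<gamma> = 4 * pi / 7" using g by simp
    hence "similar_sets (tri A B C) (tri P Q R)"
      using rational_angle_similar[OF tile ABC] geo(1,2) by blast
    thus ?thesis using not_similar by simp
  next
    case irrational: False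
    \<comment> \<open>The direction of the side between \<open>A\<close> and \<open>B\<close> when
      \<open>ABC\<close> is traversed counterclockwise; normalizing its weight to 1 fixes the
      weights of the other two sides.\<close>
    define d where "d = (if ccw A B C then cx (sgn (B - A)) else cx (sgn (A - B)))"
    have "A \<noteq> B" using nc ccw_distinct by metis
    hence d: "d \<noteq> 0" by (simp add: d_def sgn_zero_iff)
    have weights: "\<exists>G (\<kappa> :: point set \<Rightarrow> int). (\<forall>z. G (- z) = - G z) \<and>
        (\<forall>t\<in>\<T>. \<kappa> t \<in> {- 1, 0, 1} \<and> (\<eta> = - 1 \<longrightarrow> (\<forall>e\<in>E t. G (cx (sgn (evec e))) = real_of_int (\<kappa> t)))) \<and>
        dist A B + dist B C - dist A C = (\<Sum>t\<in>\<T>. \<kappa> t) * (c + b - \<eta> * a)"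
      if \<eta>: "\<eta> \<in> {1, - 1}" for \<eta> :: real
    proof -
      obtain G :: "complex \<Rightarrow> real" where G: "\<And>z. G (- z) = - G z" "\<And>z. G (cis \<gamma> * z) = \<eta> * G z"
        "\<And>z. G (cis (- \<gamma>) * z) = \<eta> * G z" "G d = 1" "\<And>z. G z \<in> {- 1, 0, 1}"
        using direction_weight_exists[OF irrational d \<eta>] by blast
      interpret W: direction_weight G \<eta> \<alpha> \<beta> \<gamma>
        by unfold_locales (fact G \<eta> geo)+
      have "\<forall>t\<in>\<T>. \<exists>k::int. k \<in> {- 1, 0, 1} \<and>
          (\<Sum>e\<in>E t. G (cx (sgn (evec e))) * elen e) = k * (c + b - \<eta> * a) \<and>
          (\<eta> = - 1 \<longrightarrow> (\<forall>e\<in>E t. G (cx (sgn (evec e))) = real_of_int k))"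
      proof
        fix t assume "t \<in> \<T>"
        then obtain z where z: "(\<Sum>e\<in>E t. G (cx (sgn (evec e))) * elen e) = G z * (c + b - \<eta> * a)"
          "\<eta> = - 1 \<longrightarrow> (\<forall>e\<in>E t. G (cx (sgn (evec e))) = G z)"
          using W.tile_weight[OF E] by blast
        have "\<exists>k::int. k \<in> {- 1, 0, 1} \<and> G z = real_of_int k"
          using G(5)[of z] by (auto intro: exI[of _ "- 1"] exI[of _ 0] exI[of _ 1])
        then obtain k :: int where "k \<in> {- 1, 0, 1}" "G z = real_of_int k" by blast
        thus "\<exists>k::int. k \<in> {- 1, 0, 1} \<and>
          (\<Sum>e\<in>E t. G (cx (sgn (evec e))) * elen e) = k * (c + b - \<eta> * a) \<and>
          (\<eta> = - 1 \<longrightarrow> (\<forall>e\<in>E t. G (cx (sgn (evec e))) = real_of_int k))"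
          using z by (intro exI[of _ k]) simp
      qed
      then obtain \<kappa> :: "point set \<Rightarrow> int" where \<kappa>: "\<forall>t\<in>\<T>. \<kappa> t \<in> {- 1, 0, 1} \<and>
          (\<Sum>e\<in>E t. G (cx (sgn (evec e))) * elen e) = \<kappa> t * (c + b - \<eta> * a) \<and>
          (\<eta> = - 1 \<longrightarrow> (\<forall>e\<in>E t. G (cx (sgn (evec e))) = real_of_int (\<kappa> t)))"
        by (rule bchoice[THEN exE])
      have "dist A B + dist B C - dist A C = (\<Sum>e\<in>ES. G (cx (sgn (evec e))) * elen e)"
      proof (cases "ccw A B C")
        case True
        thus ?thesis using W.outer_weight[OF True angles] G(4) by (simp add: ES_def d_def)
      next
        case False
        hence "ccw A C B" using nc by blast
        thus ?thesis using W.outer_weight'[OF _ angles] G(4) False by (simp add: ES_def d_def)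
      qed
      also have "\<dots> = (\<Sum>t\<in>\<T>. \<Sum>e\<in>E t. G (cx (sgn (evec e))) * elen e)"
        by (rule T.odd_weight_sum[of "\<lambda>u. G (cx u)", symmetric]) (simp add: G(1))
      also have "\<dots> = (\<Sum>t\<in>\<T>. \<kappa> t * (c + b - \<eta> * a))"
        using \<kappa> by (intro sum.cong) auto
      finally have "dist A B + dist B C - dist A C = (\<Sum>t\<in>\<T>. \<kappa> t) * (c + b - \<eta> * a)"
        by (simp add: sum_distrib_right)
      thus ?thesis using G(1) \<kappa> by blast
    qed
    have "- 1 \<in> {1, - 1::real}" "1 \<in> {1, - 1::real}" by simp_all
    note weights_at = weights[OF this(1)] weights[OF this(2)]
    obtain G :: "complex \<Rightarrow> real" and \<kappa> :: "point set \<Rightarrow> int" where G: "\<forall>z. G (- z) = - G z"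
      and \<kappa>: "\<forall>t\<in>\<T>. \<kappa> t \<in> {- 1, 0, 1} \<and> ((- 1 :: real) = - 1 \<longrightarrow> (\<forall>e\<in>E t. G (cx (sgn (evec e))) = real_of_int (\<kappa> t)))"
      and sum0: "dist A B + dist B C - dist A C = (\<Sum>t\<in>\<T>. \<kappa> t) * (c + b - (- 1) * a)"
      using weights_at(1) by blast
    have \<kappa>_range: "\<kappa> t \<in> {- 1, 0, 1}" if "t \<in> \<T>" for t using \<kappa> that by blast
    have \<kappa>_edge: "G (cx (sgn (evec e))) = real_of_int (\<kappa> t)" if "t \<in> \<T>" "e \<in> E t" for t e
      using \<kappa> that by blast
    obtain \<kappa>1 :: "point set \<Rightarrow> int" where sum1: "dist A B + dist B C - dist A C = (\<Sum>t\<in>\<T>. \<kappa>1 t) * (c + b - 1 * a)"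
      using weights_at(2) by blast
    define M0 where "M0 = (\<Sum>t\<in>\<T>. \<kappa> t)"
    define M1 where "M1 = (\<Sum>t\<in>\<T>. \<kappa>1 t)"
    have lhs: "dist A B + dist B C - dist A C = c * (y * ((2 - s\<^sup>2) + (1 - s\<^sup>2) * (3 - s\<^sup>2) - 1))"
      unfolding AB BC y(2) by (simp add: algebra_simps)
    have "c * (y * ((2 - s\<^sup>2) + (1 - s\<^sup>2) * (3 - s\<^sup>2) - 1)) = c * (M0 * (1 + (1 - s\<^sup>2) + s))"
      using sum0 unfolding lhs M0_def[symmetric] ac bc by (simp add: algebra_simps)
    hence eq0: "y * ((2 - s\<^sup>2) + (1 - s\<^sup>2) * (3 - s\<^sup>2) - 1) = M0 * (1 + (1 - s\<^sup>2) + s)" using c by simp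
    have "c * (y * ((2 - s\<^sup>2) + (1 - s\<^sup>2) * (3 - s\<^sup>2) - 1)) = c * (M1 * (1 + (1 - s\<^sup>2) - s))"
      using sum1 unfolding lhs M1_def[symmetric] ac bc by (simp add: algebra_simps)
    hence eq1: "y * ((2 - s\<^sup>2) + (1 - s\<^sup>2) * (3 - s\<^sup>2) - 1) = M1 * (1 + (1 - s\<^sup>2) - s)" using c by simp
    \<comment> \<open>A priori all tiles might have weight 0. Since \<open>AB + BC > AC\<close> in
      the explicit form below, this does not happen, and \<open>K\<close> will be 1 or
      \<open>- 1\<close>.\<close>
    have M0: "M0 \<noteq> 0"
    proof
      assume "M0 = 0"
      moreover have "(2 - s\<^sup>2) + (1 - s\<^sup>2) * (3 - s\<^sup>2) - 1 = (1 - s\<^sup>2) * (4 - s\<^sup>2)"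
        by (simp add: algebra_simps)
      ultimately have "y * ((1 - s\<^sup>2) * (4 - s\<^sup>2)) = 0" using eq0 by simp
      thus False using y(1) \<open>s\<^sup>2 < 1\<close> by simp
    qed
    define col :: "point set \<Rightarrow> int" where "col = (\<lambda>t. if t \<in> Black then 1 else - 1)"
    obtain t0 where t0: "t0 \<in> \<T>" using black_at_B Black by blast
    \<comment> \<open>Across a shared segment the directions are opposite and so are the colours, so
      the product of weight and colour does not change.\<close>
    have const: "\<kappa> t * col t = \<kappa> t0 * col t0" if t: "t \<in> \<T>" for t
    proof (rule T.constant_across_edges[OF _ t0 t])
      fix t u e f assume *: "t \<in> \<T>" "u \<in> \<T>" "t \<noteq> u" "e \<in> E t" "f \<in> E u" "sgn (evec f) = - sgn (evec e)"
        "\<exists>y z. y \<noteq> z \<and> closed_segment y z \<subseteq> frontier t \<inter> frontier u"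
      have "col u = - col t" using alternate[OF *(1-3,7)] by (auto simp: col_def)
      moreover have "real_of_int (\<kappa> u) = - real_of_int (\<kappa> t)"
        using \<kappa>_edge[OF *(1,4)] \<kappa>_edge[OF *(2,5)] *(6) G by simp
      hence "\<kappa> u = - \<kappa> t" by linarith
      ultimately show "\<kappa> t * col t = \<kappa> u * col u" by simp
    qed
    define K where "K = \<kappa> t0 * col t0"
    have "M0 = (\<Sum>t\<in>\<T>. K * col t)"
    proof -
      have "\<kappa> t = K * col t" if "t \<in> \<T>" for t
        using const[OF that, folded K_def] by (auto simp: col_def split: if_splits)
      thus ?thesis unfolding M0_def by (intro sum.cong) auto
    qed
    also have "\<dots> = K * (\<Sum>t\<in>\<T>. col t)" by (simp add: sum_distrib_left)
    also have "(\<Sum>t\<in>\<T>. col t) = M"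
    proof -
      have "(\<Sum>t\<in>\<T>. col t) = (\<Sum>t\<in>\<T> - Black. col t) + (\<Sum>t\<in>Black. col t)"
        by (rule sum.subset_diff[OF Black fin])
      thus ?thesis by (simp add: M col_def)
    qed
    finally have "M0 = K * M" .
    \<comment> \<open>The sign of \<open>K\<close> remains open, but only \<open>M\<^sup>2\<close>
      occurs in the claim.\<close>
    moreover have "K \<in> {- 1, 0, 1}" using \<kappa>_range[OF t0] by (auto simp: K_def col_def)
    ultimately have "M0\<^sup>2 = M\<^sup>2" using M0 by auto
    hence "(real_of_int M0)\<^sup>2 = (real_of_int M)\<^sup>2" by (metis of_int_power)
    thus ?thesis using irrational_case_algebra[OF s1 y(1) N eq0 eq1] by simp
  qed
qed

end
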